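(* Let $\mathfrak g=sl(4)$. The following vector $v$ is a singular vector of weight $-\frac52\Lambda_0-4\delta+2\omega_2$ in $V^{-5/2}(\mathfrak g)$ (where, for $x\in\mathfrak g$, we abbreviate $x=x(-1)$, $\dot x=x(-2)$, $\ddot x=x(-3)$, and products of operators are taken in the written order): $$\begin{aligned}v=\Big(&e_{13}\ddot e_{24}+\ddot e_{13}e_{24}+\tfrac12\dot e_{13}\dot e_{24}-e_{14}\ddot e_{23}-\ddot e_{14}e_{23}-\tfrac12\dot e_{14}\dot e_{23}+e_{24}\dot e_{23}e_{12}-\dot e_{24}e_{23}e_{12}\\&-e_{13}\dot e_{23}e_{34}-3\dot e_{13}e_{23}e_{34}+2e_{12}e_{23}^2e_{34}-e_{13}\dot e_{24}(h_1+h_2)-\dot e_{13}e_{24}(h_2+h_3)\\&+e_{14}\dot e_{23}(h_1+h_2+h_3)+\dot e_{14}e_{23}h_2\\&+\tfrac23e_{13}e_{24}\big[-\dot h_2+h_1h_2-h_1h_3+h_2^2+h_2h_3-e_{12}f_{12}+2e_{13}f_{13}+2e_{14}f_{14}+2e_{23}f_{23}+2e_{24}f_{24}-e_{34}f_{34}\big]\\&+\tfrac23e_{14}e_{23}\big[\dot h_2-h_1h_2-2h_1h_3-h_2^2-h_2h_3+e_{12}f_{12}-2e_{13}f_{13}-2e_{14}f_{14}-2e_{23}f_{23}-2e_{24}f_{24}+e_{34}f_{34}\big]\\&-2e_{24}e_{23}e_{12}h_3+2e_{13}e_{23}e_{34}h_1+2e_{13}e_{14}f_{12}h_3+e_{13}\dot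 e_{14}f_{12}-\dot e_{13}e_{14}f_{12}-2e_{13}^2e_{34}f_{12}\\&-2e_{14}e_{24}f_{34}h_1+e_{14}\dot e_{24}f_{34}-\dot e_{14}e_{24}f_{34}-2e_{24}^2e_{12}f_{34}+2e_{14}^2f_{12}f_{34}\Big)\mathbf 1.\end{aligned}$$
   Context: $V^{-5/2}(\mathfrak g)$ is the universal affine vertex algebra of $\mathfrak g=sl(4)$ at level $-5/2$, with vacuum $\mathbf 1$; $x(n)=x\otimes t^n\in\widehat{\mathfrak g}$. Standard root vectors: $e_{ij}=e_{\varepsilon_i-\varepsilon_j}=E_{ij}$, $f_{ij}=f_{\varepsilon_i-\varepsilon_j}=E_{ji}$ for $1\le i<j\le4$; $h_i=E_{ii}-E_{i+1,i+1}$; $\omega_2$ is the second fundamental weight. A singular vector is a (nonzero) weight vector annihilated by $e_{i,i+1}(0)$, $i=1,2,3$, and by $f_{14}(1)$. The weight $-\frac52\Lambda_0-4\delta+2\omega_2$ means level $-\frac52$, conformal weight $4$, and $\mathfrak g$-weight $2\omega_2$. *)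

theory Defs
  imports "HOL-Analysis.Analysis" "HOL-Library.Poly_Mapping"
begin

section \<open>The Lie algebra \<open>sl(4)\<close> over the complex numbers\<close>

typedef sl4 = "{A :: complex^4^4. trace A = 0}"
  morphisms mat_of_sl4 Abs_sl4
  by (rule exI[of _ 0]) (simp add: trace_def)

setup_lifting type_definition_sl4

instantiation sl4 :: ab_group_add
begin

lift_definition zero_sl4 :: sl4 is 0 by (simp add: trace_def)
lift_definition plus_sl4 :: "sl4 \<Rightarrow> sl4 \<Rightarrow> sl4" is "(+)" by (simp add: trace_add)
lift_definition minus_sl4 :: "sl4 \<Rightarrow> sl4 \<Rightarrow> sl4" is "(-)" by (simp add: trace_sub)
lift_definition uminus_sl4 :: "sl4 \<Rightarrow> sl4" is uminus by (simp add: trace_def sum_negf)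

instance
  by standard (transfer; simp add: algebra_simps)+

end

lift_definition scale_sl4 :: "complex \<Rightarrow> sl4 \<Rightarrow> sl4" is "\<lambda>c A. \<chi> i j. c * A $ i $ j"
  by (simp add: trace_def flip: sum_distrib_left)

lift_definition bracket_sl4 :: "sl4 \<Rightarrow> sl4 \<Rightarrow> sl4" is "\<lambda>A B. A ** B - B ** A"
  by (simp add: trace_sub) (rule trace_mul_sym)

text \<open>The normalized invariant form, for which long roots have square length 2, is the trace form.\<close>

definition form_sl4 :: "sl4 \<Rightarrow> sl4 \<Rightarrow> complex" where
  "form_sl4 x y = trace (mat_of_sl4 x ** mat_of_sl4 y)"

text \<open>Rows and columns are indexed by the type \<open>4\<close>, whose elements are \<open>1, 2, 3, 4\<close>
  (as integers modulo 4, so \<open>4 = 0\<close>).\<close>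

definition matrix_unit :: "4 \<Rightarrow> 4 \<Rightarrow> complex^4^4" where
  "matrix_unit i j = (\<chi> a b. if a = i \<and> b = j then 1 else 0)"

text \<open>The matrix unit \<open>E\<^sub>i\<^sub>j\<close> as an element of \<open>sl(4)\<close>; only used for \<open>i \<noteq> j\<close>.\<close>

lift_definition root_vector :: "4 \<Rightarrow> 4 \<Rightarrow> sl4" is
  "\<lambda>i j. if i = j then 0 else matrix_unit i j"
  by (auto simp: trace_def matrix_unit_def intro!: sum.neutral)

lift_definition coroot :: "4 \<Rightarrow> sl4" is
  "\<lambda>i. matrix_unit i i - matrix_unit (i + 1) (i + 1)"
  by (simp add: trace_sub) (simp add: trace_def matrix_unit_def)


section \<open>The affine Lie algebra\<close>

text \<open>A triple \<open>(p, a, b)\<close> stands for \<open>(\<Sum>n. p(n) \<otimes> t\<^sup>n) + a K + b d\<close>, where \<open>K\<close> is the central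
  element and \<open>d\<close> is the derivation \<open>t d/dt\<close>, which measures the coefficient of \<open>\<delta>\<close> in a weight.\<close>

type_synonym affine = "(int \<Rightarrow>\<^sub>0 sl4) \<times> complex \<times> complex"

definition mode :: "sl4 \<Rightarrow> int \<Rightarrow> affine" where
  "mode x n = (Poly_Mapping.single n x, 0, 0)"

definition central_K :: affine where "central_K = (0, 1, 0)"

definition derivation_d :: affine where "derivation_d = (0, 0, 1)"

definition scale_loop :: "complex \<Rightarrow> (int \<Rightarrow>\<^sub>0 sl4) \<Rightarrow> (int \<Rightarrow>\<^sub>0 sl4)" where
  "scale_loop c p = Poly_Mapping.map (scale_sl4 c) p"

definition bracket_loop :: "(int \<Rightarrow>\<^sub>0 sl4) \<Rightarrow> (int \<Rightarrow>\<^sub>0 sl4) \<Rightarrow> (int \<Rightarrow>\<^sub>0 sl4)" where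
  "bracket_loop p q =
     (\<Sum>m\<in>Poly_Mapping.keys p. \<Sum>n\<in>Poly_Mapping.keys q.
        Poly_Mapping.single (m + n)
          (bracket_sl4 (Poly_Mapping.lookup p m) (Poly_Mapping.lookup q n)))"

definition euler_loop :: "(int \<Rightarrow>\<^sub>0 sl4) \<Rightarrow> (int \<Rightarrow>\<^sub>0 sl4)" where
  "euler_loop p =
     (\<Sum>n\<in>Poly_Mapping.keys p.
        Poly_Mapping.single n (scale_sl4 (of_int n) (Poly_Mapping.lookup p n)))"

definition cocycle_loop :: "(int \<Rightarrow>\<^sub>0 sl4) \<Rightarrow> (int \<Rightarrow>\<^sub>0 sl4) \<Rightarrow> complex" where
  "cocycle_loop p q =
     (\<Sum>m\<in>Poly_Mapping.keys p.
        of_int m * form_sl4 (Poly_Mapping.lookup p m) (Poly_Mapping.lookup q (- m)))"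

fun scale_affine :: "complex \<Rightarrow> affine \<Rightarrow> affine" where
  "scale_affine c (p, a, b) = (scale_loop c p, c * a, c * b)"

text \<open>\<open>[x(m), y(n)] = [x,y](m+n) + m \<delta>\<^sub>m\<^sub>+\<^sub>n\<^sub>,\<^sub>0 (x,y) K\<close>, \<open>[d, x(n)] = n x(n)\<close>, and \<open>K\<close> is central.\<close>

fun bracket_affine :: "affine \<Rightarrow> affine \<Rightarrow> affine" where
  "bracket_affine (p, a, b) (q, a', b') =
     (bracket_loop p q + scale_loop b (euler_loop q) - scale_loop b' (euler_loop p),
      cocycle_loop p q, 0)"


section \<open>The universal enveloping algebra\<close>

text \<open>Finitely supported complex functions on the free monoid of words, with the convolution
  product of \<^type>\<open>poly_mapping\<close>, form the free associative algebra on the letters.\<close>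

datatype 'a word = Word (letters: "'a list")

instantiation word :: (type) monoid_add
begin

definition zero_word :: "'a word" where "zero_word = Word []"
definition plus_word :: "'a word \<Rightarrow> 'a word \<Rightarrow> 'a word" where
  "plus_word u w = Word (letters u @ letters w)"

instance
  by standard (simp_all add: zero_word_def plus_word_def)

end

type_synonym free_algebra = "affine word \<Rightarrow>\<^sub>0 complex"

definition generator :: "affine \<Rightarrow> free_algebra" where
  "generator x = Poly_Mapping.single (Word [x]) 1"

definition free_scalar :: "complex \<Rightarrow> free_algebra" where
  "free_scalar c = Poly_Mapping.single 0 c"

inductive_set two_sided_ideal :: "'r::ring_1 set \<Rightarrow> 'r set" for R where
  zero: "0 \<in> two_sided_ideal R"
| add: "r \<in> R \<Longrightarrow> u \<in> two_sided_ideal R \<Longrightarrow> a * r * b + u \<in> two_sided_ideal R"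

inductive_set left_ideal :: "'r::ring_1 set \<Rightarrow> 'r set" for R where
  zero: "0 \<in> left_ideal R"
| add: "r \<in> R \<Longrightarrow> u \<in> left_ideal R \<Longrightarrow> a * r + u \<in> left_ideal R"

definition envelope_relations :: "free_algebra set" where
  "envelope_relations =
     {generator (x + y) - generator x - generator y | x y. True} \<union>
     {generator (scale_affine c x) - free_scalar c * generator x | c x. True} \<union>
     {generator x * generator y - generator y * generator x - generator (bracket_affine x y) | x y. True}"

lemma two_sided_ideal_add:
  "u \<in> two_sided_ideal R \<Longrightarrow> w \<in> two_sided_ideal R \<Longrightarrow> u + w \<in> two_sided_ideal R"
  by (induction rule: two_sided_ideal.induct)
     (auto simp: add.assoc intro: two_sided_ideal.add)

lemma two_sided_ideal_mult:
  "u \<in> two_sided_ideal R \<Longrightarrow> c * u * e \<in> two_sided_ideal R"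
proof (induction rule: two_sided_ideal.induct)
  case (add r u a b)
  then have "(c * a) * r * (b * e) + c * u * e \<in> two_sided_ideal R"
    by (intro two_sided_ideal.add)
  then show ?case by (simp add: algebra_simps)
qed (simp add: two_sided_ideal.zero)

lemma left_ideal_add:
  "u \<in> left_ideal R \<Longrightarrow> w \<in> left_ideal R \<Longrightarrow> u + w \<in> left_ideal R"
  by (induction rule: left_ideal.induct) (auto simp: add.assoc intro: left_ideal.add)

lemma left_ideal_mult:
  "u \<in> left_ideal R \<Longrightarrow> c * u \<in> left_ideal R"
proof (induction rule: left_ideal.induct)
  case (add r u a)
  then have "(c * a) * r + c * u \<in> left_ideal R"
    by (intro left_ideal.add)
  then show ?case by (simp add: algebra_simps)
qed (simp add: left_ideal.zero)

lemma two_sided_ideal_diff_sym: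
  assumes "u - w \<in> two_sided_ideal R" shows "w - u \<in> two_sided_ideal R"
  using two_sided_ideal_mult[OF assms, of "- 1" 1] by simp

lemma left_ideal_diff_sym:
  assumes "u - w \<in> left_ideal R" shows "w - u \<in> left_ideal R"
  using left_ideal_mult[OF assms, of "- 1"] by simp

lemma two_sided_ideal_diff_trans:
  assumes "u - w \<in> two_sided_ideal R" "w - z \<in> two_sided_ideal R"
  shows "u - z \<in> two_sided_ideal R"
  using two_sided_ideal_add[OF assms] by simp

lemma left_ideal_diff_trans:
  assumes "u - w \<in> left_ideal R" "w - z \<in> left_ideal R"
  shows "u - z \<in> left_ideal R"
  using left_ideal_add[OF assms] by simp

text \<open>The constant coefficient is a counit, so the enveloping algebra is not the zero ring.\<close>

lemma lookup_times_zero_word: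
  fixes u w :: free_algebra
  shows "Poly_Mapping.lookup (u * w) 0 = Poly_Mapping.lookup u 0 * Poly_Mapping.lookup w 0"
proof -
  have split: "(l + q = 0) = (l = 0 \<and> q = 0)" for l q :: "affine word"
    by (cases l; cases q) (auto simp: zero_word_def plus_word_def)
  have inner: "(\<Sum>q. Poly_Mapping.lookup w q when l + q = 0)
      = (Poly_Mapping.lookup w 0 when l = 0)" for l
  proof (cases "l = 0")
    case True
    have "(\<lambda>q. Poly_Mapping.lookup w q when l + q = 0)
        = (\<lambda>q. Poly_Mapping.lookup w q when q = 0)"
      using True by (auto simp: fun_eq_iff split)
    then show ?thesis using True by simp
  qed (simp add: split)
  have coeff: "(\<lambda>l. Poly_Mapping.lookup u l * (Poly_Mapping.lookup w 0 when l = 0))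
      = (\<lambda>l. Poly_Mapping.lookup u l * Poly_Mapping.lookup w 0 when l = 0)"
    by (auto simp: fun_eq_iff when_def)
  have "Poly_Mapping.lookup (u * w) 0
      = (\<Sum>l. Poly_Mapping.lookup u l * (Poly_Mapping.lookup w 0 when l = 0))"
    by (simp add: lookup_mult inner eq_commute[of 0])
  then show ?thesis by (simp only: coeff Sum_any_when_equal)
qed

lemma two_sided_ideal_envelope_lookup_zero:
  "u \<in> two_sided_ideal envelope_relations \<Longrightarrow> Poly_Mapping.lookup u 0 = 0"
proof (induction rule: two_sided_ideal.induct)
  case (add r u a b)
  have gen: "Poly_Mapping.lookup (generator x) 0 = 0" for x
    by (simp add: generator_def lookup_single zero_word_def)
  have "Poly_Mapping.lookup r 0 = 0"
    using add.hyps(1)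
    by (auto simp: envelope_relations_def lookup_minus lookup_times_zero_word gen)
  then show ?case
    using add.IH by (simp add: lookup_add lookup_times_zero_word)
qed simp

quotient_type envelope = free_algebra /
  "\<lambda>u w. u - w \<in> two_sided_ideal envelope_relations"
proof (rule equivpI)
  show "reflp (\<lambda>u w. u - w \<in> two_sided_ideal envelope_relations)"
    by (rule reflpI) (simp add: two_sided_ideal.zero)
  show "symp (\<lambda>u w. u - w \<in> two_sided_ideal envelope_relations)"
    by (rule sympI) (rule two_sided_ideal_diff_sym)
  show "transp (\<lambda>u w. u - w \<in> two_sided_ideal envelope_relations)"
    by (rule transpI) (rule two_sided_ideal_diff_trans)
qed

instantiation envelope :: ring_1
begin

lift_definition zero_envelope :: envelope is 0 .
lift_definition one_envelope :: envelope is 1 .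

lift_definition plus_envelope :: "envelope \<Rightarrow> envelope \<Rightarrow> envelope" is "(+)"
  by (drule (1) two_sided_ideal_add) (simp add: algebra_simps)

lift_definition uminus_envelope :: "envelope \<Rightarrow> envelope" is uminus
  by (drule two_sided_ideal_diff_sym) simp

lift_definition minus_envelope :: "envelope \<Rightarrow> envelope \<Rightarrow> envelope" is "(-)"
  by (drule two_sided_ideal_add, erule two_sided_ideal_diff_sym) (simp add: algebra_simps)

lift_definition times_envelope :: "envelope \<Rightarrow> envelope \<Rightarrow> envelope" is "(*)"
proof -
  fix a b c e :: free_algebra
  assume ab: "a - b \<in> two_sided_ideal envelope_relations"
    and ce: "c - e \<in> two_sided_ideal envelope_relations"
  show "a * c - b * e \<in> two_sided_ideal envelope_relations"
    using two_sided_ideal_add[OF two_sided_ideal_mult[OF ab, of 1 c]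
        two_sided_ideal_mult[OF ce, of b 1]]
    by (simp add: algebra_simps)
qed

instance
proof
  show "(0::envelope) \<noteq> 1"
  proof (transfer, rule notI)
    assume "0 - 1 \<in> two_sided_ideal envelope_relations"
    then show False
      using two_sided_ideal_envelope_lookup_zero by (fastforce simp: lookup_minus)
  qed
qed (transfer; simp add: algebra_simps two_sided_ideal.zero)+

end

lift_definition emb :: "affine \<Rightarrow> envelope" is generator .

lift_definition scalar :: "complex \<Rightarrow> envelope" is free_scalar .


section \<open>The universal affine vertex algebra at level \<open>-5/2\<close>\<close>

text \<open>As a module over the affine Lie algebra, the universal affine vertex algebra of level \<open>k\<close> is
  induced from the one-dimensional module of the subalgebra spanned by the \<open>x(n)\<close> with
  \<open>n \<ge> 0\<close>, \<open>K\<close> and \<open>d\<close> on which \<open>K\<close> acts by \<open>k\<close> and everything else by 0, i.e. it is the quotient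
  of the enveloping algebra by the left ideal generated by the following elements. On it \<open>d\<close> acts
  as \<open>- L(0)\<close>: \<open>x\<^sub>1(- n\<^sub>1) \<dots> x\<^sub>r(- n\<^sub>r) 1\<close> has \<open>d\<close>-eigenvalue minus its conformal weight
  \<open>n\<^sub>1 + \<dots> + n\<^sub>r\<close>.\<close>

definition vacuum_relations :: "complex \<Rightarrow> envelope set" where
  "vacuum_relations k =
     {emb (mode x n) | x n. n \<ge> 0} \<union> {emb central_K - scalar k, emb derivation_d}"

definition level :: complex where "level = - 5 / 2"

lifting_forget envelope.lifting

quotient_type vacuum_module = envelope /
  "\<lambda>u w. u - w \<in> left_ideal (vacuum_relations level)"
proof (rule equivpI)
  show "reflp (\<lambda>u w. u - w \<in> left_ideal (vacuum_relations level))"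
    by (rule reflpI) (simp add: left_ideal.zero)
  show "symp (\<lambda>u w. u - w \<in> left_ideal (vacuum_relations level))"
    by (rule sympI) (rule left_ideal_diff_sym)
  show "transp (\<lambda>u w. u - w \<in> left_ideal (vacuum_relations level))"
    by (rule transpI) (rule left_ideal_diff_trans)
qed

instantiation vacuum_module :: ab_group_add
begin

lift_definition zero_vacuum_module :: vacuum_module is 0 .

lift_definition plus_vacuum_module :: "vacuum_module \<Rightarrow> vacuum_module \<Rightarrow> vacuum_module" is "(+)"
  by (drule (1) left_ideal_add) (simp add: algebra_simps)

lift_definition uminus_vacuum_module :: "vacuum_module \<Rightarrow> vacuum_module" is uminus
  by (drule left_ideal_diff_sym) simp

lift_definition minus_vacuum_module :: "vacuum_module \<Rightarrow> vacuum_module \<Rightarrow> vacuum_module" is "(-)"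
  by (drule left_ideal_add, erule left_ideal_diff_sym) (simp add: algebra_simps)

instance
  by standard (transfer; simp add: algebra_simps left_ideal.zero)+

end

lift_definition vacuum :: vacuum_module is 1 .

lift_definition act :: "envelope \<Rightarrow> vacuum_module \<Rightarrow> vacuum_module" (infixr \<open>\<bullet>\<^sub>U\<close> 72) is "(*)"
proof -
  fix u a b :: envelope
  assume "a - b \<in> left_ideal (vacuum_relations level)"
  from left_ideal_mult[OF this, of u] show "u * a - u * b \<in> left_ideal (vacuum_relations level)"
    by (simp add: algebra_simps)
qed

lemma act_one: "1 \<bullet>\<^sub>U v = v"
  by transfer (simp add: left_ideal.zero)

lemma act_mult: "(u * w) \<bullet>\<^sub>U v = u \<bullet>\<^sub>U w \<bullet>\<^sub>U v"
  by transfer (simp add: mult.assoc left_ideal.zero)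

lemma act_add_left: "(u + w) \<bullet>\<^sub>U v = u \<bullet>\<^sub>U v + w \<bullet>\<^sub>U v"
  by transfer (simp add: algebra_simps left_ideal.zero)

lemma act_add_right: "u \<bullet>\<^sub>U (v + v') = u \<bullet>\<^sub>U v + u \<bullet>\<^sub>U v'"
  by transfer (simp add: algebra_simps left_ideal.zero)


section \<open>Weights and singular vectors\<close>

definition cartan :: "affine set" where
  "cartan = {(Poly_Mapping.single 0 H, a, b) | H a b.
               \<forall>i j. i \<noteq> j \<longrightarrow> mat_of_sl4 H $ i $ j = 0}"

text \<open>Weights are represented as functions on the affine Lie algebra, of which only the values on
  the Cartan subalgebra matter.\<close>

definition weight_space :: "(affine \<Rightarrow> complex) \<Rightarrow> vacuum_module set" where
  "weight_space \<mu> = {v. \<forall>H\<in>cartan. emb H \<bullet>\<^sub>U v = scalar (\<mu> H) \<bullet>\<^sub>U v}"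

fun \<Lambda>\<^sub>0 :: "affine \<Rightarrow> complex" where "\<Lambda>\<^sub>0 (p, a, b) = a"

fun \<delta> :: "affine \<Rightarrow> complex" where "\<delta> (p, a, b) = b"

text \<open>\<open>\<omega>\<^sub>2 = \<epsilon>\<^sub>1 + \<epsilon>\<^sub>2\<close> on traceless diagonal matrices; it takes the values \<open>0, 1, 0\<close> on
  \<open>h\<^sub>1, h\<^sub>2, h\<^sub>3\<close>.\<close>

fun \<omega>\<^sub>2 :: "affine \<Rightarrow> complex" where
  "\<omega>\<^sub>2 (p, a, b) =
     mat_of_sl4 (Poly_Mapping.lookup p 0) $ 1 $ 1 + mat_of_sl4 (Poly_Mapping.lookup p 0) $ 2 $ 2"

definition ee :: "4 \<Rightarrow> 4 \<Rightarrow> int \<Rightarrow> envelope" where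
  "ee i j n = emb (mode (root_vector i j) n)"

definition ff :: "4 \<Rightarrow> 4 \<Rightarrow> int \<Rightarrow> envelope" where
  "ff i j n = emb (mode (root_vector j i) n)"

definition hh :: "4 \<Rightarrow> int \<Rightarrow> envelope" where
  "hh i n = emb (mode (coroot i) n)"

definition singular_vector_of_weight :: "(affine \<Rightarrow> complex) \<Rightarrow> vacuum_module \<Rightarrow> bool" where
  "singular_vector_of_weight \<mu> v \<longleftrightarrow>
     v \<noteq> 0 \<and> v \<in> weight_space \<mu> \<and>
     ee 1 2 0 \<bullet>\<^sub>U v = 0 \<and> ee 2 3 0 \<bullet>\<^sub>U v = 0 \<and> ee 3 4 0 \<bullet>\<^sub>U v = 0 \<and>
     ff 1 4 1 \<bullet>\<^sub>U v = 0"

end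

theory Submission
  imports Defs
begin

text \<open>Annihilation by the raising operators and the weight are obtained by rewriting in the vacuum
  module to Poincare--Birkhoff--Witt ordered words. This rewriting needs no linear independence of
  the ordered words, but the fact that the vector is nonzero does need a representation in which the
  level is \<open>-5/2\<close>. It comes from the embedding of the affine algebra into a central extension of
  infinite matrices over \<open>\<complex>\<^sup>4[t, t\<^sup>-\<^sup>1] = H\<^sub>- + H\<^sub>+\<close>, which acts on the big cell of the Grassmannian, the
  affine space of the maps \<open>Z\<close> from \<open>H\<^sub>+\<close> to \<open>H\<^sub>-\<close>, by vector fields
  \<open>Z \<mapsto> (P - Z) X (Q + Z)\<close>, where \<open>P\<close> and \<open>Q\<close> are the projections to \<open>H\<^sub>-\<close> and \<open>H\<^sub>+\<close>. Adding
  \<open>k tr (X Z)\<close> to such a vector field gives first order operators of level \<open>k\<close> on polynomial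
  functions of \<open>Z\<close>. Letting a word act on a polynomial from left to right and then evaluating at
  \<open>Z = 0\<close> is a functional which vanishes on the left ideal defining the vacuum module. For the fourth power of the
  linear form \<open>x(-1) \<mapsto> x\<^sub>1\<^sub>2 + x\<^sub>2\<^sub>3 + x\<^sub>3\<^sub>4\<close> it only sees the products of four
  factors \<open>x(-1)\<close>, among them the term \<open>2 e\<^sub>1\<^sub>2 e\<^sub>2\<^sub>3\<^sup>2 e\<^sub>3\<^sub>4\<close>.\<close>

section \<open>The enveloping algebra and the vacuum module\<close>

text \<open>Rewriting proves that elements of a quotient vanish, but not that one survives, so a
  functional has to detect the vector. Vector fields by themselves have level 0. The multiplier
  \<open>k tr (X Z)\<close> is the regularized logarithmic derivative of the \<open>k\<close>-th
  power of the determinant of the \<open>H_+\<close> block of the moved graph; as only this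
  infinitesimal form occurs, \<open>k\<close> may be any complex number. It respects brackets up to
  \<open>k\<close> times the standard cocycle of infinite matrices, which on loops is the affine
  one.

  Evaluation at \<open>Z = 0\<close> is chosen because the field there is \<open>P X Q\<close>, zero
  for every \<open>X\<close> that preserves \<open>H_+\<close>: nonnegative modes and
  \<open>d\<close>. Loop matrices are infinite, so the traces exist only because \<open>Z\<close>
  and the blocks of \<open>X\<close> between \<open>H_-\<close> and \<open>H_+\<close> are finite.

  The linear form adds the simple root coordinates because the quoted term is the only product of
  four simple root vectors in the vector. Negative modes act on its powers by plain differentiation,
  so the pairing is \<open>2 * 4!\<close> whatever the level; the level matters for vanishing on the
  ideal.\<close>

lemma poly_mapping_single_add_induct [case_names zero single add]:
  assumes "P 0" "\<And>k v. P (Poly_Mapping.single k v)" "\<And>u w. P u \<Longrightarrow> P w \<Longrightarrow> P (u + w)"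
  shows "P (u :: 'a \<Rightarrow>\<^sub>0 'b::ab_group_add)"
proof (induction u rule: update_induct)
  case (update g k v)
  \<comment> \<open>The induction rule supplies a key \<open>k\<close> outside
    \<open>keys g\<close>, so overwriting is adding.\<close>
  then have "Poly_Mapping.update k v g = g + Poly_Mapping.single k v"
    by (intro poly_mapping_eqI)
       (auto simp: lookup_update lookup_add lookup_single in_keys_iff when_def)
  with update assms show ?case by metis
qed (rule assms)

text \<open>The lifting setup of \<open>envelope\<close> is switched off so that
  \<open>transfer\<close> treats it as an opaque ring when working in the vacuum module. It returns
  only in this block, where the defining relations become equations in
  \<open>envelope\<close>.\<close>

context
  includes envelope.lifting
  notes [transfer_rule] = Quotient_rel_eq_transfer[OF Quotient_envelope]
    Quotient_right_total[OF Quotient_envelope] emb.transfer scalar.transfer zero_envelope.transfer one_envelope.transfer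
    plus_envelope.transfer minus_envelope.transfer times_envelope.transfer
begin

lemma two_sided_ideal_base: "r \<in> R \<Longrightarrow> r \<in> two_sided_ideal R"
  using two_sided_ideal.add[OF _ two_sided_ideal.zero, of r R 1 1] by simp

lemma emb_add: "emb (x + y) = emb x + emb y"
  by transfer (unfold diff_diff_eq[symmetric] envelope_relations_def,
    rule two_sided_ideal_base, blast)

lemma emb_scale: "emb (scale_affine c x) = scalar c * emb x"
  by transfer (unfold envelope_relations_def, rule two_sided_ideal_base, blast)

lemma emb_commutator: "emb x * emb y - emb y * emb x = emb (bracket_affine x y)"
  by transfer (unfold envelope_relations_def, rule two_sided_ideal_base, blast)

lemma scalar_0 [simp]: "scalar 0 = 0"
  by transfer (simp add: free_scalar_def two_sided_ideal.zero)

lemma scalar_1 [simp]: "scalar 1 = 1"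
  by transfer (simp add: free_scalar_def two_sided_ideal.zero)

lemma scalar_add: "scalar (c + d) = scalar c + scalar d"
  by transfer (simp add: free_scalar_def single_add two_sided_ideal.zero)

lemma scalar_mult: "scalar (c * d) = scalar c * scalar d"
  by transfer (simp add: free_scalar_def mult_single two_sided_ideal.zero)

lemma free_scalar_commute: "free_scalar c * u = u * free_scalar c"
proof (induction u rule: poly_mapping_single_add_induct)
  case (single k v)
  then show ?case by (simp add: free_scalar_def mult_single mult.commute)
qed (simp_all add: distrib_left distrib_right)

lemma scalar_commute: "u * scalar c = scalar c * u"
proof (induction u rule: envelope.abs_induct)
  case (1 u)
  show ?case
    by (simp add: scalar.abs_eq times_envelope.abs_eq free_scalar_commute)
qed

end

lemma scalar_minus: "scalar (- c) = - scalar c"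
  using scalar_add[of c "- c"] by (simp add: eq_neg_iff_add_eq_0 add.commute)

lemma scalar_of_nat: "scalar (of_nat n) = of_nat n"
  by (induction n) (auto simp: scalar_add)

lemma scalar_of_int: "scalar (of_int n) = of_int n"
  by (cases n) (auto simp: scalar_of_nat scalar_minus scalar_add simp flip: of_nat_Suc)

lemma scalar_numeral: "scalar (numeral n) = numeral n"
  using scalar_of_int[of "numeral n"] by simp

section \<open>The action on the vacuum module\<close>

lemma act_diff_left: "(u - w) \<bullet>\<^sub>U v = u \<bullet>\<^sub>U v - w \<bullet>\<^sub>U v"
  using act_add_left[of "u - w" w v] by (simp add: algebra_simps)

lemma act_zero_left [simp]: "0 \<bullet>\<^sub>U v = 0"
  using act_add_left[of 0 0 v] by simp

lemma act_zero_right [simp]: "u \<bullet>\<^sub>U 0 = 0"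
  using act_add_right[of u 0 0] by simp

lemma left_ideal_base: "r \<in> R \<Longrightarrow> r \<in> left_ideal R"
  using left_ideal.add[OF _ left_ideal.zero, of r R 1] by simp

lemma act_mode_vacuum: "n \<ge> 0 \<Longrightarrow> emb (mode x n) \<bullet>\<^sub>U vacuum = 0"
  by transfer (auto simp: vacuum_relations_def intro!: left_ideal_base)

lemma act_central_vacuum: "emb central_K \<bullet>\<^sub>U vacuum = scalar level \<bullet>\<^sub>U vacuum"
  by transfer (auto simp: vacuum_relations_def intro!: left_ideal_base)

lemma act_derivation_vacuum: "emb derivation_d \<bullet>\<^sub>U vacuum = 0"
  by transfer (auto simp: vacuum_relations_def intro!: left_ideal_base)

section \<open>Brackets of single modes\<close>

lemma mat_eq_iff: "x = y \<longleftrightarrow> (\<forall>i j. mat_of_sl4 x $ i $ j = mat_of_sl4 y $ i $ j)"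
  by (simp add: mat_of_sl4_inject[symmetric] vec_eq_iff)

lemma bracket_sl4_zero [simp]: "bracket_sl4 0 y = 0" "bracket_sl4 x 0 = 0"
  by (transfer, simp add: matrix_matrix_mult_def vec_eq_iff)+

lemma scale_sl4_zero [simp]: "scale_sl4 c 0 = 0" "scale_sl4 0 x = 0"
  by (transfer, simp add: vec_eq_iff)+

lemma form_sl4_zero [simp]: "form_sl4 0 y = 0" "form_sl4 x 0 = 0"
  by (simp_all add: form_sl4_def zero_sl4.rep_eq trace_def matrix_matrix_mult_def)

lemma lookup_scale_loop: "Poly_Mapping.lookup (scale_loop c p) n = scale_sl4 c (Poly_Mapping.lookup p n)"
  by (simp add: scale_loop_def Poly_Mapping.map.rep_eq when_def)

lemma scale_loop_zero [simp]: "scale_loop c 0 = 0" "scale_loop 0 p = 0"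
  by (auto intro!: poly_mapping_eqI simp: lookup_scale_loop)

lemma scale_loop_single: "scale_loop c (Poly_Mapping.single n x) = Poly_Mapping.single n (scale_sl4 c x)"
  by (rule poly_mapping_eqI) (simp add: lookup_scale_loop lookup_single when_def)

lemma bracket_loop_single:
  "bracket_loop (Poly_Mapping.single m x) (Poly_Mapping.single n y) =
     Poly_Mapping.single (m + n) (bracket_sl4 x y)"
  by (simp add: bracket_loop_def)

lemma euler_loop_single:
  "euler_loop (Poly_Mapping.single n x) = Poly_Mapping.single n (scale_sl4 (of_int n) x)"
  by (simp add: euler_loop_def)

lemma cocycle_loop_single:
  "cocycle_loop (Poly_Mapping.single m x) (Poly_Mapping.single n y) =
     (if m + n = 0 then of_int m * form_sl4 x y else 0)"
  by (auto simp: cocycle_loop_def lookup_single when_def)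

lemma scale_affine_mode: "scale_affine c (mode x n) = mode (scale_sl4 c x) n"
  by (simp add: mode_def scale_loop_single)

lemma scale_affine_central: "scale_affine c central_K = (0, c, 0)"
  by (simp add: central_K_def)

lemma scale_affine_derivation: "scale_affine c derivation_d = (0, 0, c)"
  by (simp add: derivation_d_def)

lemma emb_mode_add: "emb (mode (x + y) n) = emb (mode x n) + emb (mode y n)"
  by (simp add: mode_def single_add flip: emb_add)

lemma emb_mode_scale: "emb (mode (scale_sl4 c x) n) = scalar c * emb (mode x n)"
  by (simp add: scale_affine_mode flip: emb_scale)

lemma emb_zero [simp]: "emb 0 = 0"
  using emb_add[of 0 0] by simp

lemma zero_triple: "(0, 0, 0) = (0 :: affine)"
  by (simp add: zero_prod_def)

lemma emb_mode_zero [simp]: "emb (mode 0 n) = 0"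
  by (simp add: mode_def zero_triple)

lemma emb_decompose:
  "emb (Poly_Mapping.single n x, a, b) =
     emb (mode x n) + scalar a * emb central_K + scalar b * emb derivation_d"
  by (simp add: scale_affine_central scale_affine_derivation mode_def flip: emb_scale emb_add)

lemma emb_mode_commute:
  "emb (mode x m) * emb (mode y n) = emb (mode y n) * emb (mode x m) + emb (mode (bracket_sl4 x y) (m + n))
     + scalar (if m + n = 0 then of_int m * form_sl4 x y else 0) * emb central_K"
proof -
  have "bracket_affine (mode x m) (mode y n) =
      (Poly_Mapping.single (m + n) (bracket_sl4 x y), if m + n = 0 then of_int m * form_sl4 x y else 0, 0)"
    by (simp add: mode_def bracket_loop_single cocycle_loop_single)
  with emb_commutator[of "mode x m" "mode y n"] show ?thesis
    by (simp add: emb_decompose algebra_simps)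
qed

lemma emb_central_commute: "emb central_K * emb (mode y n) = emb (mode y n) * emb central_K"
  using emb_commutator[of central_K "mode y n"]
  by (simp add: central_K_def mode_def bracket_loop_def cocycle_loop_def euler_loop_def zero_triple)

lemma emb_derivation_commute:
  "emb derivation_d * emb (mode y n) = emb (mode y n) * emb derivation_d + scalar (of_int n) * emb (mode y n)"
proof -
  have "bracket_affine derivation_d (mode y n) = mode (scale_sl4 (of_int n) y) n"
  proof -
    have "scale_loop 1 (Poly_Mapping.single n z) = Poly_Mapping.single n z" for z
      by (simp add: scale_loop_single, rule arg_cong[where f = "Poly_Mapping.single n"])
         (simp add: mat_eq_iff scale_sl4.rep_eq)
    then show ?thesis
      by (simp add: derivation_d_def mode_def bracket_loop_def cocycle_loop_def euler_loop_single)
  qed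
  with emb_commutator[of derivation_d "mode y n"] show ?thesis
    by (simp add: emb_mode_scale algebra_simps)
qed

section \<open>Row- and column-finite matrices\<close>

text \<open>Multiplication by \<open>t^n\<close> on Laurent polynomials has infinitely many nonzero
  entries, so finite matrices would not do, while arbitrary infinite ones have no product.
  Finiteness of each row and each column is preserved by products and gives a ring.\<close>

typedef 'i rcf_matrix =
  "{A :: 'i \<Rightarrow> 'i \<Rightarrow> complex. (\<forall>i. finite {j. A i j \<noteq> 0}) \<and> (\<forall>j. finite {i. A i j \<noteq> 0})}"
  morphisms entry Abs_rcf_matrix
  by (rule exI[of _ "\<lambda>_ _. 0"]) simp

setup_lifting type_definition_rcf_matrix

lemma finite_row: "finite {j. entry A i j \<noteq> 0}" and finite_column: "finite {i. entry A i j \<noteq> 0}"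
  using entry[of A] by auto

lemma rcf_matrix_eqI: "(\<And>i j. entry A i j = entry B i j) \<Longrightarrow> A = B"
  by (metis entry_inject ext)

instantiation rcf_matrix :: (type) ring_1
begin

lift_definition zero_rcf_matrix :: "'a rcf_matrix" is "\<lambda>_ _. 0" by simp

lift_definition one_rcf_matrix :: "'a rcf_matrix" is "\<lambda>i j. if i = j then 1 else 0" by simp

lift_definition uminus_rcf_matrix :: "'a rcf_matrix \<Rightarrow> 'a rcf_matrix" is "\<lambda>A i j. - A i j" by simp

lift_definition plus_rcf_matrix :: "'a rcf_matrix \<Rightarrow> 'a rcf_matrix \<Rightarrow> 'a rcf_matrix"
  is "\<lambda>A B i j. A i j + B i j"
proof (intro conjI allI)
  fix A B :: "'a \<Rightarrow> 'a \<Rightarrow> complex" and k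
  assume *: "(\<forall>i. finite {j. A i j \<noteq> 0}) \<and> (\<forall>j. finite {i. A i j \<noteq> 0})"
    "(\<forall>i. finite {j. B i j \<noteq> 0}) \<and> (\<forall>j. finite {i. B i j \<noteq> 0})"
  show "finite {j. A k j + B k j \<noteq> 0}"
    by (rule finite_subset[of _ "{j. A k j \<noteq> 0} \<union> {j. B k j \<noteq> 0}"]) (use * in auto)
  show "finite {i. A i k + B i k \<noteq> 0}"
    by (rule finite_subset[of _ "{i. A i k \<noteq> 0} \<union> {i. B i k \<noteq> 0}"]) (use * in auto)
qed

definition minus_rcf_matrix :: "'a rcf_matrix \<Rightarrow> 'a rcf_matrix \<Rightarrow> 'a rcf_matrix"
  where "minus_rcf_matrix A B = A + - B"

lift_definition times_rcf_matrix :: "'a rcf_matrix \<Rightarrow> 'a rcf_matrix \<Rightarrow> 'a rcf_matrix"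
  is "\<lambda>A B i j. \<Sum>k | A i k \<noteq> 0. A i k * B k j"
proof (intro conjI allI)
  fix A B :: "'a \<Rightarrow> 'a \<Rightarrow> complex" and r
  assume *: "(\<forall>i. finite {j. A i j \<noteq> 0}) \<and> (\<forall>j. finite {i. A i j \<noteq> 0})"
    "(\<forall>i. finite {j. B i j \<noteq> 0}) \<and> (\<forall>j. finite {i. B i j \<noteq> 0})"
  have nonzero: "\<exists>k. A i k \<noteq> 0 \<and> B k j \<noteq> 0" if "(\<Sum>k | A i k \<noteq> 0. A i k * B k j) \<noteq> 0" for i j
    using sum.not_neutral_contains_not_neutral[OF that] by auto
  show "finite {j. (\<Sum>k | A r k \<noteq> 0. A r k * B k j) \<noteq> 0}"
    by (rule finite_subset[of _ "\<Union>k\<in>{k. A r k \<noteq> 0}. {j. B k j \<noteq> 0}"])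
       (use * in \<open>auto dest!: nonzero\<close>)
  show "finite {i. (\<Sum>k | A i k \<noteq> 0. A i k * B k r) \<noteq> 0}"
    by (rule finite_subset[of _ "\<Union>k\<in>{k. B k r \<noteq> 0}. {i. A i k \<noteq> 0}"])
       (use * in \<open>auto dest!: nonzero\<close>)
qed

text \<open>The index set may be the support of a row of \<open>A\<close> or of a column of
  \<open>B\<close>. Associativity needs both choices; distributivity over a sum on the left needs
  the second, because the row support of a sum is not that of its summands.\<close>

lemma entry_times_sum:
  assumes "finite S" "\<And>k. entry A i k \<noteq> 0 \<Longrightarrow> entry B k j \<noteq> 0 \<Longrightarrow> k \<in> S"
  shows "entry (A * B) i j = (\<Sum>k\<in>S. entry A i k * entry B k j)"
  unfolding times_rcf_matrix.rep_eq
  by (rule sum.mono_neutral_cong) (use assms finite_row in auto)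

instance
proof
  fix A B C :: "'a rcf_matrix"
  show "A * B * C = A * (B * C)"
  proof (rule rcf_matrix_eqI)
    fix i j
    let ?S = "{k. entry A i k \<noteq> 0}" and ?T = "{l. entry C l j \<noteq> 0}"
    have "entry (A * B * C) i j = (\<Sum>l\<in>?T. entry (A * B) i l * entry C l j)"
      by (rule entry_times_sum) (auto simp: finite_column)
    also have "\<dots> = (\<Sum>l\<in>?T. \<Sum>k\<in>?S. entry A i k * entry B k l * entry C l j)"
      by (simp add: entry_times_sum[of ?S] finite_row sum_distrib_right)
    also have "\<dots> = (\<Sum>k\<in>?S. entry A i k * entry (B * C) k j)"
      by (subst sum.swap) (simp add: entry_times_sum[of ?T] finite_column sum_distrib_left mult.assoc)
    also have "\<dots> = entry (A * (B * C)) i j"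
      by (rule entry_times_sum[symmetric]) (auto simp: finite_row)
    finally show "entry (A * B * C) i j = entry (A * (B * C)) i j" .
  qed
  show "A + B + C = A + (B + C)" "A + B = B + A" "0 + A = A" "- A + A = 0"
    by (rule rcf_matrix_eqI; simp add: plus_rcf_matrix.rep_eq zero_rcf_matrix.rep_eq uminus_rcf_matrix.rep_eq)+
  show "A - B = A + - B" by (simp add: minus_rcf_matrix_def)
  show "1 * A = A"
    by (rule rcf_matrix_eqI) (simp add: times_rcf_matrix.rep_eq one_rcf_matrix.rep_eq)
  show "A * 1 = A"
  proof (rule rcf_matrix_eqI)
    fix i j
    show "entry (A * 1) i j = entry A i j"
      by (subst entry_times_sum[of "{j}"]) (auto simp: one_rcf_matrix.rep_eq split: if_splits)
  qed
  show "(A + B) * C = A * C + B * C"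
  proof (rule rcf_matrix_eqI)
    fix i j
    let ?T = "{l. entry C l j \<noteq> 0}"
    have "entry (X * C) i j = (\<Sum>k\<in>?T. entry X i k * entry C k j)" for X
      by (rule entry_times_sum) (auto simp: finite_column)
    then show "entry ((A + B) * C) i j = entry (A * C + B * C) i j"
      by (simp add: plus_rcf_matrix.rep_eq distrib_right sum.distrib)
  qed
  show "A * (B + C) = A * B + A * C"
    by (rule rcf_matrix_eqI)
       (simp add: times_rcf_matrix.rep_eq plus_rcf_matrix.rep_eq distrib_left sum.distrib)
  show "(0 :: 'a rcf_matrix) \<noteq> 1"
    by transfer (meson zero_neq_one)
qed

end

lemmas entry_simps = plus_rcf_matrix.rep_eq zero_rcf_matrix.rep_eq uminus_rcf_matrix.rep_eq
  one_rcf_matrix.rep_eq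

lemma entry_minus: "entry (A - B) i j = entry A i j - entry B i j"
  unfolding minus_rcf_matrix_def entry_simps by simp

text \<open>Scalars enter as central elements of the ring, so that scalar multiples obey ordinary
  ring identities.\<close>

lift_definition scalar_matrix :: "complex \<Rightarrow> 'i rcf_matrix" is "\<lambda>c i j. if i = j then c else 0"
  by simp

lift_definition diagonal :: "('i \<Rightarrow> complex) \<Rightarrow> 'i rcf_matrix" is "\<lambda>d i j. if i = j then d i else 0"
  by simp

lemma entry_diagonal_times: "entry (diagonal d * A) i j = d i * entry A i j"
  by (subst entry_times_sum[of "{i}"]) (auto simp: diagonal.rep_eq split: if_splits)

lemma entry_times_diagonal: "entry (A * diagonal d) i j = entry A i j * d j"
  by (subst entry_times_sum[of "{j}"]) (auto simp: diagonal.rep_eq split: if_splits)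

lemma scalar_matrix_diagonal: "scalar_matrix c = diagonal (\<lambda>_. c)"
  by transfer simp

lemma entry_scalar_matrix_times: "entry (scalar_matrix c * A) i j = c * entry A i j"
  by (simp add: scalar_matrix_diagonal entry_diagonal_times)

lemma scalar_matrix_commute: "A * scalar_matrix c = scalar_matrix c * A"
  by (rule rcf_matrix_eqI) (simp add: scalar_matrix_diagonal entry_diagonal_times entry_times_diagonal)

lemma scalar_matrix_pull: "A * (scalar_matrix c * B) = scalar_matrix c * (A * B)"
  by (simp only: mult.assoc[symmetric] scalar_matrix_commute[of A c])

section \<open>Finite matrices and their trace\<close>

definition finite_matrix :: "'i rcf_matrix \<Rightarrow> bool" where
  "finite_matrix A \<longleftrightarrow> finite {(i, j). entry A i j \<noteq> 0}"

lemma finite_matrixI: "finite S \<Longrightarrow> (\<And>i j. entry A i j \<noteq> 0 \<Longrightarrow> (i, j) \<in> S) \<Longrightarrow> finite_matrix A"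
  unfolding finite_matrix_def by (rule finite_subset) auto

lemma finite_matrixE:
  assumes "finite_matrix A"
  obtains S where "finite S" "\<And>i j. entry A i j \<noteq> 0 \<Longrightarrow> i \<in> S \<and> j \<in> S"
proof
  let ?N = "{(i, j). entry A i j \<noteq> 0}"
  show "finite (fst ` ?N \<union> snd ` ?N)"
    using assms by (auto simp: finite_matrix_def)
  show "i \<in> fst ` ?N \<union> snd ` ?N \<and> j \<in> fst ` ?N \<union> snd ` ?N" if "entry A i j \<noteq> 0" for i j
    using that by (auto intro: rev_image_eqI)
qed

lemma finite_matrix_zero [simp]: "finite_matrix 0"
  by (simp add: finite_matrix_def entry_simps)

lemma finite_matrix_add:
  assumes "finite_matrix A" "finite_matrix B" shows "finite_matrix (A + B)"
  by (rule finite_matrixI[of "{(i, j). entry A i j \<noteq> 0} \<union> {(i, j). entry B i j \<noteq> 0}"])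
     (use assms in \<open>auto simp: finite_matrix_def entry_simps\<close>)

lemma finite_matrix_minus:
  assumes "finite_matrix A" "finite_matrix B" shows "finite_matrix (A - B)"
  by (rule finite_matrixI[of "{(i, j). entry A i j \<noteq> 0} \<union> {(i, j). entry B i j \<noteq> 0}"])
     (use assms in \<open>auto simp: finite_matrix_def entry_minus\<close>)

lemma entry_times_nonzero:
  "entry (A * B) i j \<noteq> 0 \<Longrightarrow> \<exists>k. entry A i k \<noteq> 0 \<and> entry B k j \<noteq> 0"
  unfolding times_rcf_matrix.rep_eq
  by (drule sum.not_neutral_contains_not_neutral) auto

text \<open>Together with its companion for right factors this makes the finite matrices a two-sided
  ideal: \<open>X * Z\<close> is finite for finite \<open>Z\<close> even when \<open>X\<close> is an
  infinite loop matrix.\<close>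

lemma finite_matrix_times_left:
  assumes "finite_matrix A" shows "finite_matrix (A * B)"
proof -
  obtain S where S: "finite S" "\<And>i j. entry A i j \<noteq> 0 \<Longrightarrow> i \<in> S \<and> j \<in> S"
    using finite_matrixE[OF assms] by blast
  show ?thesis
    by (rule finite_matrixI[of "S \<times> (\<Union>k\<in>S. {j. entry B k j \<noteq> 0})"])
       (use S in \<open>auto simp: finite_row dest!: entry_times_nonzero\<close>)
qed

lemma finite_matrix_times_right:
  assumes "finite_matrix B" shows "finite_matrix (A * B)"
proof -
  obtain S where S: "finite S" "\<And>i j. entry B i j \<noteq> 0 \<Longrightarrow> i \<in> S \<and> j \<in> S"
    using finite_matrixE[OF assms] by blast
  show ?thesis
    by (rule finite_matrixI[of "(\<Union>k\<in>S. {i. entry A i k \<noteq> 0}) \<times> S"])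
       (use S in \<open>auto simp: finite_column dest!: entry_times_nonzero\<close>)
qed

text \<open>With infinitely many nonzero diagonal entries the sum takes its default value 0.
  Additivity therefore asks for finite matrices, while scaling respects the default.\<close>

definition matrix_trace :: "'i rcf_matrix \<Rightarrow> complex" where
  "matrix_trace A = (\<Sum>i | entry A i i \<noteq> 0. entry A i i)"

lemma matrix_trace_eq:
  assumes "finite S" "\<And>i. entry A i i \<noteq> 0 \<Longrightarrow> i \<in> S"
  shows "matrix_trace A = (\<Sum>i\<in>S. entry A i i)"
  unfolding matrix_trace_def
  by (rule sum.mono_neutral_left) (use assms in auto)

lemma matrix_trace_zero [simp]: "matrix_trace 0 = 0"
  by (simp add: matrix_trace_def entry_simps)

lemma matrix_trace_add:
  assumes "finite_matrix A" "finite_matrix B"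
  shows "matrix_trace (A + B) = matrix_trace A + matrix_trace B"
proof -
  obtain S where S: "finite S" "\<And>i j. entry A i j \<noteq> 0 \<Longrightarrow> i \<in> S \<and> j \<in> S"
    using finite_matrixE[OF assms(1)] by blast
  obtain T where T: "finite T" "\<And>i j. entry B i j \<noteq> 0 \<Longrightarrow> i \<in> T \<and> j \<in> T"
    using finite_matrixE[OF assms(2)] by blast
  have "i \<in> S \<union> T" if "C \<in> {A, B, A + B}" "entry C i i \<noteq> 0" for C i
    using that S(2)[of i i] T(2)[of i i] by (cases "entry A i i = 0") (auto simp: entry_simps)
  then have "matrix_trace C = (\<Sum>i\<in>S \<union> T. entry C i i)" if "C \<in> {A, B, A + B}" for C
    by (intro matrix_trace_eq) (use S T that in auto)
  then show ?thesis
    by (simp add: entry_simps sum.distrib)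
qed

lemma matrix_trace_scalar_times: "matrix_trace (scalar_matrix c * A) = c * matrix_trace A"
  by (cases "c = 0") (simp_all add: matrix_trace_def entry_scalar_matrix_times sum_distrib_left)

lemma matrix_trace_minus:
  assumes "finite_matrix A" "finite_matrix B"
  shows "matrix_trace (A - B) = matrix_trace A - matrix_trace B"
  using matrix_trace_add[of "A - B" B] assms by (simp add: finite_matrix_minus)

text \<open>Both traces are the sum of \<open>entry A i k * entry B k i\<close> over a finite square
  containing the support of \<open>A\<close>; \<open>B\<close> is typically an infinite loop
  matrix.\<close>

lemma matrix_trace_commute:
  assumes "finite_matrix A"
  shows "matrix_trace (A * B) = matrix_trace (B * A)"
proof -
  obtain S where S: "finite S" "\<And>i j. entry A i j \<noteq> 0 \<Longrightarrow> i \<in> S \<and> j \<in> S"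
    using finite_matrixE[OF assms] by blast
  have "matrix_trace (A * B) = (\<Sum>i\<in>S. entry (A * B) i i)"
    by (rule matrix_trace_eq) (use S in \<open>auto dest!: entry_times_nonzero\<close>)
  also have "\<dots> = (\<Sum>i\<in>S. \<Sum>k\<in>S. entry A i k * entry B k i)"
    by (intro sum.cong refl entry_times_sum) (use S in auto)
  also have "\<dots> = (\<Sum>k\<in>S. \<Sum>i\<in>S. entry B k i * entry A i k)"
    by (subst sum.swap) (simp add: mult.commute)
  also have "\<dots> = (\<Sum>k\<in>S. entry (B * A) k k)"
    by (intro sum.cong refl entry_times_sum[symmetric]) (use S in auto)
  also have "\<dots> = matrix_trace (B * A)"
    by (rule matrix_trace_eq[symmetric]) (use S in \<open>auto dest!: entry_times_nonzero\<close>)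
  finally show ?thesis .
qed

section \<open>Polynomial functions on the big cell\<close>

text \<open>The index \<open>(i, m)\<close> stands for the basis vector \<open>e_i t^m\<close>;
  \<open>neg_proj\<close> and \<open>nonneg_proj\<close> are the projections \<open>P\<close> and
  \<open>Q\<close>.\<close>

type_synonym chart_matrix = "(4 \<times> int) rcf_matrix"

definition neg_proj :: chart_matrix where "neg_proj = diagonal (\<lambda>(i, m). if m < 0 then 1 else 0)"

definition nonneg_proj :: chart_matrix where "nonneg_proj = diagonal (\<lambda>(i, m). if m < 0 then 0 else 1)"

lemma projections_sum: "neg_proj + nonneg_proj = 1"
  by (rule rcf_matrix_eqI) (auto simp: neg_proj_def nonneg_proj_def entry_simps diagonal.rep_eq)

lemma projections_mult [simp]:
  "neg_proj * neg_proj = neg_proj" "nonneg_proj * nonneg_proj = nonneg_proj"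
  "neg_proj * nonneg_proj = 0" "nonneg_proj * neg_proj = 0"
  by (rule rcf_matrix_eqI; auto simp: neg_proj_def nonneg_proj_def entry_diagonal_times entry_simps diagonal.rep_eq split: if_splits)+

lemma projections_absorb [simp]:
  "neg_proj * (neg_proj * A) = neg_proj * A" "nonneg_proj * (nonneg_proj * A) = nonneg_proj * A"
  "neg_proj * (nonneg_proj * A) = 0" "nonneg_proj * (neg_proj * A) = 0"
  by (simp_all flip: mult.assoc)

text \<open>The two equations say \<open>Z = P Z Q\<close>, a map from the nonnegative to the
  negative powers of \<open>t\<close> extended by 0; finiteness makes every trace with
  \<open>Z\<close> a finite sum.\<close>

definition chart :: "chart_matrix set" where
  "chart = {Z. finite_matrix Z \<and> neg_proj * Z = Z \<and> Z * nonneg_proj = Z}"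

lemma chart_zero [simp]: "0 \<in> chart" by (simp add: chart_def)

lemma chart_add: "Z \<in> chart \<Longrightarrow> W \<in> chart \<Longrightarrow> Z + W \<in> chart"
  by (simp add: chart_def finite_matrix_add distrib_left distrib_right)

lemma chart_scale: "Z \<in> chart \<Longrightarrow> scalar_matrix c * Z \<in> chart"
  by (simp add: chart_def finite_matrix_times_right scalar_matrix_pull mult.assoc)

text \<open>Each rule comes with and without a right factor \<open>A\<close>, so that it still fires
  after products have been associated to the right.\<close>

lemma chart_simps:
  assumes "Z \<in> chart"
  shows "neg_proj * Z = Z" "Z * nonneg_proj = Z" "nonneg_proj * Z = 0" "Z * neg_proj = 0" "nonneg_proj * (Z * A) = 0" "neg_proj * (Z * A) = Z * A"
    "Z * (nonneg_proj * A) = Z * A" "Z * (neg_proj * A) = 0"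
proof -
  show *: "neg_proj * Z = Z" "Z * nonneg_proj = Z" using assms by (auto simp: chart_def)
  show **: "nonneg_proj * Z = 0" by (metis *(1) projections_absorb(4))
  show ***: "Z * neg_proj = 0" by (metis *(2) projections_mult(4) mult.assoc mult_zero_right)
  show "nonneg_proj * (Z * A) = 0" "neg_proj * (Z * A) = Z * A" "Z * (nonneg_proj * A) = Z * A" "Z * (neg_proj * A) = 0"
    by (metis * ** *** mult.assoc mult_zero_left)+
qed

text \<open>Functions are only compared on the big cell, hence the last clause.\<close>

inductive_set polynomials :: "(chart_matrix \<Rightarrow> complex) set" where
  const: "(\<lambda>_. c) \<in> polynomials"
| entry: "(\<lambda>Z. entry Z i j) \<in> polynomials"
| add: "f \<in> polynomials \<Longrightarrow> g \<in> polynomials \<Longrightarrow> (\<lambda>Z. f Z + g Z) \<in> polynomials"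
| mult: "f \<in> polynomials \<Longrightarrow> g \<in> polynomials \<Longrightarrow> (\<lambda>Z. f Z * g Z) \<in> polynomials"
| cong: "f \<in> polynomials \<Longrightarrow> (\<And>Z. Z \<in> chart \<Longrightarrow> g Z = f Z) \<Longrightarrow> g \<in> polynomials"

section \<open>Directional derivatives and vector fields\<close>

definition directional :: "(chart_matrix \<Rightarrow> complex) \<Rightarrow> chart_matrix \<Rightarrow> chart_matrix \<Rightarrow> complex" where
  "directional f Z W = deriv (\<lambda>s. f (Z + scalar_matrix s * W)) 0"

lemma directional_cong:
  assumes "\<And>Z. Z \<in> chart \<Longrightarrow> f Z = g Z" "Z \<in> chart" "W \<in> chart"
  shows "directional f Z W = directional g Z W"
  using assms by (simp add: directional_def chart_add chart_scale)

text \<open>\<open>deriv\<close> is total, so its sum and product rules require differentiability.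
  On a line in the chart, a polynomial is built by sums and products from affine functions of
  \<open>s\<close>.\<close>

lemma polynomials_differentiable:
  assumes "f \<in> polynomials" "Z \<in> chart" "W \<in> chart"
  shows "(\<lambda>s. f (Z + scalar_matrix s * W)) field_differentiable at 0"
  using assms
proof (induction rule: polynomials.induct)
  case (cong f g)
  then show ?case by (simp add: chart_add chart_scale)
qed (auto simp: entry_simps entry_scalar_matrix_times intro!: derivative_intros)

lemma scalar_matrix_zero [simp]: "scalar_matrix 0 = 0"
  by transfer simp

lemma directional_const: "directional (\<lambda>_. c) Z W = 0"
  by (simp add: directional_def)

lemma directional_entry: "directional (\<lambda>Z. entry Z i j) Z W = entry W i j"
  unfolding directional_def entry_simps entry_scalar_matrix_times
  by (rule DERIV_imp_deriv) (auto intro!: derivative_eq_intros)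

context
  fixes f g Z W
  assumes f: "f \<in> polynomials" and g: "g \<in> polynomials" and chart: "Z \<in> chart" "W \<in> chart"
begin

lemma directional_add: "directional (\<lambda>Z. f Z + g Z) Z W = directional f Z W + directional g Z W"
  unfolding directional_def
  by (intro deriv_add polynomials_differentiable f g chart)

lemma directional_mult:
  "directional (\<lambda>Z. f Z * g Z) Z W = f Z * directional g Z W + directional f Z W * g Z"
  unfolding directional_def
  by (subst deriv_mult) (auto intro!: polynomials_differentiable f g chart)

end

definition vector_field :: "(chart_matrix \<Rightarrow> chart_matrix) \<Rightarrow> bool" where
  "vector_field V \<longleftrightarrow> (\<forall>Z\<in>chart. V Z \<in> chart) \<and> (\<forall>i j. (\<lambda>Z. entry (V Z) i j) \<in> polynomials)"

text \<open>Linearity in the direction is not visible from derivatives along single lines; for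
  polynomials it propagates from the coordinate functions through sums and products.\<close>

lemma directional_direction_add:
  assumes "f \<in> polynomials" "Z \<in> chart" "W \<in> chart" "W' \<in> chart"
  shows "directional f Z (W + W') = directional f Z W + directional f Z W'"
  using assms
proof (induction rule: polynomials.induct)
  case (cong f g)
  then show ?case using directional_cong[of g f] by (simp add: chart_add)
qed (simp_all add: directional_const directional_entry entry_simps directional_add directional_mult
    chart_add algebra_simps)

lemma directional_direction_scale:
  assumes "f \<in> polynomials" "Z \<in> chart" "W \<in> chart"
  shows "directional f Z (scalar_matrix c * W) = c * directional f Z W"
  using assms
proof (induction rule: polynomials.induct)
  case (cong f g)
  then show ?case using directional_cong[of g f] by (simp add: chart_scale)
qed (simp_all add: directional_const directional_entry entry_scalar_matrix_times directional_add
    directional_mult chart_scale algebra_simps)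

lemma directional_vector_field:
  assumes "f \<in> polynomials" "vector_field V"
  shows "(\<lambda>Z. directional f Z (V Z)) \<in> polynomials"
  using assms(1)
proof (induction rule: polynomials.induct)
  case (const c)
  then show ?case by (simp add: directional_const polynomials.const)
next
  case (entry i j)
  then show ?case using assms(2) by (simp add: directional_entry vector_field_def del: split_paired_All)
next
  case (add f g)
  then show ?case
    by (intro polynomials.cong[OF polynomials.add[OF add.IH]])
       (use assms(2) in \<open>auto simp: vector_field_def directional_add\<close>)
next
  case (mult f g)
  then show ?case
    by (intro polynomials.cong[OF polynomials.add[OF polynomials.mult[OF mult.hyps(1) mult.IH(2)]
            polynomials.mult[OF mult.IH(1) mult.hyps(2)]]])
       (use assms(2) in \<open>auto simp: vector_field_def directional_mult\<close>)
next
  case (cong f g)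
  then show ?case
    using assms(2) by (intro polynomials.cong[OF cong.IH])
      (auto simp: vector_field_def intro!: directional_cong)
qed

text \<open>A commutator of derivations is again a derivation, and derivations that agree on the
  coordinates agree on all polynomials; the coordinates are covered by the hypothesis
  \<open>bracket\<close>.\<close>

lemma vector_field_commutator:
  assumes "f \<in> polynomials" and V: "vector_field V" and W: "vector_field W"
    and U: "\<And>Z. Z \<in> chart \<Longrightarrow> U Z \<in> chart"
    and bracket: "\<And>Z i j. Z \<in> chart \<Longrightarrow> directional (\<lambda>Z. entry (V Z) i j) Z (W Z)
         - directional (\<lambda>Z. entry (W Z) i j) Z (V Z) = entry (U Z) i j"
    and "Z \<in> chart"
  shows "directional (\<lambda>Z. directional f Z (V Z)) Z (W Z)
     - directional (\<lambda>Z. directional f Z (W Z)) Z (V Z) = directional f Z (U Z)"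
  using assms(1) \<open>Z \<in> chart\<close>
proof (induction arbitrary: Z rule: polynomials.induct)
  case (const c)
  then show ?case by (simp add: directional_const)
next
  case (entry i j)
  then show ?case using bracket by (simp add: directional_entry)
next
  have in_chart: "V Z \<in> chart" "W Z \<in> chart" if "Z \<in> chart" for Z
    using V W that by (auto simp: vector_field_def)
  {
    case (add f g)
    have "directional (\<lambda>Z. directional (\<lambda>Z. f Z + g Z) Z (A Z)) Z B
        = directional (\<lambda>Z. directional f Z (A Z)) Z B + directional (\<lambda>Z. directional g Z (A Z)) Z B"
      if "vector_field A" "B \<in> chart" for A B
    proof -
      have "directional (\<lambda>Z. directional (\<lambda>Z. f Z + g Z) Z (A Z)) Z B
          = directional (\<lambda>Z. directional f Z (A Z) + directional g Z (A Z)) Z B"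
        using add that by (intro directional_cong) (auto simp: directional_add vector_field_def)
      then show ?thesis
        using add that by (simp add: directional_add directional_vector_field)
    qed
    from this[OF V] this[OF W] show ?case
      using add.IH[OF add.prems] add.hyps add.prems in_chart U
      by (simp add: directional_add algebra_simps)
  next
    case (mult f g)
    have "directional (\<lambda>Z. directional (\<lambda>Z. f Z * g Z) Z (A Z)) Z B
        = f Z * directional (\<lambda>Z. directional g Z (A Z)) Z B + directional f Z B * directional g Z (A Z)
        + (directional f Z (A Z) * directional g Z B + directional (\<lambda>Z. directional f Z (A Z)) Z B * g Z)"
      if "vector_field A" "B \<in> chart" for A B
    proof -
      have "directional (\<lambda>Z. directional (\<lambda>Z. f Z * g Z) Z (A Z)) Z B
          = directional (\<lambda>Z. f Z * directional g Z (A Z) + directional f Z (A Z) * g Z) Z B"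
        using mult that by (intro directional_cong) (auto simp: directional_mult vector_field_def)
      then show ?thesis
        using mult that by (simp add: directional_add directional_mult directional_vector_field polynomials.mult)
    qed
    note product = this
    \<comment> \<open>The mixed terms of \<open>product\<close>, with one derivative on each factor,
      are symmetric in \<open>V\<close> and \<open>W\<close> and cancel in the difference; the
      Leibniz rule with the two induction hypotheses remains.\<close>
    have "g Z * (directional (\<lambda>Z. directional f Z (V Z)) Z (W Z) - directional (\<lambda>Z. directional f Z (W Z)) Z (V Z))
        = g Z * directional f Z (U Z)"
      "f Z * (directional (\<lambda>Z. directional g Z (V Z)) Z (W Z) - directional (\<lambda>Z. directional g Z (W Z)) Z (V Z))
        = f Z * directional g Z (U Z)"
      by (simp_all only: mult.IH[OF mult.prems])
    with product[OF V in_chart(2)[OF mult.prems]] product[OF W in_chart(1)[OF mult.prems]] show ?case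
      using mult.hyps mult.prems in_chart U
      by (simp add: directional_mult algebra_simps)
  next
    case (cong f g)
    have "directional (\<lambda>Z. directional g Z (A Z)) Z B = directional (\<lambda>Z. directional f Z (A Z)) Z B"
      if "vector_field A" "B \<in> chart" for A B
      using cong that by (intro directional_cong) (auto simp: vector_field_def intro!: directional_cong)
    moreover have "directional g Z (U Z) = directional f Z (U Z)"
      using cong U by (intro directional_cong) auto
    ultimately show ?case
      using cong V W in_chart by simp
  }
qed

section \<open>Moebius vector fields\<close>

lemmas polynomials_basic = polynomials.const polynomials.entry polynomials.add polynomials.mult

text \<open>The algebraic form of the restricted general linear algebra. The block
  \<open>P X Q\<close> is the constant term of the field and must be finite for the field to stay in
  \<open>chart\<close>; \<open>Q X P\<close> governs the quadratic term and the trace, and its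
  finiteness makes both polynomial.\<close>

definition tame :: "chart_matrix \<Rightarrow> bool" where
  "tame X \<longleftrightarrow> finite_matrix (neg_proj * X * nonneg_proj) \<and> finite_matrix (nonneg_proj * X * neg_proj)"

text \<open>The motion of the graph of \<open>Z\<close>: to first order \<open>X\<close> moves the
  point \<open>(Q + Z) w\<close> by \<open>X (Q + Z) w\<close>, and rewriting the moved space as a
  graph changes \<open>Z\<close> by \<open>P X (Q + Z) - Z Q X (Q + Z)\<close>, where
  \<open>Z Q = Z\<close>.\<close>

definition moebius_field :: "chart_matrix \<Rightarrow> chart_matrix \<Rightarrow> chart_matrix" where
  "moebius_field X Z = (neg_proj - Z) * X * (nonneg_proj + Z)"

lemma moebius_field_expand:
  assumes "Z \<in> chart"
  shows "moebius_field X Z = neg_proj * X * nonneg_proj + neg_proj * X * Z - Z * X * nonneg_proj - Z * (nonneg_proj * X * neg_proj * Z)"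
  by (simp add: moebius_field_def left_diff_distrib distrib_left mult.assoc chart_simps[OF assms] algebra_simps)

lemma polynomials_sum: "(\<And>k. k \<in> S \<Longrightarrow> f k \<in> polynomials) \<Longrightarrow> (\<lambda>Z. \<Sum>k\<in>S. f k Z) \<in> polynomials"
  by (induction S rule: infinite_finite_induct) (auto intro: polynomials_basic)

lemma polynomials_entry_times_left: "(\<lambda>Z. entry (A * Z) i j) \<in> polynomials"
  unfolding times_rcf_matrix.rep_eq by (intro polynomials_sum polynomials_basic)

lemma polynomials_entry_times_right: "(\<lambda>Z. entry (Z * A) i j) \<in> polynomials"
proof -
  have "entry (Z * A) i j = (\<Sum>k | entry A k j \<noteq> 0. entry Z i k * entry A k j)" for Z
    by (rule entry_times_sum) (auto simp: finite_column)
  then show ?thesis by (simp only:) (intro polynomials_sum polynomials_basic)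
qed

text \<open>A sum over the support of \<open>Z\<close> would vary with \<open>Z\<close>; the finite
  middle factor provides one index set for all \<open>Z\<close>.\<close>

lemma polynomials_entry_quadratic:
  assumes "finite_matrix A" shows "(\<lambda>Z. entry (Z * (A * Z)) i j) \<in> polynomials"
proof -
  obtain S where S: "finite S" "\<And>i j. entry A i j \<noteq> 0 \<Longrightarrow> i \<in> S \<and> j \<in> S"
    using finite_matrixE[OF assms] by blast
  have "entry (Z * (A * Z)) i j = (\<Sum>k\<in>S. entry Z i k * entry (A * Z) k j)" for Z
    by (rule entry_times_sum) (use S in \<open>auto dest!: entry_times_nonzero\<close>)
  then show ?thesis
    by (simp only:) (intro polynomials_sum polynomials_basic polynomials_entry_times_left)
qed

lemma polynomials_minus:
  assumes "f \<in> polynomials" "g \<in> polynomials" shows "(\<lambda>Z. f Z - g Z) \<in> polynomials"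
  using polynomials.add[OF assms(1) polynomials.mult[OF polynomials.const[of "- 1"] assms(2)]] by simp

lemma vector_field_moebius:
  assumes "tame X" shows "vector_field (moebius_field X)"
  unfolding vector_field_def
proof (intro conjI ballI allI)
  fix Z assume Z: "Z \<in> chart"
  then have fin: "finite_matrix Z" by (simp add: chart_def)
  have "finite_matrix (moebius_field X Z)"
    using assms fin unfolding moebius_field_expand[OF Z] tame_def
    by (intro finite_matrix_minus finite_matrix_add) (auto intro: finite_matrix_times_left finite_matrix_times_right)
  moreover have "neg_proj * moebius_field X Z = moebius_field X Z" "moebius_field X Z * nonneg_proj = moebius_field X Z"
    unfolding moebius_field_expand[OF Z]
    by (simp_all add: right_diff_distrib left_diff_distrib distrib_left distrib_right mult.assoc chart_simps[OF Z])
  ultimately show "moebius_field X Z \<in> chart" by (simp add: chart_def)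
next
  fix i j
  have "(\<lambda>Z. entry (neg_proj * X * nonneg_proj) i j + entry (neg_proj * X * Z) i j - entry (Z * (X * nonneg_proj)) i j
      - entry (Z * (nonneg_proj * X * neg_proj * Z)) i j) \<in> polynomials"
    using assms unfolding tame_def
    by (intro polynomials_minus polynomials.add polynomials.const polynomials_entry_times_left
        polynomials_entry_times_right polynomials_entry_quadratic) auto
  then show "(\<lambda>Z. entry (moebius_field X Z) i j) \<in> polynomials"
    by (rule polynomials.cong) (simp add: moebius_field_expand entry_simps entry_minus mult.assoc)
qed

lemma moebius_shift:
  fixes p q x z u :: "'a::ring"
  shows "(p - (z + u)) * x * (q + (z + u)) =
    (p - z) * x * (q + z) + ((p - z) * x * u - u * x * (q + z)) - u * x * u"
  by (simp add: algebra_simps)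

text \<open>The field is quadratic in \<open>Z\<close>, so along a line it is a quadratic polynomial
  in \<open>s\<close>, and its linear coefficient is the derivative.\<close>

lemma directional_moebius:
  "directional (\<lambda>Z. entry (moebius_field X Z) i j) Z W
     = entry ((neg_proj - Z) * X * W - W * X * (nonneg_proj + Z)) i j"
proof -
  let ?V = "(neg_proj - Z) * X * W - W * X * (nonneg_proj + Z)"
  have "entry (moebius_field X (Z + scalar_matrix s * W)) i j =
      entry (moebius_field X Z) i j + s * entry ?V i j - s * (s * entry (W * X * W) i j)" for s
  proof -
    have "(neg_proj - Z) * X * (scalar_matrix s * W) = scalar_matrix s * ((neg_proj - Z) * X * W)"
      by (rule scalar_matrix_pull)
    moreover have "scalar_matrix s * W * X * (scalar_matrix s * W) = scalar_matrix s * (scalar_matrix s * (W * X * W))"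
      by (subst scalar_matrix_pull) (simp only: mult.assoc)
    ultimately have "moebius_field X (Z + scalar_matrix s * W) = moebius_field X Z
        + scalar_matrix s * ?V - scalar_matrix s * (scalar_matrix s * (W * X * W))"
      unfolding moebius_field_def moebius_shift by (simp only: mult.assoc right_diff_distrib)
    then show ?thesis
      by (simp only: entry_simps entry_minus entry_scalar_matrix_times)
  qed
  moreover have "((\<lambda>s. a + s * b - s * (s * c)) has_field_derivative b) (at 0)" for a b c :: complex
    by (auto intro!: derivative_eq_intros)
  ultimately show ?thesis
    unfolding directional_def by (simp only: DERIV_imp_deriv)
qed

text \<open>In the difference the inner factors occur only through the sum
  \<open>(P - Z) + (Q + Z) = 1\<close>, which joins \<open>X\<close> and \<open>Y\<close> to the
  products \<open>X * Y\<close> and \<open>Y * X\<close>.\<close>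

lemma moebius_bracket:
  "directional (\<lambda>Z. entry (moebius_field X Z) i j) Z (moebius_field Y Z)
     - directional (\<lambda>Z. entry (moebius_field Y Z) i j) Z (moebius_field X Z)
   = entry (moebius_field (X * Y - Y * X) Z) i j"
proof -
  have nonneg: "nonneg_proj = 1 - neg_proj" using projections_sum by (simp add: eq_diff_eq add.commute)
  have "(neg_proj - Z) * X * moebius_field Y Z - moebius_field Y Z * X * (nonneg_proj + Z)
      - ((neg_proj - Z) * Y * moebius_field X Z - moebius_field X Z * Y * (nonneg_proj + Z))
    = (neg_proj - Z) * (X * ((neg_proj - Z) + (nonneg_proj + Z)) * Y - Y * ((neg_proj - Z) + (nonneg_proj + Z)) * X) * (nonneg_proj + Z)"
    unfolding moebius_field_def by (simp only: left_diff_distrib right_diff_distrib distrib_left distrib_right mult.assoc) (simp add: algebra_simps)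
  also have "\<dots> = moebius_field (X * Y - Y * X) Z"
    by (simp add: moebius_field_def nonneg)
  finally show ?thesis
    by (simp add: directional_moebius flip: entry_minus)
qed

section \<open>The trace multiplier and its cocycle\<close>

lemma polynomials_trace:
  assumes "tame X" shows "(\<lambda>Z. matrix_trace (X * Z)) \<in> polynomials"
proof -
  obtain S where S: "finite S" "\<And>i j. entry (nonneg_proj * X * neg_proj) i j \<noteq> 0 \<Longrightarrow> i \<in> S \<and> j \<in> S"
    using finite_matrixE[of "nonneg_proj * X * neg_proj"] assms unfolding tame_def by blast
  have "(\<lambda>Z. \<Sum>i\<in>S. entry (nonneg_proj * X * neg_proj * Z) i i) \<in> polynomials"
    by (intro polynomials_sum polynomials_entry_times_left)
  then show ?thesis
  proof (rule polynomials.cong)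
    fix Z assume Z: "Z \<in> chart"
    then have fin: "finite_matrix Z" by (simp add: chart_def)
    \<comment> \<open>\<open>Z = Z Q\<close> and cyclicity put \<open>Q\<close> in front, and
      \<open>Z = P Z\<close> inserts \<open>P\<close>: only the finite block \<open>Q X P\<close>
      contributes.\<close>
    have "matrix_trace (X * Z) = matrix_trace ((X * Z) * nonneg_proj)"
      by (simp add: mult.assoc chart_simps[OF Z])
    also have "\<dots> = matrix_trace (nonneg_proj * (X * Z))"
      using fin by (intro matrix_trace_commute finite_matrix_times_right)
    also have "nonneg_proj * (X * Z) = nonneg_proj * X * neg_proj * Z"
      by (simp add: mult.assoc chart_simps[OF Z])
    also have "matrix_trace \<dots> = (\<Sum>i\<in>S. entry (nonneg_proj * X * neg_proj * Z) i i)"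
    proof (rule matrix_trace_eq[OF S(1)])
      fix i assume "entry (nonneg_proj * X * neg_proj * Z) i i \<noteq> 0"
      then obtain k where "entry (nonneg_proj * X * neg_proj) i k \<noteq> 0" using entry_times_nonzero[of "nonneg_proj * X * neg_proj" Z] by metis
      with S(2)[of i k] show "i \<in> S" by simp
    qed
    finally show "matrix_trace (X * Z) = (\<Sum>i\<in>S. entry (nonneg_proj * X * neg_proj * Z) i i)" .
  qed
qed

lemma directional_trace:
  assumes "Z \<in> chart" "W \<in> chart"
  shows "directional (\<lambda>Z. matrix_trace (X * Z)) Z W = matrix_trace (X * W)"
proof -
  have fin: "finite_matrix Z" "finite_matrix W" using assms by (auto simp: chart_def)
  have "matrix_trace (X * (Z + scalar_matrix s * W)) = matrix_trace (X * Z) + s * matrix_trace (X * W)" for s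
    using fin by (simp add: distrib_left scalar_matrix_pull matrix_trace_add finite_matrix_times_right
        matrix_trace_scalar_times)
  then show ?thesis
    unfolding directional_def by (simp only:) (rule DERIV_imp_deriv, auto intro!: derivative_eq_intros)
qed

text \<open>The standard two-cocycle of infinite matrices for the splitting into \<open>H_-\<close>
  and \<open>H_+\<close>. On loops it becomes \<open>m (x, y)\<close>, which is how the level
  enters.\<close>

definition matrix_cocycle :: "chart_matrix \<Rightarrow> chart_matrix \<Rightarrow> complex" where
  "matrix_cocycle X Y = matrix_trace (X * (neg_proj * Y * nonneg_proj)) - matrix_trace (Y * (neg_proj * X * nonneg_proj))"

text \<open>Terms quadratic in \<open>Z\<close> cancel by cyclicity of the trace, linear ones
  combine through \<open>P + Q = 1\<close>, and the constant ones are the cocycle. So the multiplier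
  \<open>tr (X Z)\<close> is compatible with brackets up to a constant.\<close>

lemma trace_moebius:
  assumes "tame X" "tame Y" "Z \<in> chart"
  shows "matrix_trace (X * moebius_field Y Z) - matrix_trace (Y * moebius_field X Z)
     = matrix_trace ((X * Y - Y * X) * Z) + matrix_cocycle X Y"
proof -
  have fin: "finite_matrix Z" using assms by (simp add: chart_def)
  note fins = finite_matrix_times_right[OF fin] finite_matrix_times_left[OF fin]
    finite_matrix_times_right[OF finite_matrix_times_left[OF fin]]
    finite_matrix_times_right[OF finite_matrix_times_right[OF fin]]
  have expand: "matrix_trace (X * moebius_field Y Z) = matrix_trace (X * (neg_proj * Y * nonneg_proj)) + matrix_trace (X * neg_proj * Y * Z)
      - matrix_trace (Y * nonneg_proj * X * Z) - matrix_trace (X * Z * (Y * Z))" if "tame Y" for X Y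
  proof -
    have "X * moebius_field Y Z = X * (neg_proj * Y * nonneg_proj) + X * neg_proj * Y * Z - X * (Z * (Y * nonneg_proj)) - X * Z * (Y * Z)"
      unfolding moebius_field_expand[OF assms(3)]
      by (simp add: right_diff_distrib distrib_left mult.assoc chart_simps[OF assms(3)])
    moreover have "finite_matrix (X * (neg_proj * Y * nonneg_proj))"
      using that by (auto simp: tame_def intro: finite_matrix_times_right)
    moreover have "matrix_trace (X * (Z * (Y * nonneg_proj))) = matrix_trace (Y * nonneg_proj * X * Z)"
    proof -
      have "matrix_trace (X * (Z * (Y * nonneg_proj))) = matrix_trace ((Z * (Y * nonneg_proj)) * X)"
        by (rule matrix_trace_commute[symmetric]) (rule fins)
      also have "\<dots> = matrix_trace (Y * nonneg_proj * X * Z)"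
        using matrix_trace_commute[OF fin, of "Y * nonneg_proj * X"] by (simp add: mult.assoc)
      finally show ?thesis .
    qed
    ultimately show ?thesis
      by (simp add: matrix_trace_minus matrix_trace_add finite_matrix_minus finite_matrix_add fins)
  qed
  have sym: "matrix_trace (X * Z * (Y * Z)) = matrix_trace (Y * Z * (X * Z))"
    by (rule matrix_trace_commute) (rule fins)
  have split: "matrix_trace (A * neg_proj * B * Z) + matrix_trace (A * nonneg_proj * B * Z) = matrix_trace (A * B * Z)" for A B
  proof -
    have "A * B * Z = A * (neg_proj + nonneg_proj) * B * Z" by (simp add: projections_sum)
    also have "\<dots> = A * neg_proj * B * Z + A * nonneg_proj * B * Z" by (simp add: distrib_left distrib_right)
    finally show ?thesis by (simp add: matrix_trace_add fins)
  qed
  have "matrix_trace ((X * Y - Y * X) * Z) = matrix_trace (X * Y * Z) - matrix_trace (Y * X * Z)"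
    by (simp add: left_diff_distrib matrix_trace_minus fins)
  then show ?thesis
    using split[of X Y, symmetric] split[of Y X, symmetric]
    unfolding expand[OF assms(1)] expand[OF assms(2)] matrix_cocycle_def sym by simp
qed

section \<open>Operators of level \<open>k\<close>\<close>

definition field_operator :: "complex \<Rightarrow> chart_matrix \<Rightarrow> complex \<Rightarrow> (chart_matrix \<Rightarrow> complex) \<Rightarrow> chart_matrix \<Rightarrow> complex" where
  "field_operator k X c f Z = directional f Z (moebius_field X Z) + (k * matrix_trace (X * Z) + c) * f Z"

lemma polynomials_multiplier: "tame X \<Longrightarrow> (\<lambda>Z. k * matrix_trace (X * Z) + c) \<in> polynomials"
  by (intro polynomials_basic polynomials_trace)

lemma moebius_in_chart: "tame X \<Longrightarrow> Z \<in> chart \<Longrightarrow> moebius_field X Z \<in> chart"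
  using vector_field_moebius by (auto simp: vector_field_def)

lemma polynomials_field_operator:
  "f \<in> polynomials \<Longrightarrow> tame X \<Longrightarrow> field_operator k X c f \<in> polynomials"
  unfolding field_operator_def
  by (intro polynomials.add polynomials.mult directional_vector_field vector_field_moebius polynomials_multiplier)

lemma field_operator_cong:
  assumes "\<And>Z. Z \<in> chart \<Longrightarrow> f Z = g Z" "tame X" "Z \<in> chart"
  shows "field_operator k X c f Z = field_operator k X c g Z"
  using assms directional_cong[OF assms(1) assms(3) moebius_in_chart[OF assms(2,3)]]
  by (simp add: field_operator_def)

lemma field_operator_add:
  assumes "f \<in> polynomials" "g \<in> polynomials" "tame X" "Z \<in> chart"
  shows "field_operator k X c (\<lambda>Z. f Z + g Z) Z = field_operator k X c f Z + field_operator k X c g Z"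
  using assms by (simp add: field_operator_def directional_add moebius_in_chart algebra_simps)

lemma field_operator_scale:
  assumes "f \<in> polynomials" "tame X" "Z \<in> chart"
  shows "field_operator k X c (\<lambda>Z. a * f Z) Z = a * field_operator k X c f Z"
  using assms by (simp add: field_operator_def directional_mult[OF polynomials.const] directional_const
      moebius_in_chart algebra_simps)

text \<open>Vector fields given by a left action form an anti-representation. This matches the
  reversal of words in the pairing below.\<close>

lemma field_operator_commutator:
  assumes f: "f \<in> polynomials" and X: "tame X" and Y: "tame Y" and XY: "tame (X * Y - Y * X)" and Z: "Z \<in> chart"
  shows "field_operator k Y d (field_operator k X c f) Z - field_operator k X c (field_operator k Y d f) Z
     = field_operator k (X * Y - Y * X) (k * matrix_cocycle X Y) f Z"
proof -
  have expand: "field_operator k Y d (field_operator k X c f) Z =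
      directional (\<lambda>Z. directional f Z (moebius_field X Z)) Z (moebius_field Y Z)
      + (k * matrix_trace (X * Z) + c) * directional f Z (moebius_field Y Z)
      + k * matrix_trace (X * moebius_field Y Z) * f Z
      + (k * matrix_trace (Y * Z) + d) * field_operator k X c f Z"
    if X: "tame X" and Y: "tame Y" for X Y c d
  proof -
    note in_chart = moebius_in_chart[OF X Z] moebius_in_chart[OF Y Z]
    have "directional (\<lambda>Z. k * matrix_trace (X * Z) + c) Z (moebius_field Y Z)
        = k * matrix_trace (X * moebius_field Y Z)"
      using X Z in_chart by (simp add: directional_add directional_mult directional_const directional_trace
          polynomials_basic polynomials_trace)
    moreover have "directional (field_operator k X c f) Z (moebius_field Y Z) =
        directional (\<lambda>Z. directional f Z (moebius_field X Z)) Z (moebius_field Y Z)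
        + directional (\<lambda>Z. (k * matrix_trace (X * Z) + c) * f Z) Z (moebius_field Y Z)"
      unfolding field_operator_def
      by (intro directional_add directional_vector_field vector_field_moebius polynomials.mult
          polynomials_multiplier f X Z in_chart)
    ultimately show ?thesis
      by (subst field_operator_def)
         (simp add: directional_mult[OF polynomials_multiplier[OF X] f Z in_chart(2)])
  qed
  have "directional (\<lambda>Z. directional f Z (moebius_field X Z)) Z (moebius_field Y Z)
     - directional (\<lambda>Z. directional f Z (moebius_field Y Z)) Z (moebius_field X Z)
     = directional f Z (moebius_field (X * Y - Y * X) Z)"
    by (rule vector_field_commutator[OF f vector_field_moebius[OF X] vector_field_moebius[OF Y]
          moebius_in_chart[OF XY] moebius_bracket Z])
  moreover have "k * (matrix_trace (X * moebius_field Y Z) - matrix_trace (Y * moebius_field X Z)) * f Z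
      = k * (matrix_trace ((X * Y - Y * X) * Z) + matrix_cocycle X Y) * f Z"
    by (simp only: trace_moebius[OF X Y Z])
  \<comment> \<open>Stated with free variables, this is plain algebra: products of two multipliers
    and of a multiplier with a first derivative cancel, leaving the bracket of the fields and the
    difference of the traces.\<close>
  moreover have "(D1 + mX * dY + k * tX * g + mY * (dX + mX * g)) - (D2 + mY * dX + k * tY * g + mX * (dY + mY * g))
      = dB + (k * t + k * co) * g"
    if "D1 - D2 = dB" "k * (tX - tY) * g = k * (t + co) * g" for D1 D2 mX mY dX dY tX tY t co dB g
    using that by (simp add: algebra_simps)
  ultimately show ?thesis
    unfolding expand[OF X Y] expand[OF Y X] unfolding field_operator_def by blast
qed

text \<open>With \<open>P + Q = 1\<close> inserted between the factors, each summand of an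
  off-diagonal block of \<open>X * Y\<close> contains an off-diagonal block of \<open>X\<close> or
  of \<open>Y\<close>.\<close>

lemma tame_times: "tame X \<Longrightarrow> tame Y \<Longrightarrow> tame (X * Y)"
proof -
  have split: "A * (X * Y) * B = (A * X * neg_proj) * (neg_proj * Y * B) + (A * X * nonneg_proj) * (nonneg_proj * Y * B)" for A B
  proof -
    have "A * (X * Y) * B = A * X * (neg_proj + nonneg_proj) * Y * B" by (simp add: projections_sum mult.assoc)
    then show ?thesis by (simp add: distrib_left distrib_right mult.assoc)
  qed
  show "tame X \<Longrightarrow> tame Y \<Longrightarrow> tame (X * Y)"
    unfolding tame_def split
    by (auto intro!: finite_matrix_add intro: finite_matrix_times_left finite_matrix_times_right)
qed

lemma tame_add: "tame X \<Longrightarrow> tame Y \<Longrightarrow> tame (X + Y)"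
  by (simp add: tame_def distrib_left distrib_right finite_matrix_add)

lemma tame_minus: "tame X \<Longrightarrow> tame Y \<Longrightarrow> tame (X - Y)"
  by (simp add: tame_def left_diff_distrib right_diff_distrib finite_matrix_minus)

lemma tame_zero [simp]: "tame 0"
  by (simp add: tame_def)

lemma tame_sum: "(\<And>n. n \<in> S \<Longrightarrow> tame (X n)) \<Longrightarrow> tame (\<Sum>n\<in>S. X n)"
  by (induction S rule: infinite_finite_induct) (auto intro: tame_add)

lemma tame_diagonal: "tame (diagonal d)"
proof -
  have "neg_proj * diagonal d * nonneg_proj = 0" "nonneg_proj * diagonal d * neg_proj = 0"
    by (rule rcf_matrix_eqI; auto simp: neg_proj_def nonneg_proj_def mult.assoc entry_diagonal_times entry_times_diagonal
        entry_simps diagonal.rep_eq split: if_splits)+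
  then show ?thesis by (simp add: tame_def)
qed

lemma tame_scale: "tame X \<Longrightarrow> tame (scalar_matrix c * X)"
  by (simp add: scalar_matrix_diagonal tame_times tame_diagonal)

section \<open>The affine Lie algebra inside the infinite matrices\<close>

text \<open>The operator of multiplication by \<open>A t^n\<close> on vector-valued Laurent
  polynomials.\<close>

lift_definition mode_matrix :: "complex^4^4 \<Rightarrow> int \<Rightarrow> chart_matrix" is
  "\<lambda>A n (i, m) (j, m'). if m = m' + n then A $ i $ j else 0"
proof (intro conjI allI)
  fix A :: "complex^4^4" and n :: int and r :: "4 \<times> int"
  obtain i m where r: "r = (i, m)" by (cases r)
  show "finite {c. (case r of (i, m) \<Rightarrow> \<lambda>(j, m'). if m = m' + n then A $ i $ j else 0) c \<noteq> 0}"
    by (rule finite_subset[of _ "UNIV \<times> {snd r - n}"]) (auto simp: r split: if_splits)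
  show "finite {c. (case c of (i, m) \<Rightarrow> \<lambda>(j, m'). if m = m' + n then A $ i $ j else 0) r \<noteq> 0}"
    by (rule finite_subset[of _ "UNIV \<times> {snd r + n}"]) (auto simp: r split: if_splits)
qed

lemma entry_mode_matrix: "entry (mode_matrix A n) (i, m) (j, m') = (if m = m' + n then A $ i $ j else 0)"
  by (simp add: mode_matrix.rep_eq)

lemma entry_mode_matrix_times: "entry (mode_matrix A n * X) (i, m) c = (\<Sum>k\<in>UNIV. A $ i $ k * entry X (k, m - n) c)"
proof -
  have "entry (mode_matrix A n * X) (i, m) c
      = (\<Sum>r\<in>(\<lambda>k. (k, m - n)) ` UNIV. entry (mode_matrix A n) (i, m) r * entry X r c)"
    by (rule entry_times_sum) (auto simp: entry_mode_matrix split: if_splits)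
  also have "\<dots> = (\<Sum>k\<in>UNIV. A $ i $ k * entry X (k, m - n) c)"
    by (subst sum.reindex) (auto simp: inj_on_def entry_mode_matrix)
  finally show ?thesis .
qed

lemma mode_matrix_times: "mode_matrix A m * mode_matrix B n = mode_matrix (A ** B) (m + n)"
proof (rule rcf_matrix_eqI)
  fix r c :: "4 \<times> int"
  show "entry (mode_matrix A m * mode_matrix B n) r c = entry (mode_matrix (A ** B) (m + n)) r c"
    by (cases r; cases c) (simp add: entry_mode_matrix_times entry_mode_matrix matrix_matrix_mult_def)
qed

lemma mode_matrix_add: "mode_matrix (A + B) n = mode_matrix A n + mode_matrix B n"
  by (rule rcf_matrix_eqI) (auto simp: entry_simps entry_mode_matrix)

lemma mode_matrix_diff: "mode_matrix (A - B) n = mode_matrix A n - mode_matrix B n"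
  by (rule rcf_matrix_eqI) (auto simp: entry_minus entry_mode_matrix)

lemma mode_matrix_zero [simp]: "mode_matrix 0 n = 0"
  by (rule rcf_matrix_eqI) (auto simp: entry_simps entry_mode_matrix)

lemma mode_matrix_scale: "mode_matrix (mat_of_sl4 (scale_sl4 c x)) n = scalar_matrix c * mode_matrix (mat_of_sl4 x) n"
  by (rule rcf_matrix_eqI) (auto simp: entry_scalar_matrix_times entry_mode_matrix scale_sl4.rep_eq)

text \<open>The operator \<open>t d/dt\<close>, the image of \<open>d\<close>. It is not a loop, but
  being diagonal it is tame and has cocycle 0 with every matrix.\<close>

definition degree_matrix :: chart_matrix where "degree_matrix = diagonal (\<lambda>(i, m). of_int m)"

lemma degree_mode_matrix:
  "degree_matrix * mode_matrix A n - mode_matrix A n * degree_matrix = scalar_matrix (of_int n) * mode_matrix A n"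
  by (rule rcf_matrix_eqI)
     (auto simp: degree_matrix_def entry_minus entry_diagonal_times entry_times_diagonal
       entry_scalar_matrix_times entry_mode_matrix algebra_simps)

text \<open>Multiplication by \<open>t^n\<close> carries at most \<open>abs n\<close> powers of
  \<open>t\<close> across the cut between -1 and 0.\<close>

lemma tame_mode_matrix: "tame (mode_matrix A n)"
  unfolding tame_def
proof
  show "finite_matrix (neg_proj * mode_matrix A n * nonneg_proj)"
    by (rule finite_matrixI[of "(UNIV \<times> {n..0}) \<times> (UNIV \<times> {0..- n})"])
       (auto simp: neg_proj_def nonneg_proj_def mult.assoc entry_diagonal_times entry_times_diagonal entry_mode_matrix split: if_splits)
  show "finite_matrix (nonneg_proj * mode_matrix A n * neg_proj)"
    by (rule finite_matrixI[of "(UNIV \<times> {0..n}) \<times> (UNIV \<times> {- n..0})"])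
       (auto simp: neg_proj_def nonneg_proj_def mult.assoc entry_diagonal_times entry_times_diagonal entry_mode_matrix split: if_splits)
qed

definition loop_matrix :: "(int \<Rightarrow>\<^sub>0 sl4) \<Rightarrow> chart_matrix" where
  "loop_matrix p = (\<Sum>n\<in>Poly_Mapping.keys p. mode_matrix (mat_of_sl4 (Poly_Mapping.lookup p n)) n)"

lemma loop_matrix_superset:
  "finite S \<Longrightarrow> Poly_Mapping.keys p \<subseteq> S \<Longrightarrow>
    loop_matrix p = (\<Sum>n\<in>S. mode_matrix (mat_of_sl4 (Poly_Mapping.lookup p n)) n)"
  unfolding loop_matrix_def
  by (rule sum.mono_neutral_left) (auto simp: in_keys_iff zero_sl4.rep_eq)

lemma loop_matrix_add: "loop_matrix (p + q) = loop_matrix p + loop_matrix q"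
proof -
  let ?S = "Poly_Mapping.keys p \<union> Poly_Mapping.keys q"
  have "Poly_Mapping.keys (p + q) \<subseteq> ?S" by (rule keys_add)
  then show ?thesis
    by (simp add: loop_matrix_superset[of ?S] lookup_add plus_sl4.rep_eq mode_matrix_add sum.distrib)
qed

lemma loop_matrix_zero [simp]: "loop_matrix 0 = 0"
  by (simp add: loop_matrix_def)

lemma loop_matrix_diff: "loop_matrix (p - q) = loop_matrix p - loop_matrix q"
  using loop_matrix_add[of "p - q" q] by (simp add: algebra_simps)

lemma loop_matrix_sum: "loop_matrix (\<Sum>k\<in>S. p k) = (\<Sum>k\<in>S. loop_matrix (p k))"
  by (induction S rule: infinite_finite_induct) (simp_all add: loop_matrix_add)

lemma loop_matrix_single [simp]: "loop_matrix (Poly_Mapping.single n x) = mode_matrix (mat_of_sl4 x) n"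
  by (subst loop_matrix_superset[of "{n}"]) auto

lemma loop_matrix_scale: "loop_matrix (scale_loop c p) = scalar_matrix c * loop_matrix p"
proof -
  have "Poly_Mapping.keys (scale_loop c p) \<subseteq> Poly_Mapping.keys p"
    by (auto simp: in_keys_iff lookup_scale_loop)
  then have "loop_matrix (scale_loop c p) =
      (\<Sum>n\<in>Poly_Mapping.keys p. mode_matrix (mat_of_sl4 (Poly_Mapping.lookup (scale_loop c p) n)) n)"
    by (intro loop_matrix_superset) auto
  then show ?thesis
    by (simp add: lookup_scale_loop mode_matrix_scale loop_matrix_def sum_distrib_left)
qed

lemma loop_matrix_bracket: "loop_matrix (bracket_loop p q) = loop_matrix p * loop_matrix q - loop_matrix q * loop_matrix p"
proof -
  have "loop_matrix (bracket_loop p q) = (\<Sum>m\<in>Poly_Mapping.keys p. \<Sum>n\<in>Poly_Mapping.keys q.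
      mode_matrix (mat_of_sl4 (Poly_Mapping.lookup p m)) m * mode_matrix (mat_of_sl4 (Poly_Mapping.lookup q n)) n
      - mode_matrix (mat_of_sl4 (Poly_Mapping.lookup q n)) n * mode_matrix (mat_of_sl4 (Poly_Mapping.lookup p m)) m)"
    by (simp add: bracket_loop_def loop_matrix_sum bracket_sl4.rep_eq mode_matrix_diff mode_matrix_times add.commute)
  also have "\<dots> = loop_matrix p * loop_matrix q - loop_matrix q * loop_matrix p"
    unfolding loop_matrix_def sum_product sum_subtractf
    by (subst (4) sum.swap) (rule refl)
  finally show ?thesis .
qed

lemma loop_matrix_euler: "loop_matrix (euler_loop p) = degree_matrix * loop_matrix p - loop_matrix p * degree_matrix"
proof -
  have "loop_matrix (euler_loop p) = (\<Sum>n\<in>Poly_Mapping.keys p.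
      degree_matrix * mode_matrix (mat_of_sl4 (Poly_Mapping.lookup p n)) n
      - mode_matrix (mat_of_sl4 (Poly_Mapping.lookup p n)) n * degree_matrix)"
    by (simp add: euler_loop_def loop_matrix_sum mode_matrix_scale degree_mode_matrix)
  then show ?thesis
    by (simp add: loop_matrix_def sum_subtractf sum_distrib_left sum_distrib_right)
qed

lemma tame_loop_matrix: "tame (loop_matrix p)"
  unfolding loop_matrix_def by (intro tame_sum tame_mode_matrix)

text \<open>The central coordinate \<open>a\<close> has no matrix; \<open>affine_operator\<close>
  adds it as the scalar \<open>k * a\<close>.\<close>

fun affine_matrix :: "affine \<Rightarrow> chart_matrix" where
  "affine_matrix (p, a, b) = loop_matrix p + scalar_matrix b * degree_matrix"

lemma tame_affine_matrix: "tame (affine_matrix x)"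
  by (cases x) (auto simp: degree_matrix_def intro!: tame_add tame_loop_matrix tame_scale tame_diagonal)

lemma scalar_matrix_add: "scalar_matrix (a + b) = scalar_matrix a + scalar_matrix b"
  by (rule rcf_matrix_eqI) (simp add: scalar_matrix.rep_eq entry_simps)

lemma scalar_matrix_mult: "scalar_matrix (a * b) = scalar_matrix a * scalar_matrix b"
  by (rule rcf_matrix_eqI) (simp add: entry_scalar_matrix_times scalar_matrix.rep_eq)

lemma affine_matrix_add: "affine_matrix (x + y) = affine_matrix x + affine_matrix y"
  by (cases x; cases y) (simp add: loop_matrix_add scalar_matrix_add distrib_right add_ac)

lemma affine_matrix_scale: "affine_matrix (scale_affine c x) = scalar_matrix c * affine_matrix x"
  by (cases x) (simp add: loop_matrix_scale scalar_matrix_mult distrib_left mult.assoc)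

lemma affine_matrix_bracket:
  "affine_matrix (bracket_affine x y) = affine_matrix x * affine_matrix y - affine_matrix y * affine_matrix x"
proof -
  obtain p a b q a' b' where xy: "x = (p, a, b)" "y = (q, a', b')" by (cases x, cases y) auto
  let ?D = degree_matrix
  show ?thesis
    by (simp add: xy loop_matrix_add loop_matrix_diff loop_matrix_bracket loop_matrix_scale loop_matrix_euler
        distrib_left distrib_right right_diff_distrib mult.assoc scalar_matrix_pull[of "loop_matrix p"]
        scalar_matrix_pull[of "loop_matrix q"] scalar_matrix_pull[of ?D] scalar_matrix_pull[of "scalar_matrix b'" b])
qed

section \<open>The cocycle on the affine algebra\<close>

lemma matrix_cocycle_add:
  assumes "tame X" "tame X'" "tame Y"
  shows "matrix_cocycle (X + X') Y = matrix_cocycle X Y + matrix_cocycle X' Y"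
    and "matrix_cocycle Y (X + X') = matrix_cocycle Y X + matrix_cocycle Y X'"
  using assms unfolding matrix_cocycle_def tame_def
  by (simp_all add: distrib_left distrib_right matrix_trace_add finite_matrix_times_right)

lemma matrix_cocycle_zero [simp]: "matrix_cocycle 0 Y = 0" "matrix_cocycle Y 0 = 0"
  by (simp_all add: matrix_cocycle_def)

lemma matrix_cocycle_sum:
  assumes "\<And>n. n \<in> S \<Longrightarrow> tame (X n)" "tame Y"
  shows "matrix_cocycle (\<Sum>n\<in>S. X n) Y = (\<Sum>n\<in>S. matrix_cocycle (X n) Y)"
    and "matrix_cocycle Y (\<Sum>n\<in>S. X n) = (\<Sum>n\<in>S. matrix_cocycle Y (X n))"
  using assms
  by (induction S rule: infinite_finite_induct) (simp_all add: matrix_cocycle_add tame_sum)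

text \<open>A diagonal entry at degree \<open>r\<close> comes from a path that goes from
  \<open>r\<close>, at least 0, down to a negative \<open>r - m\<close> and back: \<open>m\<close>
  values of \<open>r\<close> if \<open>m\<close> is positive, none otherwise.\<close>

lemma trace_mode_matrices:
  "matrix_trace (mode_matrix A m * (neg_proj * mode_matrix B n * nonneg_proj)) =
     (if m + n = 0 then of_nat (nat m) * trace (A ** B) else 0)"
proof -
  have diag: "entry (mode_matrix A m * (neg_proj * mode_matrix B n * nonneg_proj)) (i, r) (i, r) =
      (if m + n = 0 \<and> 0 \<le> r \<and> r < m then (A ** B) $ i $ i else 0)" for i r
    by (auto simp: entry_mode_matrix_times neg_proj_def nonneg_proj_def mult.assoc entry_diagonal_times entry_times_diagonal
        entry_mode_matrix matrix_matrix_mult_def intro!: sum.neutral)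
  have "matrix_trace (mode_matrix A m * (neg_proj * mode_matrix B n * nonneg_proj)) =
      (\<Sum>x\<in>UNIV \<times> {0..<m}. entry (mode_matrix A m * (neg_proj * mode_matrix B n * nonneg_proj)) x x)"
    by (rule matrix_trace_eq) (auto simp: diag split: if_splits)
  also have "\<dots> = (\<Sum>i\<in>UNIV. \<Sum>r\<in>{0..<m}. if m + n = 0 then (A ** B) $ i $ i else 0)"
    unfolding sum.cartesian_product by (rule sum.cong) (auto simp: diag)
  finally show ?thesis
    by (simp add: trace_def sum_distrib_left)
qed

lemma matrix_cocycle_mode:
  "matrix_cocycle (mode_matrix (mat_of_sl4 x) m) (mode_matrix (mat_of_sl4 y) n) =
     (if m + n = 0 then of_int m * form_sl4 x y else 0)"
proof (cases "m + n = 0")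
  case True
  then have n: "n = - m" by presburger
  let ?t = "trace (mat_of_sl4 x ** mat_of_sl4 y)"
  have "trace (mat_of_sl4 y ** mat_of_sl4 x) = ?t" by (rule trace_mul_sym)
  then have "matrix_cocycle (mode_matrix (mat_of_sl4 x) m) (mode_matrix (mat_of_sl4 y) n)
      = of_nat (nat m) * ?t - of_nat (nat (- m)) * ?t"
    unfolding matrix_cocycle_def trace_mode_matrices n by simp
  \<comment> \<open>The two counts are the positive and the negative part of
    \<open>m\<close>.\<close>
  also have "\<dots> = of_int m * ?t"
    by (cases m rule: int_cases2) simp_all
  finally show ?thesis using True by (simp add: form_sl4_def)
next
  case False
  then have "n + m \<noteq> 0" by presburger
  with False show ?thesis unfolding matrix_cocycle_def trace_mode_matrices by simp
qed

lemma matrix_cocycle_loop: "matrix_cocycle (loop_matrix p) (loop_matrix q) = cocycle_loop p q"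
proof -
  have "matrix_cocycle (loop_matrix p) (loop_matrix q) = (\<Sum>m\<in>Poly_Mapping.keys p. \<Sum>n\<in>Poly_Mapping.keys q.
      if m + n = 0 then of_int m * form_sl4 (Poly_Mapping.lookup p m) (Poly_Mapping.lookup q n) else 0)"
    unfolding loop_matrix_def
    by (simp add: matrix_cocycle_sum tame_mode_matrix tame_sum matrix_cocycle_mode) (rule sum.swap)
  also have "\<dots> = (\<Sum>m\<in>Poly_Mapping.keys p. of_int m * form_sl4 (Poly_Mapping.lookup p m) (Poly_Mapping.lookup q (- m)))"
  proof (rule sum.cong[OF refl])
    fix m
    have "(\<Sum>n\<in>Poly_Mapping.keys q. if m + n = 0 then of_int m * form_sl4 (Poly_Mapping.lookup p m) (Poly_Mapping.lookup q n) else 0)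
      = (\<Sum>n\<in>Poly_Mapping.keys q. if n = - m then of_int m * form_sl4 (Poly_Mapping.lookup p m) (Poly_Mapping.lookup q (- m)) else 0)"
      by (rule sum.cong) auto
    then show "(\<Sum>n\<in>Poly_Mapping.keys q. if m + n = 0 then of_int m * form_sl4 (Poly_Mapping.lookup p m) (Poly_Mapping.lookup q n) else 0)
      = of_int m * form_sl4 (Poly_Mapping.lookup p m) (Poly_Mapping.lookup q (- m))"
      by (auto simp: in_keys_iff)
  qed
  finally show ?thesis by (simp add: cocycle_loop_def)
qed

lemma matrix_cocycle_diagonal: "matrix_cocycle (diagonal d) Y = 0" "matrix_cocycle Y (diagonal d) = 0"
proof -
  have "entry (diagonal d * (neg_proj * Y * nonneg_proj)) i i = 0" for i Y
    by (cases i) (simp add: neg_proj_def nonneg_proj_def mult.assoc entry_diagonal_times entry_times_diagonal)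
  then have "matrix_trace (diagonal d * (neg_proj * Y * nonneg_proj)) = 0" for Y
    by (simp add: matrix_trace_def)
  moreover have "neg_proj * diagonal d * nonneg_proj = 0"
    by (rule rcf_matrix_eqI; auto simp: neg_proj_def nonneg_proj_def mult.assoc entry_diagonal_times entry_times_diagonal
        entry_simps diagonal.rep_eq split: if_splits)
  ultimately show "matrix_cocycle (diagonal d) Y = 0" "matrix_cocycle Y (diagonal d) = 0"
    by (simp_all add: matrix_cocycle_def)
qed

lemma matrix_cocycle_affine:
  "matrix_cocycle (affine_matrix x) (affine_matrix y) = fst (snd (bracket_affine x y))"
proof -
  obtain p a b q a' b' where xy: "x = (p, a, b)" "y = (q, a', b')" by (cases x, cases y) auto
  obtain d d' where "scalar_matrix b * degree_matrix = diagonal d" "scalar_matrix b' * degree_matrix = diagonal d'"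
  proof
    show "scalar_matrix b * degree_matrix = diagonal (\<lambda>(i, m). b * of_int m)"
      "scalar_matrix b' * degree_matrix = diagonal (\<lambda>(i, m). b' * of_int m)"
      by (rule rcf_matrix_eqI; auto simp: degree_matrix_def entry_scalar_matrix_times diagonal.rep_eq)+
  qed
  then show ?thesis
    by (simp add: xy matrix_cocycle_add tame_loop_matrix tame_diagonal tame_add matrix_cocycle_diagonal matrix_cocycle_loop)
qed

section \<open>Pairing the vacuum module with polynomial functions\<close>

definition affine_operator :: "complex \<Rightarrow> affine \<Rightarrow> (chart_matrix \<Rightarrow> complex) \<Rightarrow> chart_matrix \<Rightarrow> complex" where
  "affine_operator k x = field_operator k (affine_matrix x) (k * fst (snd x))"

definition word_operator :: "complex \<Rightarrow> affine word \<Rightarrow> (chart_matrix \<Rightarrow> complex) \<Rightarrow> chart_matrix \<Rightarrow> complex" where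
  "word_operator k w = fold (affine_operator k) (letters w)"

definition free_operator :: "complex \<Rightarrow> free_algebra \<Rightarrow> (chart_matrix \<Rightarrow> complex) \<Rightarrow> chart_matrix \<Rightarrow> complex" where
  "free_operator k u f Z = (\<Sum>w\<in>Poly_Mapping.keys u. Poly_Mapping.lookup u w * word_operator k w f Z)"

lemma polynomials_affine_operator: "f \<in> polynomials \<Longrightarrow> affine_operator k x f \<in> polynomials"
  unfolding affine_operator_def by (intro polynomials_field_operator tame_affine_matrix)

lemma polynomials_fold: "f \<in> polynomials \<Longrightarrow> fold (affine_operator k) xs f \<in> polynomials"
  by (induction xs arbitrary: f) (auto intro: polynomials_affine_operator)

lemma fold_affine_operator_cong:
  assumes "\<And>Z. Z \<in> chart \<Longrightarrow> f Z = g Z" "Z \<in> chart"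
  shows "fold (affine_operator k) xs f Z = fold (affine_operator k) xs g Z"
  using assms
proof (induction xs arbitrary: f g)
  case (Cons x xs)
  have "affine_operator k x f Z = affine_operator k x g Z" if "Z \<in> chart" for Z
    unfolding affine_operator_def using that Cons.prems by (intro field_operator_cong tame_affine_matrix)
  from Cons.IH[OF this Cons.prems(2)] show ?case by simp
qed simp

lemma affine_operator_add_right:
  "f \<in> polynomials \<Longrightarrow> g \<in> polynomials \<Longrightarrow> Z \<in> chart \<Longrightarrow>
    affine_operator k x (\<lambda>Z. f Z + g Z) Z = affine_operator k x f Z + affine_operator k x g Z"
  unfolding affine_operator_def by (intro field_operator_add tame_affine_matrix)

lemma affine_operator_scale_right:
  "f \<in> polynomials \<Longrightarrow> Z \<in> chart \<Longrightarrow> affine_operator k x (\<lambda>Z. a * f Z) Z = a * affine_operator k x f Z"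
  unfolding affine_operator_def by (intro field_operator_scale tame_affine_matrix)

lemma fold_affine_operator_add:
  assumes "f \<in> polynomials" "g \<in> polynomials" "Z \<in> chart"
  shows "fold (affine_operator k) xs (\<lambda>Z. f Z + g Z) Z
    = fold (affine_operator k) xs f Z + fold (affine_operator k) xs g Z"
  using assms
proof (induction xs arbitrary: f g)
  case (Cons x xs)
  have "fold (affine_operator k) xs (affine_operator k x (\<lambda>Z. f Z + g Z)) Z
      = fold (affine_operator k) xs (\<lambda>Z. affine_operator k x f Z + affine_operator k x g Z) Z"
    using Cons.prems by (intro fold_affine_operator_cong affine_operator_add_right)
  then show ?case using Cons by (simp add: polynomials_affine_operator)
qed simp

lemma fold_affine_operator_scale:
  assumes "f \<in> polynomials" "Z \<in> chart"
  shows "fold (affine_operator k) xs (\<lambda>Z. a * f Z) Z = a * fold (affine_operator k) xs f Z"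
  using assms
proof (induction xs arbitrary: f)
  case (Cons x xs)
  have "fold (affine_operator k) xs (affine_operator k x (\<lambda>Z. a * f Z)) Z
      = fold (affine_operator k) xs (\<lambda>Z. a * affine_operator k x f Z) Z"
    using Cons.prems by (intro fold_affine_operator_cong affine_operator_scale_right)
  then show ?case using Cons by (simp add: polynomials_affine_operator)
qed simp

lemma free_operator_superset:
  "finite S \<Longrightarrow> Poly_Mapping.keys u \<subseteq> S \<Longrightarrow>
    free_operator k u f Z = (\<Sum>w\<in>S. Poly_Mapping.lookup u w * word_operator k w f Z)"
  unfolding free_operator_def by (rule sum.mono_neutral_left) (auto simp: in_keys_iff)

lemma free_operator_zero [simp]: "free_operator k 0 f Z = 0"
  by (simp add: free_operator_def)

lemma free_operator_add: "free_operator k (u + w) f Z = free_operator k u f Z + free_operator k w f Z"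
proof -
  let ?S = "Poly_Mapping.keys u \<union> Poly_Mapping.keys w"
  have "Poly_Mapping.keys (u + w) \<subseteq> ?S" by (rule keys_add)
  then show ?thesis
    by (simp add: free_operator_superset[of ?S] lookup_add distrib_right sum.distrib)
qed

lemma free_operator_diff: "free_operator k (u - w) f Z = free_operator k u f Z - free_operator k w f Z"
  using free_operator_add[of k "u - w" w f Z] by simp

lemma free_operator_single: "free_operator k (Poly_Mapping.single w c) f Z = c * word_operator k w f Z"
  by (subst free_operator_superset[of "{w}"]) auto

lemma polynomials_free_operator: "f \<in> polynomials \<Longrightarrow> free_operator k u f \<in> polynomials"
proof -
  assume "f \<in> polynomials"
  then have "(\<lambda>Z. free_operator k u f Z) \<in> polynomials"
    unfolding free_operator_def word_operator_def
    by (intro polynomials_sum polynomials.mult polynomials.const polynomials_fold)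
  then show ?thesis by simp
qed

lemma free_operator_cong:
  "(\<And>Z. Z \<in> chart \<Longrightarrow> f Z = g Z) \<Longrightarrow> Z \<in> chart \<Longrightarrow> free_operator k u f Z = free_operator k u g Z"
  unfolding free_operator_def word_operator_def
  by (rule sum.cong) (auto intro: fold_affine_operator_cong)

lemma free_operator_add_right:
  assumes "f \<in> polynomials" "g \<in> polynomials" "Z \<in> chart"
  shows "free_operator k u (\<lambda>Z. f Z + g Z) Z = free_operator k u f Z + free_operator k u g Z"
  using assms by (simp add: free_operator_def word_operator_def fold_affine_operator_add distrib_left sum.distrib)

lemma free_operator_scale_right:
  assumes "f \<in> polynomials" "Z \<in> chart"
  shows "free_operator k u (\<lambda>Z. a * f Z) Z = a * free_operator k u f Z"
  using assms by (simp add: free_operator_def word_operator_def fold_affine_operator_scale sum_distrib_left mult.left_commute)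

text \<open>This makes the polynomials a right module over the free algebra: in a product the left
  factor acts first. Additivity reduces it to words, where it is \<open>fold\<close> over a
  concatenation.\<close>

lemma free_operator_mult:
  assumes f: "f \<in> polynomials" and Z: "Z \<in> chart"
  shows "free_operator k (u * w) f Z = free_operator k w (free_operator k u f) Z"
proof (induction u rule: poly_mapping_single_add_induct)
  case zero
  \<comment> \<open>Writing the zero function as \<open>0 * f\<close> brings it under the scaling
    rule.\<close>
  have "free_operator k w (free_operator k 0 f) Z = free_operator k w (\<lambda>Z. 0 * f Z) Z"
    by (intro free_operator_cong Z) simp
  also have "\<dots> = 0" by (subst free_operator_scale_right) (use f Z in auto)
  finally show ?case by (metis mult_zero_left free_operator_zero)
next
  case (add u v)
  have "free_operator k w (free_operator k (u + v) f) Z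
      = free_operator k w (\<lambda>Z. free_operator k u f Z + free_operator k v f Z) Z"
    by (intro free_operator_cong Z free_operator_add)
  also have "\<dots> = free_operator k w (free_operator k u f) Z + free_operator k w (free_operator k v f) Z"
    by (intro free_operator_add_right polynomials_free_operator f Z)
  finally have "free_operator k w (free_operator k (u + v) f) Z
      = free_operator k w (free_operator k u f) Z + free_operator k w (free_operator k v f) Z" .
  moreover have "free_operator k ((u + v) * w) f Z
      = free_operator k w (free_operator k u f) Z + free_operator k w (free_operator k v f) Z"
    by (simp add: distrib_right free_operator_add add)
  ultimately show ?case by metis
next
  case (single x c)
  show ?case
  proof (induction w rule: poly_mapping_single_add_induct)
    case (single y d)
    have "free_operator k (Poly_Mapping.single y d) (free_operator k (Poly_Mapping.single x c) f) Z
        = free_operator k (Poly_Mapping.single y d) (\<lambda>Z. c * word_operator k x f Z) Z"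
      by (intro free_operator_cong Z free_operator_single)
    also have "\<dots> = c * (d * word_operator k y (word_operator k x f) Z)"
      by (subst free_operator_scale_right) (auto simp: free_operator_single word_operator_def intro: polynomials_fold f Z)
    also have "word_operator k y (word_operator k x f) = word_operator k (x + y) f"
      by (simp add: word_operator_def plus_word_def)
    finally have "free_operator k (Poly_Mapping.single y d) (free_operator k (Poly_Mapping.single x c) f) Z
        = c * (d * word_operator k (x + y) f Z)" .
    moreover have "free_operator k (Poly_Mapping.single x c * Poly_Mapping.single y d) f Z
        = c * (d * word_operator k (x + y) f Z)"
      by (simp add: mult_single free_operator_single)
    ultimately show ?case by metis
  qed (simp_all add: distrib_left free_operator_add)
qed

lemma free_operator_generator: "free_operator k (generator x) f Z = affine_operator k x f Z"
  by (simp add: generator_def free_operator_single word_operator_def)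

lemma free_operator_scalar: "free_operator k (free_scalar c) f Z = c * f Z"
  by (simp add: free_scalar_def free_operator_single word_operator_def zero_word_def)

section \<open>Descent to the enveloping algebra\<close>

lemma moebius_field_linear:
  "moebius_field (X + Y) Z = moebius_field X Z + moebius_field Y Z"
  "moebius_field (scalar_matrix c * X) Z = scalar_matrix c * moebius_field X Z"
  by (simp_all add: moebius_field_def distrib_left distrib_right scalar_matrix_pull mult.assoc)

lemma trace_chart_add:
  "Z \<in> chart \<Longrightarrow> matrix_trace ((X + Y) * Z) = matrix_trace (X * Z) + matrix_trace (Y * Z)"
  by (simp add: chart_def distrib_right matrix_trace_add finite_matrix_times_right)

lemma affine_operator_add:
  assumes "f \<in> polynomials" "Z \<in> chart"
  shows "affine_operator k (x + y) f Z = affine_operator k x f Z + affine_operator k y f Z"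
  using assms
  by (simp add: affine_operator_def field_operator_def affine_matrix_add moebius_field_linear
      directional_direction_add moebius_in_chart tame_affine_matrix trace_chart_add)
     (simp add: algebra_simps)

lemma affine_operator_scale:
  assumes "f \<in> polynomials" "Z \<in> chart"
  shows "affine_operator k (scale_affine c x) f Z = c * affine_operator k x f Z"
proof -
  have "fst (snd (scale_affine c x)) = c * fst (snd x)" by (cases x) simp
  then show ?thesis
    using assms
    by (simp add: affine_operator_def field_operator_def affine_matrix_scale moebius_field_linear
        directional_direction_scale moebius_in_chart tame_affine_matrix matrix_trace_scalar_times mult.assoc)
       (simp add: algebra_simps)
qed

lemma affine_operator_bracket:
  assumes "f \<in> polynomials" "Z \<in> chart"
  shows "affine_operator k (bracket_affine x y) f Z =
    affine_operator k y (affine_operator k x f) Z - affine_operator k x (affine_operator k y f) Z"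
  unfolding affine_operator_def affine_matrix_bracket matrix_cocycle_affine[symmetric]
  by (rule field_operator_commutator[symmetric])
     (use assms in \<open>auto intro: tame_affine_matrix tame_minus tame_times\<close>)

lemma free_operator_envelope_relation:
  assumes "r \<in> envelope_relations" "f \<in> polynomials" "Z \<in> chart"
  shows "free_operator k r f Z = 0"
proof -
  have "affine_operator k x (free_operator k (free_scalar c) f) Z = c * affine_operator k x f Z" for x c
  proof -
    have "affine_operator k x (free_operator k (free_scalar c) f) Z = affine_operator k x (\<lambda>Z. c * f Z) Z"
      unfolding affine_operator_def
      by (intro field_operator_cong tame_affine_matrix assms free_operator_scalar)
    then show ?thesis
      unfolding affine_operator_def by (simp add: field_operator_scale tame_affine_matrix assms)
  qed
  moreover have "free_operator k (generator x) f = affine_operator k x f" for x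
    by (rule ext) (rule free_operator_generator)
  ultimately show ?thesis
    using assms unfolding envelope_relations_def Un_iff mem_Collect_eq
    by (elim disjE exE conjE) (simp_all add: free_operator_diff free_operator_generator
        free_operator_mult affine_operator_add affine_operator_scale affine_operator_bracket)
qed

lemma free_operator_ideal:
  assumes "u \<in> two_sided_ideal envelope_relations" "f \<in> polynomials" "Z \<in> chart"
  shows "free_operator k u f Z = 0"
  using assms(1)
proof (induction rule: two_sided_ideal.induct)
  case (add r u a b)
  have "free_operator k (a * r * b) f Z = free_operator k b (free_operator k (a * r) f) Z"
    by (rule free_operator_mult[OF assms(2,3)])
  also have "\<dots> = free_operator k b (\<lambda>Z. 0 * f Z) Z"
  proof (rule free_operator_cong[OF _ assms(3)])
    fix Z assume "Z \<in> chart"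
    then show "free_operator k (a * r) f Z = 0 * f Z"
      using add.hyps assms(2)
      by (simp add: free_operator_mult free_operator_envelope_relation polynomials_free_operator)
  qed
  also have "\<dots> = 0"
    by (subst free_operator_scale_right) (use assms in auto)
  finally show ?case using add.IH by (simp add: free_operator_add)
qed simp

text \<open>A representative is chosen because equivalent elements are shown to act alike only on
  \<open>polynomials\<close> and at points of \<open>chart\<close>, which is too little for lifting
  a total function.\<close>

definition pairing :: "complex \<Rightarrow> envelope \<Rightarrow> (chart_matrix \<Rightarrow> complex) \<Rightarrow> chart_matrix \<Rightarrow> complex" where
  "pairing k u = free_operator k (rep_envelope u)"

lemma pairing_abs:
  assumes "f \<in> polynomials" "Z \<in> chart"
  shows "pairing k (abs_envelope u) f Z = free_operator k u f Z"
proof -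
  have "rep_envelope (abs_envelope u) - u \<in> two_sided_ideal envelope_relations"
    using Quotient_rep_abs[OF Quotient_envelope, of u] by (simp add: two_sided_ideal.zero)
  from free_operator_ideal[OF this assms] show ?thesis
    by (simp add: pairing_def free_operator_diff)
qed

lemma polynomials_pairing: "f \<in> polynomials \<Longrightarrow> pairing k u f \<in> polynomials"
  unfolding pairing_def by (rule polynomials_free_operator)

context
  fixes f Z
  assumes f: "f \<in> polynomials" and Z: "Z \<in> chart"
begin

lemma pairing_emb: "pairing k (emb x) f Z = affine_operator k x f Z"
  unfolding emb.abs_eq by (simp add: pairing_abs f Z free_operator_generator)

lemma pairing_scalar: "pairing k (scalar c) f Z = c * f Z"
  unfolding scalar.abs_eq by (simp add: pairing_abs f Z free_operator_scalar)

lemma pairing_add: "pairing k (u + w) f Z = pairing k u f Z + pairing k w f Z"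
proof (induction u rule: envelope.abs_induct)
  case (1 u)
  show ?case
    by (induction w rule: envelope.abs_induct)
       (simp add: plus_envelope.abs_eq pairing_abs f Z free_operator_add)
qed

lemma pairing_mult: "pairing k (u * w) f Z = pairing k w (pairing k u f) Z"
proof (induction u rule: envelope.abs_induct)
  case (1 u)
  show ?case
  proof (induction w rule: envelope.abs_induct)
    case (1 w)
    have "pairing k (abs_envelope w) (pairing k (abs_envelope u) f) Z = free_operator k w (free_operator k u f) Z"
      unfolding pairing_abs[OF polynomials_pairing[OF f] Z]
      by (rule free_operator_cong[OF pairing_abs[OF f] Z])
    then show ?case
      by (simp add: times_envelope.abs_eq pairing_abs f Z free_operator_mult)
  qed
qed

end

lemma scalar_matrix_one [simp]: "scalar_matrix 1 = 1"
  by transfer simp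

lemma moebius_field_at_zero: "moebius_field X 0 = neg_proj * X * nonneg_proj"
  by (simp add: moebius_field_def)

lemma directional_zero: "f \<in> polynomials \<Longrightarrow> Z \<in> chart \<Longrightarrow> directional f Z 0 = 0"
  using directional_direction_scale[of f Z 0 0] by simp

text \<open>At \<open>Z = 0\<close> the multiplier \<open>tr (X Z)\<close> vanishes and the field is
  \<open>P X Q\<close>, which is 0 for operators preserving \<open>H_+\<close>: nonnegative modes
  and the degree operator. Of \<open>K\<close> only its scalar \<open>k\<close> is left.\<close>

lemma pairing_vacuum_relation:
  assumes "r \<in> vacuum_relations k" "f \<in> polynomials"
  shows "pairing k r f 0 = 0"
proof -
  have "neg_proj * mode_matrix A n * nonneg_proj = 0" if "0 \<le> n" for A n
    using that by (intro rcf_matrix_eqI) (auto simp: neg_proj_def nonneg_proj_def mult.assoc entry_diagonal_times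
        entry_times_diagonal entry_simps mode_matrix.rep_eq split: if_splits)
  then have "affine_operator k (mode x n) f 0 = 0" if "0 \<le> n" for x n
    using that assms(2) by (simp add: affine_operator_def field_operator_def mode_def moebius_field_at_zero
        directional_zero)
  moreover have "affine_operator k central_K f 0 = k * f 0"
    using assms(2) by (simp add: affine_operator_def field_operator_def central_K_def moebius_field_at_zero
        directional_zero)
  moreover have "affine_operator k derivation_d f 0 = 0"
  proof -
    have "neg_proj * degree_matrix * nonneg_proj = 0"
      by (rule rcf_matrix_eqI) (auto simp: neg_proj_def nonneg_proj_def degree_matrix_def mult.assoc entry_diagonal_times
          entry_times_diagonal entry_simps diagonal.rep_eq split: if_splits)
    then show ?thesis
      using assms(2) by (simp add: affine_operator_def field_operator_def derivation_d_def
          moebius_field_at_zero directional_zero)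
  qed
  moreover have "pairing k (u - w) f 0 = pairing k u f 0 - pairing k w f 0" for u w
    using pairing_add[OF assms(2) chart_zero, of k "u - w" w] by simp
  ultimately show ?thesis
    using assms by (auto simp: vacuum_relations_def pairing_emb pairing_scalar)
qed

text \<open>In \<open>a * r\<close> the relation \<open>r\<close> acts last, on the polynomial
  \<open>pairing k a f\<close>, and the result is evaluated at 0; hence the functional annihilates a
  left ideal.\<close>

lemma pairing_left_ideal:
  assumes "u \<in> left_ideal (vacuum_relations k)" "f \<in> polynomials"
  shows "pairing k u f 0 = 0"
  using assms(1)
proof (induction rule: left_ideal.induct)
  case zero
  have "pairing k (scalar 0) f 0 = 0" by (simp add: pairing_scalar assms del: scalar_0)
  then show ?case by simp
next
  case (add r u a)
  then show ?case
    using assms by (simp add: pairing_add pairing_mult pairing_vacuum_relation polynomials_pairing)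
qed

lemma pairing_cong:
  "(\<And>Z. Z \<in> chart \<Longrightarrow> f Z = g Z) \<Longrightarrow> Z \<in> chart \<Longrightarrow> pairing k u f Z = pairing k u g Z"
  unfolding pairing_def by (rule free_operator_cong)

lemma pairing_scale_right:
  "f \<in> polynomials \<Longrightarrow> Z \<in> chart \<Longrightarrow> pairing k u (\<lambda>Z. a * f Z) Z = a * pairing k u f Z"
  unfolding pairing_def by (rule free_operator_scale_right)

section \<open>The test function\<close>

definition superdiagonal :: "complex^4^4 \<Rightarrow> complex" where
  "superdiagonal A = A $ 1 $ 2 + A $ 2 $ 3 + A $ 3 $ 4"

text \<open>This reads the block of \<open>Z\<close> from degree 0 to degree -1, which
  \<open>x(-1)\<close> translates by the matrix of \<open>x\<close>.\<close>

definition superdiagonal_coordinate :: "chart_matrix \<Rightarrow> complex" where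
  "superdiagonal_coordinate Z = entry Z (1, - 1) (2, 0) + entry Z (2, - 1) (3, 0) + entry Z (3, - 1) (4, 0)"

lemma polynomials_superdiagonal_coordinate: "superdiagonal_coordinate \<in> polynomials"
proof -
  have "(\<lambda>Z. superdiagonal_coordinate Z) \<in> polynomials"
    unfolding superdiagonal_coordinate_def by (intro polynomials_basic)
  then show ?thesis by simp
qed

lemma directional_superdiagonal_coordinate:
  "Z \<in> chart \<Longrightarrow> W \<in> chart \<Longrightarrow> directional superdiagonal_coordinate Z W = superdiagonal_coordinate W"
  unfolding superdiagonal_coordinate_def[abs_def]
  by (simp add: directional_add directional_entry polynomials_basic)

lemma polynomials_power: "f \<in> polynomials \<Longrightarrow> (\<lambda>Z. f Z ^ r) \<in> polynomials"
  by (induction r) (auto intro: polynomials_basic)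

lemma directional_power:
  assumes "f \<in> polynomials" "Z \<in> chart" "W \<in> chart"
  shows "directional (\<lambda>Z. f Z ^ r) Z W = of_nat r * directional f Z W * f Z ^ (r - 1)"
proof (induction r)
  case (Suc r)
  have "directional (\<lambda>Z. f Z * f Z ^ r) Z W = f Z * directional (\<lambda>Z. f Z ^ r) Z W + directional f Z W * f Z ^ r"
    using assms by (intro directional_mult polynomials_power)
  also have "\<dots> = of_nat (Suc r) * directional f Z W * f Z ^ r"
    unfolding Suc.IH by (cases r) (simp_all add: algebra_simps)
  finally show ?case by simp
qed (simp add: directional_const)

lemma chart_entry_zero: "Z \<in> chart \<Longrightarrow> 0 \<le> m \<or> m' < 0 \<Longrightarrow> entry Z (i, m) (j, m') = 0"
proof -
  assume Z: "Z \<in> chart" and m: "0 \<le> m \<or> m' < 0"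
  have "entry (neg_proj * Z * nonneg_proj) (i, m) (j, m') = 0"
    using m by (auto simp: neg_proj_def nonneg_proj_def mult.assoc entry_diagonal_times entry_times_diagonal)
  then show "entry Z (i, m) (j, m') = 0" by (simp add: mult.assoc chart_simps[OF Z])
qed

text \<open>Negative modes lower degrees, so \<open>Q X P\<close> is 0. In this block the linear
  terms meet only rows of \<open>Z\<close> of nonnegative degree or columns of negative degree,
  where \<open>Z\<close> vanishes. The constant term \<open>P X Q\<close> remains.\<close>

lemma moebius_field_negative_mode:
  assumes "n < 0" "Z \<in> chart"
  shows "entry (moebius_field (mode_matrix A n) Z) (i, - 1) (j, 0) = (if n = - 1 then A $ i $ j else 0)"
proof -
  let ?X = "mode_matrix A n"
  have "nonneg_proj * ?X * neg_proj = 0"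
    using assms(1) by (intro rcf_matrix_eqI) (auto simp: neg_proj_def nonneg_proj_def mult.assoc entry_diagonal_times
        entry_times_diagonal entry_simps mode_matrix.rep_eq split: if_splits)
  moreover have "entry (neg_proj * ?X * Z) (i, - 1) (j, 0) = 0"
    using assms by (simp add: mult.assoc neg_proj_def entry_diagonal_times entry_mode_matrix_times chart_entry_zero)
  moreover have "entry (Z * ?X * nonneg_proj) (i, - 1) (j, 0) = 0"
  proof (rule ccontr)
    assume "entry (Z * ?X * nonneg_proj) (i, - 1) (j, 0) \<noteq> 0"
    then have "entry (Z * ?X) (i, - 1) (j, 0) \<noteq> 0" by (simp add: nonneg_proj_def entry_times_diagonal)
    then obtain k s where "entry Z (i, - 1) (k, s) \<noteq> 0" "entry ?X (k, s) (j, 0) \<noteq> 0"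
      using entry_times_nonzero by fastforce
    with assms show False by (auto simp: entry_mode_matrix chart_entry_zero split: if_splits)
  qed
  moreover have "entry (neg_proj * ?X * nonneg_proj) (i, - 1) (j, 0) = (if n = - 1 then A $ i $ j else 0)"
    by (auto simp: neg_proj_def nonneg_proj_def mult.assoc entry_diagonal_times entry_times_diagonal entry_mode_matrix)
  ultimately show ?thesis
    by (simp add: moebius_field_expand[OF assms(2)] entry_simps entry_minus)
qed

lemma trace_negative_mode: "n < 0 \<Longrightarrow> Z \<in> chart \<Longrightarrow> matrix_trace (mode_matrix A n * Z) = 0"
proof -
  assume n: "n < 0" and Z: "Z \<in> chart"
  have "entry (mode_matrix A n * Z) (i, m) (i, m) = 0" for i m
    using n Z by (cases "m < 0") (simp_all add: entry_mode_matrix_times chart_entry_zero)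
  then have "entry (mode_matrix A n * Z) c c = 0" for c
    by (cases c) simp
  then show ?thesis by (simp add: matrix_trace_def)
qed

text \<open>The coordinate moves at constant speed and the trace is 0, so the operator is plain
  differentiation of a power; the level drops out.\<close>

lemma affine_operator_superdiagonal_power:
  assumes "n < 0" "Z \<in> chart"
  shows "affine_operator k (mode x n) (\<lambda>Z. superdiagonal_coordinate Z ^ r) Z =
    (if n = - 1 then of_nat r * superdiagonal (mat_of_sl4 x) * superdiagonal_coordinate Z ^ (r - 1) else 0)"
proof -
  let ?W = "moebius_field (mode_matrix (mat_of_sl4 x) n) Z"
  have W: "?W \<in> chart" by (intro moebius_in_chart tame_mode_matrix assms)
  have "superdiagonal_coordinate ?W = (if n = - 1 then superdiagonal (mat_of_sl4 x) else 0)"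
    by (simp add: superdiagonal_coordinate_def superdiagonal_def moebius_field_negative_mode assms)
  then show ?thesis
    using assms W by (simp add: affine_operator_def field_operator_def mode_def trace_negative_mode
        directional_power directional_superdiagonal_coordinate polynomials_superdiagonal_coordinate)
qed

section \<open>Straightening words\<close>

text \<open>A datatype lets evaluation decide equality of indices by constructors;
  \<open>pos\<close> leads back to the type \<open>4\<close>.\<close>

datatype idx = I1 | I2 | I3 | I4

fun pos :: "idx \<Rightarrow> 4" where
  "pos I1 = 1" | "pos I2 = 2" | "pos I3 = 3" | "pos I4 = 4"

fun rank :: "idx \<Rightarrow> int" where
  "rank I1 = 1" | "rank I2 = 2" | "rank I3 = 3" | "rank I4 = 4"

definition kron :: "idx \<Rightarrow> idx \<Rightarrow> int" where "kron i j = (if i = j then 1 else 0)"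

type_synonym letter = "idx \<times> idx \<times> int"

text \<open>Subtracting \<open>E_44\<close> makes diagonal units traceless. For
  \<open>i = j = 4\<close> the result is 0, which is what \<open>zero_letter\<close>
  records.\<close>

lift_definition unit_vector :: "4 \<Rightarrow> 4 \<Rightarrow> sl4" is
  "\<lambda>i j. matrix_unit i j - (if i = j then matrix_unit 4 4 else 0)"
  by (auto simp: trace_sub) (auto simp: trace_def matrix_unit_def intro!: sum.neutral)

text \<open>The letter \<open>(i, j, n)\<close> stands for \<open>2 (E\<^sub>i\<^sub>j - \<delta>\<^sub>i\<^sub>j E\<^sub>4\<^sub>4)(n)\<close>: these elements span
  the loop algebra, and the factor 2 makes the structure constants at level \<open>-5/2\<close> integers, so that
  the straightening below computes with integers only.\<close>

fun letter_op :: "letter \<Rightarrow> envelope" where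
  "letter_op (i, j, n) = scalar 2 * emb (mode (unit_vector (pos i) (pos j)) n)"

fun zero_letter :: "letter \<Rightarrow> bool" where
  "zero_letter (i, j, n) \<longleftrightarrow> i = I4 \<and> j = I4"

fun mode_number :: "letter \<Rightarrow> int" where "mode_number (i, j, n) = n"

fun letter_form :: "letter \<Rightarrow> letter \<Rightarrow> int" where
  "letter_form (i, j, m) (k, l, n) = kron j k * kron i l - kron i j * kron k I4 * kron l I4
     - kron k l * kron i I4 * kron j I4 + kron i j * kron k l"

text \<open>The factor 2 is what remains of \<open>[2 x, 2 y] = 2 (2 [x, y])\<close>. The last two
  entries come from the \<open>E_44\<close> corrections of diagonal letters.\<close>

fun letter_bracket :: "letter \<Rightarrow> letter \<Rightarrow> (int \<times> letter) list" where
  "letter_bracket (i, j, m) (k, l, n) =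
     [(2 * kron j k, (i, l, m + n)), (- 2 * kron i l, (k, j, m + n)),
      (2 * kron i j * (kron l I4 - kron k I4), (k, l, m + n)),
      (2 * kron k l * (kron i I4 - kron j I4), (i, j, m + n))]"

text \<open>The constant is \<open>2 * 2 * (-5/2) = -10\<close>: two letter factors times the
  level.\<close>

fun letter_central :: "letter \<Rightarrow> letter \<Rightarrow> int" where
  "letter_central (i, j, m) (k, l, n) =
     (if m + n = 0 then - 10 * m * letter_form (i, j, m) (k, l, n) else 0)"

lemma pos_inject [simp]: "pos i = pos j \<longleftrightarrow> i = j"
  by (cases i; cases j; simp)

lemma pos_eq_4 [simp]: "pos i = 4 \<longleftrightarrow> i = I4" "4 = pos i \<longleftrightarrow> i = I4"
  by (cases i; simp)+

lemma matrix_unit_mult: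
  "matrix_unit i j ** matrix_unit k l = (if j = k then matrix_unit i l else 0)"
proof -
  have "(\<Sum>r\<in>UNIV. (if a = i \<and> r = j then 1 else 0) * (if r = k \<and> b = l then 1 else 0))
      = (if j = k \<and> a = i \<and> b = l then 1 else (0::complex))" for a b
  proof -
    have "(\<lambda>r. (if a = i \<and> r = j then 1 else 0) * (if r = k \<and> b = l then 1 else (0::complex)))
       = (\<lambda>r. if r = j then if j = k \<and> a = i \<and> b = l then 1 else 0 else 0)"
      by auto
    then show ?thesis by (simp only:) (subst sum.delta; simp)
  qed
  then show ?thesis
    by (simp add: matrix_matrix_mult_def matrix_unit_def vec_eq_iff)
qed

lemma trace_matrix_unit: "trace (matrix_unit i j) = (if i = j then 1 else 0)"
  by (cases "i = j") (auto simp: trace_def matrix_unit_def intro!: sum.neutral)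

lemma matrix_diff_ldistrib: "A ** (B - C) = A ** B - A ** (C :: complex^4^4)"
  and matrix_diff_rdistrib: "(A - B) ** C = A ** C - B ** (C :: complex^4^4)"
  by (simp_all add: matrix_matrix_mult_def vec_eq_iff sum_subtractf algebra_simps)

lemma zero_matrix_mult [simp]: "0 ** (A :: complex^4^4) = 0"
  by (simp add: matrix_matrix_mult_def vec_eq_iff)

lemma trace_zero_mat [simp]: "trace (0 :: complex^4^4) = 0"
  by (simp add: trace_def)

lemma form_unit_vector:
  "form_sl4 (unit_vector (pos i) (pos j)) (unit_vector (pos k) (pos l)) = of_int (letter_form (i, j, m) (k, l, n))"
  by (cases "i = j"; cases "k = l")
     (auto simp: form_sl4_def unit_vector.rep_eq kron_def matrix_diff_ldistrib matrix_diff_rdistrib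
      matrix_unit_mult trace_sub trace_add trace_matrix_unit)

lemma scale_mat_simps:
  "scale_sl4 1 x = x" "scale_sl4 (- 1) x = - x" "scale_sl4 (c + d) x = scale_sl4 c x + scale_sl4 d x"
  by (auto simp: mat_eq_iff scale_sl4.rep_eq uminus_sl4.rep_eq plus_sl4.rep_eq algebra_simps)

lemma bracket_unit_vector:
  "bracket_sl4 (unit_vector (pos i) (pos j)) (unit_vector (pos k) (pos l)) =
     scale_sl4 (of_int (kron j k)) (unit_vector (pos i) (pos l))
     + scale_sl4 (of_int (- kron i l)) (unit_vector (pos k) (pos j))
     + scale_sl4 (of_int (kron i j * (kron l I4 - kron k I4))) (unit_vector (pos k) (pos l))
     + scale_sl4 (of_int (kron k l * (kron i I4 - kron j I4))) (unit_vector (pos i) (pos j))"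
  unfolding mat_of_sl4_inject[symmetric]
  by (cases "i = j"; cases "k = l"; cases "i = l"; cases "j = k")
     (auto simp: unit_vector.rep_eq bracket_sl4.rep_eq plus_sl4.rep_eq uminus_sl4.rep_eq zero_sl4.rep_eq
      minus_sl4.rep_eq kron_def matrix_diff_ldistrib matrix_diff_rdistrib scale_mat_simps
      matrix_unit_mult mult_2)

lemma letter_op_commute:
  "letter_op x * letter_op y = letter_op y * letter_op x
     + (\<Sum>(c, a)\<leftarrow>letter_bracket x y. of_int c * letter_op a)
     + scalar (if mode_number x + mode_number y = 0
         then 4 * of_int (mode_number x * letter_form x y) else 0) * emb central_K"
proof -
  obtain i j m k l n where xy: "x = (i, j, m)" "y = (k, l, n)"
    by (cases x, cases y) auto
  define X Y where "X = emb (mode (unit_vector (pos i) (pos j)) m)"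
    and "Y = emb (mode (unit_vector (pos k) (pos l)) n)"
  have swap: "(scalar 2 * u) * (scalar 2 * w) = scalar 4 * (u * w)" for u w
    by (metis (no_types) mult.assoc scalar_commute scalar_mult mult_2 numeral_Bit0 one_add_one)
  have "X * Y = Y * X + emb (mode (bracket_sl4 (unit_vector (pos i) (pos j)) (unit_vector (pos k) (pos l))) (m + n))
     + scalar (if m + n = 0 then of_int (m * letter_form x y) else 0) * emb central_K"
    unfolding X_def Y_def
    by (subst emb_mode_commute) (simp add: form_unit_vector[of i j k l m n] xy)
  then have "scalar 4 * (X * Y) = scalar 4 * (Y * X) + scalar 4 * emb (mode (bracket_sl4 (unit_vector (pos i) (pos j)) (unit_vector (pos k) (pos l))) (m + n))
     + scalar 4 * (scalar (if m + n = 0 then of_int (m * letter_form x y) else 0) * emb central_K)"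
    by (simp add: distrib_left)
  moreover have "scalar 4 * emb (mode (bracket_sl4 (unit_vector (pos i) (pos j)) (unit_vector (pos k) (pos l))) (m + n))
    = (\<Sum>(c, a)\<leftarrow>letter_bracket x y. of_int c * letter_op a)"
    by (simp add: bracket_unit_vector emb_mode_add emb_mode_scale xy distrib_left add.assoc
        mult.assoc[symmetric] flip: scalar_mult scalar_of_int)
  moreover have "scalar 4 * (scalar (if m + n = 0 then of_int (m * letter_form x y) else 0) * emb central_K)
     = scalar (if mode_number x + mode_number y = 0
         then 4 * of_int (mode_number x * letter_form x y) else 0) * emb central_K"
    by (simp add: xy mult.assoc[symmetric] flip: scalar_mult)
  ultimately show ?thesis
    by (simp add: xy swap X_def[symmetric] Y_def[symmetric])
qed

section \<open>Integer combinations of words\<close>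

type_synonym combination = "(letter list \<times> int) list"

definition word_vector :: "letter list \<Rightarrow> vacuum_module" where
  "word_vector w = foldr (\<lambda>x v. letter_op x \<bullet>\<^sub>U v) w vacuum"

definition combination_vector :: "combination \<Rightarrow> vacuum_module" where
  "combination_vector p = (\<Sum>(w, c)\<leftarrow>p. of_int c \<bullet>\<^sub>U word_vector w)"

text \<open>Cancelled terms are dropped, so that vanishing can be read off as the literal result
  \<open>[]\<close>.\<close>

fun insert_term :: "letter list \<times> int \<Rightarrow> combination \<Rightarrow> combination" where
  "insert_term (w, c) [] = (if c = 0 then [] else [(w, c)])"
| "insert_term (w, c) ((w', c') # p) =
     (if w = w' then (if c + c' = 0 then p else (w, c + c') # p) else (w', c') # insert_term (w, c) p)"

definition add_scaled :: "int \<Rightarrow> combination \<Rightarrow> combination \<Rightarrow> combination" where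
  "add_scaled a p q = fold (\<lambda>(w, c). insert_term (w, a * c)) p q"

definition extend_linearly :: "(letter list \<Rightarrow> combination) \<Rightarrow> combination \<Rightarrow> combination" where
  "extend_linearly f p = fold (\<lambda>(w, c). add_scaled c (f w)) p []"

text \<open>Larger modes go to the right, so that nonnegative ones travel towards the vacuum, which
  they annihilate.\<close>

fun letter_le :: "letter \<Rightarrow> letter \<Rightarrow> bool" where
  "letter_le (i, j, m) (k, l, n) \<longleftrightarrow>
     m < n \<or> m = n \<and> (rank i < rank k \<or> i = k \<and> rank j \<le> rank l)"

text \<open>The first argument bounds the recursion depth; when it is exhausted the word is left
  unsorted, so that correctness does not depend on termination.\<close>

primrec straighten :: "nat \<Rightarrow> letter \<Rightarrow> letter list \<Rightarrow> combination" where
  "straighten 0 = (\<lambda>x w. [(x # w, 1)])"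
| "straighten (Suc k) = (\<lambda>x w. case w of
     [] \<Rightarrow> if 0 \<le> mode_number x then [] else [([x], 1)]
   | y # w' \<Rightarrow>
       if letter_le x y then [(x # y # w', 1)]
       else fold (\<lambda>(c, a) q. if c = 0 \<or> zero_letter a then q else add_scaled c (straighten k a w') q)
         (letter_bracket x y)
         (insert_term (w', letter_central x y)
           (extend_linearly (straighten k y) (straighten k x w'))))"

datatype expr = Letter letter | Const int | Add expr expr | Mult expr expr

primrec denotation :: "expr \<Rightarrow> envelope" where
  "denotation (Letter x) = letter_op x"
| "denotation (Const c) = of_int c"
| "denotation (Add a b) = denotation a + denotation b"
| "denotation (Mult a b) = denotation a * denotation b"

text \<open>Factors are applied from the right to combinations that are already straightened, so
  straightening amounts to inserting one letter at a time. The result is correct for every recursion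
  bound; 12 is large enough for the checks below to succeed.\<close>

primrec apply_expr :: "expr \<Rightarrow> combination \<Rightarrow> combination" where
  "apply_expr (Letter x) = extend_linearly (straighten 12 x)"
| "apply_expr (Const c) = (\<lambda>p. add_scaled c p [])"
| "apply_expr (Add a b) = (\<lambda>p. add_scaled 1 (apply_expr a p) (apply_expr b p))"
| "apply_expr (Mult a b) = (\<lambda>p. apply_expr a (apply_expr b p))"

section \<open>Correctness of the straightening\<close>

lemma combination_vector_Nil [simp]: "combination_vector [] = 0"
  and combination_vector_Cons: "combination_vector ((w, c) # p) = of_int c \<bullet>\<^sub>U word_vector w + combination_vector p"
  by (simp_all add: combination_vector_def)

lemma combination_vector_insert_term:
  "combination_vector (insert_term (w, c) p) = of_int c \<bullet>\<^sub>U word_vector w + combination_vector p"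
proof (induction p)
  case Nil
  then show ?case by (auto simp: combination_vector_Cons)
next
  case (Cons t p)
  obtain w' c' where t: "t = (w', c')" by (cases t)
  have "of_int c \<bullet>\<^sub>U word_vector w + of_int c' \<bullet>\<^sub>U word_vector w = of_int (c + c') \<bullet>\<^sub>U word_vector w"
    by (simp add: act_add_left)
  then show ?case
    using Cons by (auto simp: t combination_vector_Cons add.assoc[symmetric] act_add_left[symmetric]
        simp flip: of_int_add)
qed

lemma combination_vector_add_scaled:
  "combination_vector (add_scaled a p q) = of_int a \<bullet>\<^sub>U combination_vector p + combination_vector q"
proof (induction p arbitrary: q)
  case (Cons t p)
  obtain w c where t: "t = (w, c)" by (cases t)
  have "of_int (a * c) \<bullet>\<^sub>U word_vector w = of_int a \<bullet>\<^sub>U of_int c \<bullet>\<^sub>U word_vector w"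
    by (simp add: act_mult)
  with Cons show ?case
    by (simp add: t add_scaled_def combination_vector_insert_term combination_vector_Cons
        act_add_right add_ac del: of_int_mult)
qed (simp add: add_scaled_def)

lemma combination_vector_extend_linearly:
  assumes "\<And>w. combination_vector (f w) = u \<bullet>\<^sub>U word_vector w"
  shows "combination_vector (extend_linearly f p) = u \<bullet>\<^sub>U combination_vector p"
proof -
  have int_commute: "of_int c \<bullet>\<^sub>U u \<bullet>\<^sub>U v = u \<bullet>\<^sub>U of_int c \<bullet>\<^sub>U v" for c v
    by (simp add: scalar_commute flip: act_mult scalar_of_int)
  have "combination_vector (fold (\<lambda>(w, c). add_scaled c (f w)) p q)
      = u \<bullet>\<^sub>U combination_vector p + combination_vector q" for q
  proof (induction p arbitrary: q)
    case (Cons t p)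
    then show ?case
      by (cases t) (simp add: combination_vector_add_scaled combination_vector_Cons assms
          act_add_right int_commute algebra_simps)
  qed simp
  then show ?thesis by (simp add: extend_linearly_def)
qed

lemma central_letter_commute: "emb central_K * letter_op x = letter_op x * emb central_K"
  by (cases x) (metis (no_types) emb_central_commute letter_op.simps mult.assoc scalar_commute)

lemma central_word_vector: "emb central_K \<bullet>\<^sub>U word_vector w = scalar level \<bullet>\<^sub>U word_vector w"
proof (induction w)
  case Nil
  then show ?case by (simp add: word_vector_def act_central_vacuum)
next
  case (Cons x w)
  have "emb central_K \<bullet>\<^sub>U letter_op x \<bullet>\<^sub>U word_vector w = letter_op x \<bullet>\<^sub>U emb central_K \<bullet>\<^sub>U word_vector w"
    by (simp add: central_letter_commute flip: act_mult)
  also have "\<dots> = scalar level \<bullet>\<^sub>U letter_op x \<bullet>\<^sub>U word_vector w"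
    by (simp add: Cons scalar_commute flip: act_mult)
  finally show ?case by (simp add: word_vector_def)
qed

lemma letter_op_word_commute:
  "letter_op x \<bullet>\<^sub>U letter_op y \<bullet>\<^sub>U word_vector w = letter_op y \<bullet>\<^sub>U letter_op x \<bullet>\<^sub>U word_vector w
     + (\<Sum>(c, a)\<leftarrow>letter_bracket x y. of_int c \<bullet>\<^sub>U letter_op a \<bullet>\<^sub>U word_vector w)
     + of_int (letter_central x y) \<bullet>\<^sub>U word_vector w"
proof -
  obtain i j m k l n where xy: "x = (i, j, m)" "y = (k, l, n)"
    by (cases x, cases y) auto
  define z where "z = (if mode_number x + mode_number y = 0
         then 4 * of_int (mode_number x * letter_form x y) else 0 :: complex)"
  have "z * level = of_int (letter_central x y)"
    by (simp add: z_def level_def xy)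
  then have central: "(scalar z * emb central_K) \<bullet>\<^sub>U word_vector w = of_int (letter_central x y) \<bullet>\<^sub>U word_vector w"
    by (metis act_mult central_word_vector scalar_mult scalar_of_int)
  have "(letter_op x * letter_op y) \<bullet>\<^sub>U word_vector w = (letter_op y * letter_op x) \<bullet>\<^sub>U word_vector w
     + (\<Sum>(c, a)\<leftarrow>letter_bracket x y. of_int c * letter_op a) \<bullet>\<^sub>U word_vector w
     + (scalar z * emb central_K) \<bullet>\<^sub>U word_vector w"
    by (subst letter_op_commute) (simp only: act_add_left z_def)
  moreover have "(\<Sum>(c, a)\<leftarrow>cs. of_int c * letter_op a) \<bullet>\<^sub>U v
      = (\<Sum>(c, a)\<leftarrow>cs. of_int c \<bullet>\<^sub>U letter_op a \<bullet>\<^sub>U v)" for cs v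
    by (induction cs) (auto simp: act_add_left act_mult simp del: letter_op.simps)
  ultimately show ?thesis
    unfolding central by (simp only: act_mult)
qed

lemma letter_op_zero_letter: "zero_letter x \<Longrightarrow> letter_op x = 0"
proof -
  have "unit_vector 4 4 = 0" by transfer simp
  then show "zero_letter x \<Longrightarrow> letter_op x = 0" by (cases x) simp
qed

lemma letter_op_vacuum: "0 \<le> mode_number x \<Longrightarrow> letter_op x \<bullet>\<^sub>U vacuum = 0"
  by (cases x) (simp add: act_mult act_mode_vacuum)

text \<open>Every branch is an identity in the module: a swap costs the bracket and a central
  scalar, a nonnegative mode kills the vacuum, and an exhausted bound changes nothing.\<close>

lemma combination_vector_straighten:
  "combination_vector (straighten k x w) = letter_op x \<bullet>\<^sub>U word_vector w"
proof (induction k arbitrary: x w)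
  case 0
  then show ?case by (simp add: combination_vector_Cons word_vector_def act_one)
next
  case (Suc k)
  show ?case
  proof (cases w)
    case Nil
    then show ?thesis
      by (simp add: combination_vector_Cons word_vector_def act_one letter_op_vacuum)
  next
    case (Cons y w')
    have brackets: "combination_vector (fold (\<lambda>(c, a) q. if c = 0 \<or> zero_letter a then q else add_scaled c (straighten k a w') q) cs q)
        = (\<Sum>(c, a)\<leftarrow>cs. of_int c \<bullet>\<^sub>U letter_op a \<bullet>\<^sub>U word_vector w') + combination_vector q" for cs q
      by (induction cs arbitrary: q)
         (auto simp: combination_vector_add_scaled Suc letter_op_zero_letter algebra_simps
          simp del: letter_op.simps zero_letter.simps)
    have "letter_op y \<bullet>\<^sub>U word_vector w' = word_vector w"
      by (simp add: word_vector_def Cons)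
    with letter_op_word_commute[of x y w'] show ?thesis
      by (simp add: Cons brackets combination_vector_insert_term combination_vector_Cons
          combination_vector_extend_linearly[OF Suc] Suc act_one algebra_simps)
         (simp add: word_vector_def)
  qed
qed

lemma combination_vector_apply_expr:
  "combination_vector (apply_expr e p) = denotation e \<bullet>\<^sub>U combination_vector p"
  by (induction e arbitrary: p)
     (simp_all add: combination_vector_extend_linearly[OF combination_vector_straighten]
       combination_vector_add_scaled act_add_left act_mult act_one del: letter_op.simps)

section \<open>Weights of words\<close>

lemma bracket_diagonal:
  assumes "\<And>a b. a \<noteq> b \<Longrightarrow> mat_of_sl4 D $ a $ b = 0"
  shows "bracket_sl4 D (unit_vector i j) = scale_sl4 (mat_of_sl4 D $ i $ i - mat_of_sl4 D $ j $ j) (unit_vector i j)"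
proof -
  have left: "(mat_of_sl4 D ** M) $ a $ b = mat_of_sl4 D $ a $ a * M $ a $ b" for M a b
  proof -
    have "(\<Sum>k\<in>UNIV. mat_of_sl4 D $ a $ k * M $ k $ b) = (\<Sum>k\<in>UNIV. if k = a then mat_of_sl4 D $ a $ a * M $ a $ b else 0)"
      using assms by (intro sum.cong) auto
    then show ?thesis by (simp add: matrix_matrix_mult_def)
  qed
  have right: "(M ** mat_of_sl4 D) $ a $ b = M $ a $ b * mat_of_sl4 D $ b $ b" for M a b
  proof -
    have "(\<Sum>k\<in>UNIV. M $ a $ k * mat_of_sl4 D $ k $ b) = (\<Sum>k\<in>UNIV. if k = b then M $ a $ b * mat_of_sl4 D $ b $ b else 0)"
      using assms by (intro sum.cong) auto
    then show ?thesis by (simp add: matrix_matrix_mult_def)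
  qed
  show ?thesis
    by (auto simp: mat_eq_iff bracket_sl4.rep_eq scale_sl4.rep_eq left right unit_vector.rep_eq
        matrix_unit_def)
qed

text \<open>The coefficient of \<open>eps_a\<close> in the weight of a word, a letter having weight
  \<open>eps_i - eps_j\<close>. Integers can be checked by evaluation;
  \<open>cartan_weight_eq\<close> turns them into a functional.\<close>

definition weight_count :: "idx \<Rightarrow> letter list \<Rightarrow> int" where
  "weight_count a w = (\<Sum>(i, j, n)\<leftarrow>w. kron a i - kron a j)"

definition total_mode :: "letter list \<Rightarrow> int" where
  "total_mode w = sum_list (map mode_number w)"

definition cartan_weight :: "sl4 \<Rightarrow> complex \<Rightarrow> letter list \<Rightarrow> complex" where
  "cartan_weight D b w = (\<Sum>(i, j, n)\<leftarrow>w. mat_of_sl4 D $ pos i $ pos i - mat_of_sl4 D $ pos j $ pos j + b * of_int n)"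

lemma cartan_letter_commute:
  assumes "\<And>a b. a \<noteq> b \<Longrightarrow> mat_of_sl4 D $ a $ b = 0"
  shows "emb (Poly_Mapping.single 0 D, a, b) * letter_op x =
    letter_op x * emb (Poly_Mapping.single 0 D, a, b) + scalar (cartan_weight D b [x]) * letter_op x"
proof -
  obtain i j n where x: "x = (i, j, n)" by (cases x)
  let ?u = "emb (mode (unit_vector (pos i) (pos j)) n)"
  have "emb (mode D 0) * ?u = ?u * emb (mode D 0)
      + scalar (mat_of_sl4 D $ pos i $ pos i - mat_of_sl4 D $ pos j $ pos j) * ?u"
    by (subst emb_mode_commute) (simp add: bracket_diagonal[OF assms] emb_mode_scale)
  moreover have "scalar a * emb central_K * ?u = ?u * (scalar a * emb central_K)"
    by (metis emb_central_commute mult.assoc scalar_commute)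
  moreover have "scalar b * emb derivation_d * ?u = ?u * (scalar b * emb derivation_d) + scalar (b * of_int n) * ?u"
  proof -
    have "scalar b * emb derivation_d * ?u = scalar b * (?u * emb derivation_d + scalar (of_int n) * ?u)"
      by (simp only: mult.assoc emb_derivation_commute)
    then show ?thesis
      by (simp add: distrib_left scalar_mult mult.assoc[symmetric] scalar_commute[of ?u])
  qed
  ultimately have "emb (Poly_Mapping.single 0 D, a, b) * ?u =
      ?u * emb (Poly_Mapping.single 0 D, a, b) + scalar (cartan_weight D b [x]) * ?u"
    by (simp add: emb_decompose x cartan_weight_def distrib_left distrib_right scalar_add add_ac)
  then have "scalar 2 * (emb (Poly_Mapping.single 0 D, a, b) * ?u) =
      scalar 2 * (?u * emb (Poly_Mapping.single 0 D, a, b)) + scalar 2 * (scalar (cartan_weight D b [x]) * ?u)"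
    by (simp only: distrib_left)
  then show ?thesis
    by (simp add: x mult.assoc[symmetric] scalar_commute[of "emb _"] scalar_commute[of "scalar 2"])
qed

lemma cartan_word_vector:
  assumes "\<And>a b. a \<noteq> b \<Longrightarrow> mat_of_sl4 D $ a $ b = 0"
  shows "emb (Poly_Mapping.single 0 D, a, b) \<bullet>\<^sub>U word_vector w =
    scalar (a * level + cartan_weight D b w) \<bullet>\<^sub>U word_vector w"
proof (induction w)
  case Nil
  then show ?case
    by (simp add: word_vector_def emb_decompose act_add_left act_mult act_mode_vacuum
        act_central_vacuum act_derivation_vacuum cartan_weight_def scalar_mult)
next
  case (Cons x w)
  have "emb (Poly_Mapping.single 0 D, a, b) \<bullet>\<^sub>U letter_op x \<bullet>\<^sub>U word_vector w =
    letter_op x \<bullet>\<^sub>U emb (Poly_Mapping.single 0 D, a, b) \<bullet>\<^sub>U word_vector w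
     + scalar (cartan_weight D b [x]) \<bullet>\<^sub>U letter_op x \<bullet>\<^sub>U word_vector w"
    by (simp add: cartan_letter_commute[OF assms] act_add_left flip: act_mult)
  also have "\<dots> = (scalar (a * level + cartan_weight D b w) + scalar (cartan_weight D b [x])) \<bullet>\<^sub>U letter_op x \<bullet>\<^sub>U word_vector w"
    by (simp add: Cons act_add_left distrib_right act_mult[symmetric] scalar_commute[of "letter_op x"] del: letter_op.simps)
  finally show ?case
    by (simp add: word_vector_def cartan_weight_def add_ac flip: scalar_add)
qed

lemma cartan_weight_eq:
  "cartan_weight D b w = (\<Sum>a\<in>{I1, I2, I3, I4}. of_int (weight_count a w) * mat_of_sl4 D $ pos a $ pos a)
     + b * of_int (total_mode w)"
proof (induction w)
  case (Cons x w)
  obtain i j n where x: "x = (i, j, n)" by (cases x)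
  then show ?case
    using Cons by (cases i; cases j)
      (simp_all add: cartan_weight_def weight_count_def total_mode_def kron_def algebra_simps)
qed (simp add: cartan_weight_def weight_count_def total_mode_def)

section \<open>The vector as a symbolic expression\<close>

definition simple_root_letter :: "letter \<Rightarrow> int" where
  "simple_root_letter x = (case x of (I1, I2, n) \<Rightarrow> 2 | (I2, I3, n) \<Rightarrow> 2 | (I3, I4, n) \<Rightarrow> 2 | _ \<Rightarrow> 0)"

text \<open>The pairing of a word with the \<open>k\<close>-th power of
  \<open>superdiagonal_coordinate\<close> at 0: each letter differentiates once, so only words of
  length exactly \<open>k\<close> contribute.\<close>

fun eval_word :: "nat \<Rightarrow> letter list \<Rightarrow> int" where
  "eval_word k [] = (if k = 0 then 1 else 0)"
| "eval_word k (x # w) = (if mode_number x = - 1 \<and> k \<noteq> 0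
     then int k * simple_root_letter x * eval_word (k - 1) w else 0)"

definition root_expr :: "idx \<Rightarrow> idx \<Rightarrow> int \<Rightarrow> expr" where "root_expr i j n = Letter (i, j, n)"

definition Minus :: "expr \<Rightarrow> expr \<Rightarrow> expr" where "Minus a b = Add a (Mult (Const (- 1)) b)"

fun coroot_expr :: "idx \<Rightarrow> int \<Rightarrow> expr" where
  "coroot_expr I1 n = Minus (Letter (I1, I1, n)) (Letter (I2, I2, n))"
| "coroot_expr I2 n = Minus (Letter (I2, I2, n)) (Letter (I3, I3, n))"
| "coroot_expr I3 n = Letter (I3, I3, n)"
| "coroot_expr I4 n = Const 0"

bundle expr_syntax
begin
notation Add (infixl \<open>+\<^sub>e\<close> 65)
notation Minus (infixl \<open>-\<^sub>e\<close> 65)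
notation Mult (infixl \<open>*\<^sub>e\<close> 70)
end

context includes expr_syntax begin

text \<open>This is 96 times the vector of the theorem: a product of \<open>r\<close> letters
  carries the factor \<open>2\<^sup>r\<close>, and \<open>96 = 6 \<cdot> 2\<^sup>4\<close> clears the denominators.\<close>

definition singular_expr :: expr where
  "singular_expr = Const 12 *\<^sub>e (Const 2 *\<^sub>e (root_expr I1 I3 (-1) *\<^sub>e root_expr I2 I4 (-3)) +\<^sub>e Const 2 *\<^sub>e (root_expr I1 I3 (-3) *\<^sub>e root_expr I2 I4 (-1)) +\<^sub>e root_expr I1 I3 (-2) *\<^sub>e root_expr I2 I4 (-2)
      -\<^sub>e Const 2 *\<^sub>e (root_expr I1 I4 (-1) *\<^sub>e root_expr I2 I3 (-3)) -\<^sub>e Const 2 *\<^sub>e (root_expr I1 I4 (-3) *\<^sub>e root_expr I2 I3 (-1)) -\<^sub>e root_expr I1 I4 (-2) *\<^sub>e root_expr I2 I3 (-2)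
      +\<^sub>e root_expr I2 I4 (-1) *\<^sub>e root_expr I2 I3 (-2) *\<^sub>e root_expr I1 I2 (-1) -\<^sub>e root_expr I2 I4 (-2) *\<^sub>e root_expr I2 I3 (-1) *\<^sub>e root_expr I1 I2 (-1)
      -\<^sub>e root_expr I1 I3 (-1) *\<^sub>e root_expr I2 I3 (-2) *\<^sub>e root_expr I3 I4 (-1) -\<^sub>e Const 3 *\<^sub>e root_expr I1 I3 (-2) *\<^sub>e root_expr I2 I3 (-1) *\<^sub>e root_expr I3 I4 (-1)
      +\<^sub>e root_expr I1 I2 (-1) *\<^sub>e root_expr I2 I3 (-1) *\<^sub>e root_expr I2 I3 (-1) *\<^sub>e root_expr I3 I4 (-1)
      -\<^sub>e root_expr I1 I3 (-1) *\<^sub>e root_expr I2 I4 (-2) *\<^sub>e (coroot_expr I1 (-1) +\<^sub>e coroot_expr I2 (-1))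
      -\<^sub>e root_expr I1 I3 (-2) *\<^sub>e root_expr I2 I4 (-1) *\<^sub>e (coroot_expr I2 (-1) +\<^sub>e coroot_expr I3 (-1))
      +\<^sub>e root_expr I1 I4 (-1) *\<^sub>e root_expr I2 I3 (-2) *\<^sub>e (coroot_expr I1 (-1) +\<^sub>e coroot_expr I2 (-1) +\<^sub>e coroot_expr I3 (-1))
      +\<^sub>e root_expr I1 I4 (-2) *\<^sub>e root_expr I2 I3 (-1) *\<^sub>e coroot_expr I2 (-1)
      -\<^sub>e root_expr I2 I4 (-1) *\<^sub>e root_expr I2 I3 (-1) *\<^sub>e root_expr I1 I2 (-1) *\<^sub>e coroot_expr I3 (-1)
      +\<^sub>e root_expr I1 I3 (-1) *\<^sub>e root_expr I2 I3 (-1) *\<^sub>e root_expr I3 I4 (-1) *\<^sub>e coroot_expr I1 (-1)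
      +\<^sub>e root_expr I1 I3 (-1) *\<^sub>e root_expr I1 I4 (-1) *\<^sub>e root_expr I2 I1 (-1) *\<^sub>e coroot_expr I3 (-1)
      +\<^sub>e root_expr I1 I3 (-1) *\<^sub>e root_expr I1 I4 (-2) *\<^sub>e root_expr I2 I1 (-1) -\<^sub>e root_expr I1 I3 (-2) *\<^sub>e root_expr I1 I4 (-1) *\<^sub>e root_expr I2 I1 (-1)
      -\<^sub>e root_expr I1 I3 (-1) *\<^sub>e root_expr I1 I3 (-1) *\<^sub>e root_expr I3 I4 (-1) *\<^sub>e root_expr I2 I1 (-1)
      -\<^sub>e root_expr I1 I4 (-1) *\<^sub>e root_expr I2 I4 (-1) *\<^sub>e root_expr I4 I3 (-1) *\<^sub>e coroot_expr I1 (-1)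
      +\<^sub>e root_expr I1 I4 (-1) *\<^sub>e root_expr I2 I4 (-2) *\<^sub>e root_expr I4 I3 (-1) -\<^sub>e root_expr I1 I4 (-2) *\<^sub>e root_expr I2 I4 (-1) *\<^sub>e root_expr I4 I3 (-1)
      -\<^sub>e root_expr I2 I4 (-1) *\<^sub>e root_expr I2 I4 (-1) *\<^sub>e root_expr I1 I2 (-1) *\<^sub>e root_expr I4 I3 (-1)
      +\<^sub>e root_expr I1 I4 (-1) *\<^sub>e root_expr I1 I4 (-1) *\<^sub>e root_expr I2 I1 (-1) *\<^sub>e root_expr I4 I3 (-1))
   +\<^sub>e Const 4 *\<^sub>e (root_expr I1 I3 (-1) *\<^sub>e root_expr I2 I4 (-1) *\<^sub>e (Const (-2) *\<^sub>e coroot_expr I2 (-2) +\<^sub>e coroot_expr I1 (-1) *\<^sub>e coroot_expr I2 (-1)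
          -\<^sub>e coroot_expr I1 (-1) *\<^sub>e coroot_expr I3 (-1) +\<^sub>e coroot_expr I2 (-1) *\<^sub>e coroot_expr I2 (-1) +\<^sub>e coroot_expr I2 (-1) *\<^sub>e coroot_expr I3 (-1)
          -\<^sub>e root_expr I1 I2 (-1) *\<^sub>e root_expr I2 I1 (-1) +\<^sub>e Const 2 *\<^sub>e root_expr I1 I3 (-1) *\<^sub>e root_expr I3 I1 (-1) +\<^sub>e Const 2 *\<^sub>e root_expr I1 I4 (-1) *\<^sub>e root_expr I4 I1 (-1)
          +\<^sub>e Const 2 *\<^sub>e root_expr I2 I3 (-1) *\<^sub>e root_expr I3 I2 (-1) +\<^sub>e Const 2 *\<^sub>e root_expr I2 I4 (-1) *\<^sub>e root_expr I4 I2 (-1) -\<^sub>e root_expr I3 I4 (-1) *\<^sub>e root_expr I4 I3 (-1)))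
   +\<^sub>e Const 4 *\<^sub>e (root_expr I1 I4 (-1) *\<^sub>e root_expr I2 I3 (-1) *\<^sub>e (Const 2 *\<^sub>e coroot_expr I2 (-2) -\<^sub>e coroot_expr I1 (-1) *\<^sub>e coroot_expr I2 (-1)
          -\<^sub>e Const 2 *\<^sub>e coroot_expr I1 (-1) *\<^sub>e coroot_expr I3 (-1) -\<^sub>e coroot_expr I2 (-1) *\<^sub>e coroot_expr I2 (-1) -\<^sub>e coroot_expr I2 (-1) *\<^sub>e coroot_expr I3 (-1)
          +\<^sub>e root_expr I1 I2 (-1) *\<^sub>e root_expr I2 I1 (-1) -\<^sub>e Const 2 *\<^sub>e root_expr I1 I3 (-1) *\<^sub>e root_expr I3 I1 (-1) -\<^sub>e Const 2 *\<^sub>e root_expr I1 I4 (-1) *\<^sub>e root_expr I4 I1 (-1)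
          -\<^sub>e Const 2 *\<^sub>e root_expr I2 I3 (-1) *\<^sub>e root_expr I3 I2 (-1) -\<^sub>e Const 2 *\<^sub>e root_expr I2 I4 (-1) *\<^sub>e root_expr I4 I2 (-1) +\<^sub>e root_expr I3 I4 (-1) *\<^sub>e root_expr I4 I3 (-1)))"

end

lemma root_letters:
  "ee 1 2 n = scalar (1/2) * letter_op (I1, I2, n)" "ee 1 3 n = scalar (1/2) * letter_op (I1, I3, n)"
  "ee 1 4 n = scalar (1/2) * letter_op (I1, I4, n)" "ee 2 3 n = scalar (1/2) * letter_op (I2, I3, n)"
  "ee 2 4 n = scalar (1/2) * letter_op (I2, I4, n)" "ee 3 4 n = scalar (1/2) * letter_op (I3, I4, n)"
  "ff 1 2 n = scalar (1/2) * letter_op (I2, I1, n)" "ff 1 3 n = scalar (1/2) * letter_op (I3, I1, n)"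
  "ff 1 4 n = scalar (1/2) * letter_op (I4, I1, n)" "ff 2 3 n = scalar (1/2) * letter_op (I3, I2, n)"
  "ff 2 4 n = scalar (1/2) * letter_op (I4, I2, n)" "ff 3 4 n = scalar (1/2) * letter_op (I4, I3, n)"
proof -
  have root: "root_vector i j = unit_vector i j" if "i \<noteq> j" for i j
    using that by transfer simp
  have half: "emb x = scalar (1/2) * (scalar 2 * emb x)" for x
    by (simp flip: mult.assoc scalar_mult)
  show "ee 1 2 n = scalar (1/2) * letter_op (I1, I2, n)" "ee 1 3 n = scalar (1/2) * letter_op (I1, I3, n)"
    "ee 1 4 n = scalar (1/2) * letter_op (I1, I4, n)" "ee 2 3 n = scalar (1/2) * letter_op (I2, I3, n)"
    "ee 2 4 n = scalar (1/2) * letter_op (I2, I4, n)" "ee 3 4 n = scalar (1/2) * letter_op (I3, I4, n)"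
    "ff 1 2 n = scalar (1/2) * letter_op (I2, I1, n)" "ff 1 3 n = scalar (1/2) * letter_op (I3, I1, n)"
    "ff 1 4 n = scalar (1/2) * letter_op (I4, I1, n)" "ff 2 3 n = scalar (1/2) * letter_op (I3, I2, n)"
    "ff 2 4 n = scalar (1/2) * letter_op (I4, I2, n)" "ff 3 4 n = scalar (1/2) * letter_op (I4, I3, n)"
    by (simp_all add: ee_def ff_def root half[symmetric])
qed

lemma coroot_letters:
  "hh 1 n = scalar (1/2) * denotation (coroot_expr I1 n)"
  "hh 2 n = scalar (1/2) * denotation (coroot_expr I2 n)"
  "hh 3 n = scalar (1/2) * denotation (coroot_expr I3 n)"
proof -
  have half: "emb x = scalar (1/2) * (scalar 2 * emb x)" for x
    by (simp flip: mult.assoc scalar_mult)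
  have "coroot 1 = unit_vector 1 1 + scale_sl4 (- 1) (unit_vector 2 2)"
    "coroot 2 = unit_vector 2 2 + scale_sl4 (- 1) (unit_vector 3 3)"
    "coroot 3 = unit_vector 3 3"
    unfolding scale_mat_simps by (transfer, simp)+
  then show "hh 1 n = scalar (1/2) * denotation (coroot_expr I1 n)"
    "hh 2 n = scalar (1/2) * denotation (coroot_expr I2 n)" "hh 3 n = scalar (1/2) * denotation (coroot_expr I3 n)"
    by (simp_all add: hh_def Minus_def emb_mode_add emb_mode_scale scalar_minus right_diff_distrib
        half[symmetric])
qed

lemma scalar_mult_left: "scalar a * (scalar b * u) = scalar (a * b) * u"
  by (simp add: scalar_mult mult.assoc)

lemma scalar_pull_out: "u * (scalar a * w) = scalar a * (u * w)"
  by (metis mult.assoc scalar_commute)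

lemma diff_scalar: "u - w = u + scalar (- 1) * (w :: envelope)" "- w = scalar (- 1) * w"
  by (simp_all add: scalar_minus)

lemma numeral_scalar: "(numeral k :: envelope) = scalar (numeral k)"
  by (simp add: scalar_numeral)

lemma denotation_simps:
  "denotation (root_expr i j n) = letter_op (i, j, n)"
  "denotation (Const c) = scalar (of_int c)"
  "denotation (Minus a b) = denotation a + scalar (- 1) * denotation b"
  by (simp_all add: root_expr_def Minus_def scalar_of_int scalar_minus)

text \<open>A coefficient \<open>c\<close> of a product of \<open>r\<close> factors becomes
  \<open>96 c / 2^r\<close>. Hence length 4 with coefficient 2 and length 3 with coefficient 1 both
  give 12, and length 2 gives 24. The factor \<open>2/3\<close> gives 4 at length 4 and 8 at length
  3, whence the extra 2 at \<open>coroot_expr I2 (-2)\<close>.\<close>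

lemma denotation_singular_expr:
  "denotation singular_expr = scalar 96 *
    (ee 1 3 (-1) * ee 2 4 (-3) + ee 1 3 (-3) * ee 2 4 (-1) + scalar (1/2) * (ee 1 3 (-2) * ee 2 4 (-2))
      - ee 1 4 (-1) * ee 2 3 (-3) - ee 1 4 (-3) * ee 2 3 (-1) - scalar (1/2) * (ee 1 4 (-2) * ee 2 3 (-2))
      + ee 2 4 (-1) * ee 2 3 (-2) * ee 1 2 (-1) - ee 2 4 (-2) * ee 2 3 (-1) * ee 1 2 (-1)
      - ee 1 3 (-1) * ee 2 3 (-2) * ee 3 4 (-1) - 3 * ee 1 3 (-2) * ee 2 3 (-1) * ee 3 4 (-1)
      + 2 * ee 1 2 (-1) * (ee 2 3 (-1))^2 * ee 3 4 (-1)
      - ee 1 3 (-1) * ee 2 4 (-2) * (hh 1 (-1) + hh 2 (-1))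
      - ee 1 3 (-2) * ee 2 4 (-1) * (hh 2 (-1) + hh 3 (-1))
      + ee 1 4 (-1) * ee 2 3 (-2) * (hh 1 (-1) + hh 2 (-1) + hh 3 (-1))
      + ee 1 4 (-2) * ee 2 3 (-1) * hh 2 (-1)
      + scalar (2/3) * (ee 1 3 (-1) * ee 2 4 (-1) * (- hh 2 (-2) + hh 1 (-1) * hh 2 (-1) - hh 1 (-1) * hh 3 (-1) + (hh 2 (-1))^2 + hh 2 (-1) * hh 3 (-1)
          - ee 1 2 (-1) * ff 1 2 (-1) + 2 * ee 1 3 (-1) * ff 1 3 (-1) + 2 * ee 1 4 (-1) * ff 1 4 (-1)
          + 2 * ee 2 3 (-1) * ff 2 3 (-1) + 2 * ee 2 4 (-1) * ff 2 4 (-1) - ee 3 4 (-1) * ff 3 4 (-1)))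
      + scalar (2/3) * (ee 1 4 (-1) * ee 2 3 (-1) * (hh 2 (-2) - hh 1 (-1) * hh 2 (-1) - 2 * hh 1 (-1) * hh 3 (-1) - (hh 2 (-1))^2 - hh 2 (-1) * hh 3 (-1)
          + ee 1 2 (-1) * ff 1 2 (-1) - 2 * ee 1 3 (-1) * ff 1 3 (-1) - 2 * ee 1 4 (-1) * ff 1 4 (-1)
          - 2 * ee 2 3 (-1) * ff 2 3 (-1) - 2 * ee 2 4 (-1) * ff 2 4 (-1) + ee 3 4 (-1) * ff 3 4 (-1)))
      - 2 * ee 2 4 (-1) * ee 2 3 (-1) * ee 1 2 (-1) * hh 3 (-1)
      + 2 * ee 1 3 (-1) * ee 2 3 (-1) * ee 3 4 (-1) * hh 1 (-1)
      + 2 * ee 1 3 (-1) * ee 1 4 (-1) * ff 1 2 (-1) * hh 3 (-1)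
      + ee 1 3 (-1) * ee 1 4 (-2) * ff 1 2 (-1) - ee 1 3 (-2) * ee 1 4 (-1) * ff 1 2 (-1)
      - 2 * (ee 1 3 (-1))^2 * ee 3 4 (-1) * ff 1 2 (-1)
      - 2 * ee 1 4 (-1) * ee 2 4 (-1) * ff 3 4 (-1) * hh 1 (-1)
      + ee 1 4 (-1) * ee 2 4 (-2) * ff 3 4 (-1) - ee 1 4 (-2) * ee 2 4 (-1) * ff 3 4 (-1)
      - 2 * (ee 2 4 (-1))^2 * ee 1 2 (-1) * ff 3 4 (-1)
      + 2 * (ee 1 4 (-1))^2 * ff 1 2 (-1) * ff 3 4 (-1))"
proof -
  \<comment> \<open>All scalars move to the front of right-associated products, with coroots kept
    opaque, so that both sides become the same sum.\<close>
  note pull = scalar_pull_out[of "letter_op x" for x] scalar_pull_out[of "denotation (coroot_expr i n)" for i n]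
  show ?thesis
    unfolding singular_expr_def root_letters coroot_letters diff_scalar numeral_scalar power2_eq_square
    by (simp del: coroot_expr.simps letter_op.simps denotation.simps(1,2) add: denotation_simps scalar_mult_left scalar_mult[symmetric] pull
      distrib_left distrib_right mult.assoc)
qed

text \<open>The counts 1, 1, -1, -1 encode \<open>2 omega_2\<close>, which is
  \<open>eps_1 + eps_2 - eps_3 - eps_4\<close> on traceless matrices. The final sum is
  \<open>96 * 2 * 4!\<close>, coming from the term \<open>2 e_12 e_23^2 e_34\<close>.\<close>

lemma singular_expr_computation:
  "let p = apply_expr singular_expr [([], 1)] in
     apply_expr (root_expr I1 I2 0) p = [] \<and> apply_expr (root_expr I2 I3 0) p = [] \<and> apply_expr (root_expr I3 I4 0) p = [] \<and>
     apply_expr (root_expr I4 I1 1) p = [] \<and>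
     list_all (\<lambda>(w, c). weight_count I1 w = 1 \<and> weight_count I2 w = 1 \<and> weight_count I3 w = - 1 \<and>
       weight_count I4 w = - 1 \<and> total_mode w = - 4 \<and> list_all (\<lambda>x. mode_number x < 0) w) p \<and>
     (\<Sum>(w, c)\<leftarrow>p. c * eval_word 4 w) \<noteq> 0"
  by code_simp

section \<open>Singularity\<close>

text \<open>A lift of \<open>word_vector\<close> to the enveloping algebra, where
  \<open>pairing\<close> is defined.\<close>

definition word_element :: "letter list \<Rightarrow> envelope" where
  "word_element w = foldr (\<lambda>x u. letter_op x * u) w 1"

lemma word_element_act_vacuum: "word_element w \<bullet>\<^sub>U vacuum = word_vector w"
  by (induction w) (simp_all add: word_element_def word_vector_def act_one act_mult del: letter_op.simps)

lemma superdiagonal_letter: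
  "2 * superdiagonal (mat_of_sl4 (unit_vector (pos i) (pos j))) = of_int (simple_root_letter (i, j, n))"
  by (cases i; cases j) (simp_all add: superdiagonal_def unit_vector.rep_eq matrix_unit_def simple_root_letter_def)

lemma pairing_letter_superdiagonal_power:
  assumes "mode_number x < 0" "Z \<in> chart"
  shows "pairing k (letter_op x) (\<lambda>Z. superdiagonal_coordinate Z ^ r) Z =
    (if mode_number x = - 1 then of_nat r * of_int (simple_root_letter x) else 0) * superdiagonal_coordinate Z ^ (r - 1)"
proof -
  let ?f = "\<lambda>Z. superdiagonal_coordinate Z ^ r"
  obtain i j n where x: "x = (i, j, n)" by (cases x)
  let ?u = "emb (mode (unit_vector (pos i) (pos j)) n)"
  have f: "?f \<in> polynomials"
    by (intro polynomials_power polynomials_superdiagonal_coordinate)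
  have "pairing k (letter_op x) ?f Z = pairing k ?u (pairing k (scalar 2) ?f) Z"
    using assms f by (simp add: x pairing_mult)
  also have "\<dots> = pairing k ?u (\<lambda>Z. 2 * ?f Z) Z"
    by (intro pairing_cong pairing_scalar f assms)
  also have "\<dots> = 2 * affine_operator k (mode (unit_vector (pos i) (pos j)) n) ?f Z"
    using assms f by (simp add: pairing_scale_right pairing_emb)
  finally show ?thesis
    using assms by (simp add: x affine_operator_superdiagonal_power flip: superdiagonal_letter[of i j "- 1"])
qed

lemma pairing_word_superdiagonal_power:
  assumes "list_all (\<lambda>x. mode_number x < 0) w"
  shows "pairing k (word_element w) (\<lambda>Z. superdiagonal_coordinate Z ^ r) 0 = of_int (eval_word r w)"
  using assms
proof (induction w arbitrary: r)
  case Nil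
  have "pairing k (scalar 1) (\<lambda>Z. superdiagonal_coordinate Z ^ r) 0 = superdiagonal_coordinate 0 ^ r"
    by (simp add: pairing_scalar polynomials_power polynomials_superdiagonal_coordinate del: scalar_1)
  then show ?case
    by (simp add: word_element_def superdiagonal_coordinate_def entry_simps power_0_left)
next
  case (Cons x w)
  let ?c = "if mode_number x = - 1 then of_nat r * of_int (simple_root_letter x) else 0"
  have f: "(\<lambda>Z. superdiagonal_coordinate Z ^ r) \<in> polynomials" for r
    by (intro polynomials_power polynomials_superdiagonal_coordinate)
  have "pairing k (word_element (x # w)) (\<lambda>Z. superdiagonal_coordinate Z ^ r) 0
      = pairing k (word_element w) (pairing k (letter_op x) (\<lambda>Z. superdiagonal_coordinate Z ^ r)) 0"
    by (simp add: word_element_def pairing_mult f del: letter_op.simps)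
  also have "\<dots> = pairing k (word_element w) (\<lambda>Z. ?c * superdiagonal_coordinate Z ^ (r - 1)) 0"
    using Cons.prems by (intro pairing_cong pairing_letter_superdiagonal_power) auto
  also have "\<dots> = ?c * of_int (eval_word (r - 1) w)"
    using Cons by (simp add: pairing_scale_right f)
  finally show ?case by simp
qed

lemma act_vacuum_eq_zero: "u \<bullet>\<^sub>U vacuum = 0 \<Longrightarrow> u \<in> left_ideal (vacuum_relations level)"
  by transfer simp

text \<open>If the vector were 0, its lift \<open>u\<close> would lie in the left ideal and pair to
  0 with the \<open>r\<close>-th power; this one functional replaces linear independence of
  words.\<close>

lemma combination_vector_nonzero:
  assumes "list_all (\<lambda>(w, c). list_all (\<lambda>x. mode_number x < 0) w) p"
    and "(\<Sum>(w, c)\<leftarrow>p. c * eval_word r w) \<noteq> 0"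
  shows "combination_vector p \<noteq> 0"
proof
  define u where "u = (\<Sum>(w, c)\<leftarrow>p. scalar (of_int c) * word_element w)"
  let ?f = "\<lambda>Z. superdiagonal_coordinate Z ^ r"
  have f: "?f \<in> polynomials"
    by (intro polynomials_power polynomials_superdiagonal_coordinate)
  assume "combination_vector p = 0"
  moreover have "u \<bullet>\<^sub>U vacuum = combination_vector p"
    unfolding u_def by (induction p)
      (auto simp: combination_vector_Cons act_add_left act_mult word_element_act_vacuum scalar_of_int)
  ultimately have "pairing level u ?f 0 = 0"
    by (intro pairing_left_ideal act_vacuum_eq_zero f) simp
  moreover have "pairing level u ?f 0 = of_int (\<Sum>(w, c)\<leftarrow>p. c * eval_word r w)"
    using assms(1) unfolding u_def
  proof (induction p)
    case Nil
    have "pairing level (scalar 0) ?f 0 = 0" by (simp add: pairing_scalar f del: scalar_0)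
    then show ?case by simp
  next
    case (Cons t p)
    obtain w c where t: "t = (w, c)" by (cases t)
    have "pairing level (scalar (of_int c) * word_element w) ?f 0
        = pairing level (word_element w) (pairing level (scalar (of_int c)) ?f) 0"
      by (simp add: pairing_mult f)
    also have "\<dots> = pairing level (word_element w) (\<lambda>Z. of_int c * ?f Z) 0"
      by (intro pairing_cong pairing_scalar f chart_zero)
    also have "\<dots> = of_int (c * eval_word r w)"
      using Cons.prems by (simp add: t pairing_scale_right f pairing_word_superdiagonal_power)
    finally show ?case
      using Cons by (simp add: t pairing_add f)
  qed
  ultimately show False using assms(2) by simp
qed

lemma combination_vector_weight:
  assumes "list_all (\<lambda>(w, c). weight_count I1 w = 1 \<and> weight_count I2 w = 1 \<and> weight_count I3 w = - 1 \<and>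
       weight_count I4 w = - 1 \<and> total_mode w = - 4) p"
  shows "combination_vector p \<in> weight_space (\<lambda>x. - (5/2) * \<Lambda>\<^sub>0 x - 4 * \<delta> x + 2 * \<omega>\<^sub>2 x)"
  unfolding weight_space_def
proof (intro CollectI ballI)
  fix X assume "X \<in> cartan"
  then obtain D a b where X: "X = (Poly_Mapping.single 0 D, a, b)"
    and D: "\<And>i j. i \<noteq> j \<Longrightarrow> mat_of_sl4 D $ i $ j = 0"
    unfolding cartan_def by blast
  let ?c = "- (5/2) * \<Lambda>\<^sub>0 X - 4 * \<delta> X + 2 * \<omega>\<^sub>2 X"
  \<comment> \<open>Eliminating the fourth diagonal entry turns
    \<open>eps_1 + eps_2 - eps_3 - eps_4\<close> into \<open>2 (eps_1 + eps_2)\<close>.\<close>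
  have "trace (mat_of_sl4 D) = 0" using mat_of_sl4[of D] by simp
  then have "mat_of_sl4 D $ 1 $ 1 + mat_of_sl4 D $ 2 $ 2 + mat_of_sl4 D $ 3 $ 3 + mat_of_sl4 D $ 4 $ 4 = 0"
    by (simp only: trace_def sum_4)
  then have D4: "mat_of_sl4 D $ 4 $ 4 = - (mat_of_sl4 D $ 1 $ 1 + mat_of_sl4 D $ 2 $ 2 + mat_of_sl4 D $ 3 $ 3)"
    by (simp only: add_eq_0_iff)
  have word: "emb X \<bullet>\<^sub>U word_vector w = scalar ?c \<bullet>\<^sub>U word_vector w"
    if w: "weight_count I1 w = 1" "weight_count I2 w = 1" "weight_count I3 w = - 1"
      "weight_count I4 w = - 1" "total_mode w = - 4" for w
  proof -
    have "cartan_weight D b w = 2 * (mat_of_sl4 D $ 1 $ 1 + mat_of_sl4 D $ 2 $ 2) - 4 * b"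
      unfolding cartan_weight_eq w by (simp add: w D4)
    then have "a * level + cartan_weight D b w = ?c"
      by (simp add: X level_def)
    moreover have "emb X \<bullet>\<^sub>U word_vector w = scalar (a * level + cartan_weight D b w) \<bullet>\<^sub>U word_vector w"
      unfolding X by (rule cartan_word_vector[OF D])
    ultimately show ?thesis by (simp only:)
  qed
  have int_commute: "u \<bullet>\<^sub>U of_int c \<bullet>\<^sub>U v = of_int c \<bullet>\<^sub>U u \<bullet>\<^sub>U v" for u c v
    unfolding act_mult[symmetric] scalar_of_int[symmetric] by (subst scalar_commute) (rule refl)
  show "emb X \<bullet>\<^sub>U combination_vector p = scalar ?c \<bullet>\<^sub>U combination_vector p"
    using assms
  proof (induction p)
    case (Cons t p)
    obtain w c where t: "t = (w, c)" by (cases t)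
    have "emb X \<bullet>\<^sub>U word_vector w = scalar ?c \<bullet>\<^sub>U word_vector w"
      by (rule word) (use Cons.prems in \<open>auto simp: t\<close>)
    moreover have "emb X \<bullet>\<^sub>U combination_vector p = scalar ?c \<bullet>\<^sub>U combination_vector p"
      by (rule Cons.IH) (use Cons.prems in \<open>auto simp: t\<close>)
    ultimately show ?case
      unfolding t combination_vector_Cons act_add_right int_commute[of "emb X"] int_commute[of "scalar ?c"]
      by (simp only:)
  qed simp
qed

theorem theorem3p1:
  shows "singular_vector_of_weight
    (\<lambda>x. - (5/2) * \<Lambda>\<^sub>0 x - 4 * \<delta> x + 2 * \<omega>\<^sub>2 x)
    ((ee 1 3 (-1) * ee 2 4 (-3) + ee 1 3 (-3) * ee 2 4 (-1) + scalar (1/2) * (ee 1 3 (-2) * ee 2 4 (-2))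
      - ee 1 4 (-1) * ee 2 3 (-3) - ee 1 4 (-3) * ee 2 3 (-1) - scalar (1/2) * (ee 1 4 (-2) * ee 2 3 (-2))
      + ee 2 4 (-1) * ee 2 3 (-2) * ee 1 2 (-1) - ee 2 4 (-2) * ee 2 3 (-1) * ee 1 2 (-1)
      - ee 1 3 (-1) * ee 2 3 (-2) * ee 3 4 (-1) - 3 * ee 1 3 (-2) * ee 2 3 (-1) * ee 3 4 (-1)
      + 2 * ee 1 2 (-1) * (ee 2 3 (-1))^2 * ee 3 4 (-1)
      - ee 1 3 (-1) * ee 2 4 (-2) * (hh 1 (-1) + hh 2 (-1))
      - ee 1 3 (-2) * ee 2 4 (-1) * (hh 2 (-1) + hh 3 (-1))
      + ee 1 4 (-1) * ee 2 3 (-2) * (hh 1 (-1) + hh 2 (-1) + hh 3 (-1))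
      + ee 1 4 (-2) * ee 2 3 (-1) * hh 2 (-1)
      + scalar (2/3) * (ee 1 3 (-1) * ee 2 4 (-1) * (- hh 2 (-2) + hh 1 (-1) * hh 2 (-1) - hh 1 (-1) * hh 3 (-1) + (hh 2 (-1))^2 + hh 2 (-1) * hh 3 (-1)
          - ee 1 2 (-1) * ff 1 2 (-1) + 2 * ee 1 3 (-1) * ff 1 3 (-1) + 2 * ee 1 4 (-1) * ff 1 4 (-1)
          + 2 * ee 2 3 (-1) * ff 2 3 (-1) + 2 * ee 2 4 (-1) * ff 2 4 (-1) - ee 3 4 (-1) * ff 3 4 (-1)))
      + scalar (2/3) * (ee 1 4 (-1) * ee 2 3 (-1) * (hh 2 (-2) - hh 1 (-1) * hh 2 (-1) - 2 * hh 1 (-1) * hh 3 (-1) - (hh 2 (-1))^2 - hh 2 (-1) * hh 3 (-1)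
          + ee 1 2 (-1) * ff 1 2 (-1) - 2 * ee 1 3 (-1) * ff 1 3 (-1) - 2 * ee 1 4 (-1) * ff 1 4 (-1)
          - 2 * ee 2 3 (-1) * ff 2 3 (-1) - 2 * ee 2 4 (-1) * ff 2 4 (-1) + ee 3 4 (-1) * ff 3 4 (-1)))
      - 2 * ee 2 4 (-1) * ee 2 3 (-1) * ee 1 2 (-1) * hh 3 (-1)
      + 2 * ee 1 3 (-1) * ee 2 3 (-1) * ee 3 4 (-1) * hh 1 (-1)
      + 2 * ee 1 3 (-1) * ee 1 4 (-1) * ff 1 2 (-1) * hh 3 (-1)
      + ee 1 3 (-1) * ee 1 4 (-2) * ff 1 2 (-1) - ee 1 3 (-2) * ee 1 4 (-1) * ff 1 2 (-1)
      - 2 * (ee 1 3 (-1))^2 * ee 3 4 (-1) * ff 1 2 (-1)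
      - 2 * ee 1 4 (-1) * ee 2 4 (-1) * ff 3 4 (-1) * hh 1 (-1)
      + ee 1 4 (-1) * ee 2 4 (-2) * ff 3 4 (-1) - ee 1 4 (-2) * ee 2 4 (-1) * ff 3 4 (-1)
      - 2 * (ee 2 4 (-1))^2 * ee 1 2 (-1) * ff 3 4 (-1)
      + 2 * (ee 1 4 (-1))^2 * ff 1 2 (-1) * ff 3 4 (-1)) \<bullet>\<^sub>U vacuum)"
proof -
  define p where "p = apply_expr singular_expr [([], 1)]"
  note [simp del] = letter_op.simps apply_expr.simps denotation.simps
  have p_vector: "combination_vector p = denotation singular_expr \<bullet>\<^sub>U vacuum"
    by (simp add: p_def combination_vector_apply_expr combination_vector_Cons word_vector_def act_one)
  have killed: "letter_op x \<bullet>\<^sub>U combination_vector p = 0" if "apply_expr (Letter x) p = []" for x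
    using combination_vector_apply_expr[of "Letter x" p] that by (simp add: denotation.simps)
  have computation: "apply_expr (root_expr I1 I2 0) p = []" "apply_expr (root_expr I2 I3 0) p = []" "apply_expr (root_expr I3 I4 0) p = []"
    "apply_expr (root_expr I4 I1 1) p = []"
    "list_all (\<lambda>(w, c). weight_count I1 w = 1 \<and> weight_count I2 w = 1 \<and> weight_count I3 w = - 1 \<and>
       weight_count I4 w = - 1 \<and> total_mode w = - 4 \<and> list_all (\<lambda>x. mode_number x < 0) w) p"
    "(\<Sum>(w, c)\<leftarrow>p. c * eval_word 4 w) \<noteq> 0"
    using singular_expr_computation unfolding Let_def p_def by - (elim conjE, assumption)+
  have nonzero: "combination_vector p \<noteq> 0"
    by (rule combination_vector_nonzero[OF _ computation(6)])
       (use computation(5) in \<open>auto simp: list_all_iff\<close>)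
  have weight: "combination_vector p \<in> weight_space (\<lambda>x. - (5/2) * \<Lambda>\<^sub>0 x - 4 * \<delta> x + 2 * \<omega>\<^sub>2 x)"
    by (rule combination_vector_weight) (use computation(5) in \<open>auto simp: list_all_iff\<close>)
  have raising: "ee 1 2 0 \<bullet>\<^sub>U combination_vector p = 0" "ee 2 3 0 \<bullet>\<^sub>U combination_vector p = 0"
    "ee 3 4 0 \<bullet>\<^sub>U combination_vector p = 0" "ff 1 4 1 \<bullet>\<^sub>U combination_vector p = 0"
    using computation(1-4) unfolding root_expr_def by (simp_all add: root_letters act_mult killed)
  \<comment> \<open>Stated for an arbitrary \<open>u\<close>, so that the long expression enters
    only through unification with \<open>denotation_singular_expr\<close>. Singularity passes from
    \<open>96 u\<close> to \<open>u\<close> since 96 is invertible and scalars commute with every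
    operator.\<close>
  have singular: "singular_vector_of_weight (\<lambda>x. - (5/2) * \<Lambda>\<^sub>0 x - 4 * \<delta> x + 2 * \<omega>\<^sub>2 x) (u \<bullet>\<^sub>U vacuum)"
    if u: "denotation singular_expr = scalar 96 * u" for u
  proof -
    have "scalar (1/96) * denotation singular_expr = u"
      by (simp add: u scalar_mult_left)
    then have scaled: "u \<bullet>\<^sub>U vacuum = scalar (1/96) \<bullet>\<^sub>U combination_vector p"
      by (simp add: p_vector flip: act_mult)
    have "scalar 96 \<bullet>\<^sub>U u \<bullet>\<^sub>U vacuum = combination_vector p"
      by (simp add: p_vector u flip: act_mult)
    then have "u \<bullet>\<^sub>U vacuum \<noteq> 0" using nonzero by force
    moreover have commute: "x \<bullet>\<^sub>U scalar c \<bullet>\<^sub>U v = scalar c \<bullet>\<^sub>U x \<bullet>\<^sub>U v" for x c v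
      by (simp only: act_mult[symmetric] scalar_commute)
    have "x \<bullet>\<^sub>U u \<bullet>\<^sub>U vacuum = 0" if "x \<bullet>\<^sub>U combination_vector p = 0" for x
      unfolding scaled commute[of x] that by simp
    moreover have "u \<bullet>\<^sub>U vacuum \<in> weight_space \<mu>" if "combination_vector p \<in> weight_space \<mu>" for \<mu>
      unfolding weight_space_def mem_Collect_eq
    proof
      fix X assume "X \<in> cartan"
      with that have "emb X \<bullet>\<^sub>U combination_vector p = scalar (\<mu> X) \<bullet>\<^sub>U combination_vector p"
        by (simp add: weight_space_def)
      then show "emb X \<bullet>\<^sub>U u \<bullet>\<^sub>U vacuum = scalar (\<mu> X) \<bullet>\<^sub>U u \<bullet>\<^sub>U vacuum"
        unfolding scaled commute[of "emb X"] commute[of "scalar (\<mu> X)" "1/96"] by simp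
    qed
    ultimately show ?thesis
      unfolding singular_vector_of_weight_def using weight raising by blast
  qed
  show ?thesis
    by (rule singular) (rule denotation_singular_expr)
qed

end
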